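(* Let $d\ge1$ and $\ell\ge0$ be integers and let $s>0$. Then there is $\beta=\beta(d,\ell,s)>0$ such that for every sufficiently large constant integer $k$, \[\mathbb{P}\big(\mathfrak{h}(T^\cup_{n,d,\ell})<\beta\big)=O(n^{-s})\quad (n\to\infty),\] where the implied constant may depend on $d,\ell,s,k$.
   Context: For $\sigma=\{x_0<x_1<\dots<x_d\}\subset[n]$ and $\tau\in\binom{[n]}{d}$, let $I_{n,d}(\tau,\sigma)=(-1)^i$ if $\tau=\sigma\setminus\{x_i\}$ and $0$ otherwise. For $\sigma,\tau\in\binom{[n]}{d+1}$ with $|\sigma\cap\tau|=d$, set $J(\sigma,\tau)=I_{n,d}(\sigma\cap\tau,\sigma)I_{n,d}(\sigma\cap\tau,\tau)$. For $0\le\ell<n$, $P_{n,d,\ell}$ is the matrix indexed by $\binom{[n]}{d+1}\times\binom{[n]}{d+1}$ with $P_{n,d,\ell}(\sigma,\sigma)=\frac{d+1+\ell}{n+\ell}$, $P_{n,d,\ell}(\sigma,\tau)=\frac{1}{n+\ell}J(\sigma,\tau)$ if $|\sigma\cap\tau|=d$, and $0$ otherwise; it is symmetric with spectrum in $[0,1]$. The generalized determinantal hypertree $T_{n,d,\ell}$ is the determinantal random subset $X$ of $\binom{[n]}{d+1}$ with kernel $P_{n,d,\ell}$, i.e. $\mathbb{P}(A\subset X)=\det (P_{n,d,\ell})_A$ for all $A$ (where $Q_A$ is the principal submatrix on $A$); it is regarded as the simplicial complex on $[n]$ with complete $(d-1)$-skeleton and $d$-faces $X$. For $k\ge1$, $T^\cup_{n,d,\ell}$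 is the complex with complete $(d-1)$-skeleton on $[n]$ whose $d$-faces are $\bigcup_{i=1}^kT^i_{n,d,\ell}$, where $T^1_{n,d,\ell},\dots,T^k_{n,d,\ell}$ are i.i.d. copies of $T_{n,d,\ell}$. Coboundary expansion: for a $d$-dimensional complex $K$ and $0\le i\le d$, let $K(i)$ be its set of $i$-faces, $C^i(K,\mathbb{F}_2)$ the $\mathbb{F}_2$-valued functions on $K(i)$, $\delta_i$ the usual coboundary map, $B^i(K,\mathbb{F}_2)=\operatorname{Im}\delta_{i-1}$. The weight of an $i$-face $\sigma$ is $w(\sigma)=\frac{|\{\tau\in K(d):\sigma\subset\tau\}|}{\binom{d+1}{i+1}|K(d)|}$; $\|f\|=\sum_{\sigma\in\operatorname{supp}f}w(\sigma)$; $\|f+B^i\|=\min_{g\in f+B^i(K,\mathbb{F}_2)}\|g\|$. For $0\le i\le d-1$, $\mathfrak{h}_i(K)=\min_{f\in C^i\setminus B^i}\frac{\|\delta_if\|}{\|f+B^i\|}$ and $\mathfrak{h}(K)=\min_{0\le i\le d-1}\mathfrak{h}_i(K)$. *)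

theory Defs
  imports
    "HOL-Probability.Probability"
    "HOL-Probability.Product_PMF"
    "HOL-Combinatorics.Permutations"
    "HOL-Library.Ramsey"
    "HOL-Library.Z2"
    "HOL-Library.Landau_Symbols"
begin

text \<open>The ground set $[n]$ is \<^term>\<open>{1..n}\<close>, and $\binom{[n]}{m}$ is \<^term>\<open>nsets {1..n} m\<close>.\<close>

subsection \<open>The kernel and its determinantal measure\<close>

text \<open>The vertex $x_i$ is the \<open>i\<close>-th entry of the increasing enumeration of \<open>\<sigma>\<close>;
  at most one summand is nonzero.\<close>

definition incidence :: "nat set \<Rightarrow> nat set \<Rightarrow> real" where
  "incidence \<tau> \<sigma> =
     (\<Sum>i<card \<sigma>. if \<tau> = \<sigma> - {sorted_list_of_set \<sigma> ! i} then (-1) ^ i else 0)"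

definition J_sign :: "nat set \<Rightarrow> nat set \<Rightarrow> real" where
  "J_sign \<sigma> \<tau> = incidence (\<sigma> \<inter> \<tau>) \<sigma> * incidence (\<sigma> \<inter> \<tau>) \<tau>"

definition hypertree_kernel :: "nat \<Rightarrow> nat \<Rightarrow> nat \<Rightarrow> nat set \<Rightarrow> nat set \<Rightarrow> real" where
  "hypertree_kernel n d l \<sigma> \<tau> =
     (if \<sigma> = \<tau> then (real d + 1 + real l) / (real n + real l)
      else if card (\<sigma> \<inter> \<tau>) = d then J_sign \<sigma> \<tau> / (real n + real l)
      else 0)"

text \<open>Determinant of the principal submatrix on a finite index set (Leibniz formula).\<close>

definition principal_minor :: "('a \<Rightarrow> 'a \<Rightarrow> real) \<Rightarrow> 'a set \<Rightarrow> real" where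
  "principal_minor Q A =
     (\<Sum>\<pi> | \<pi> permutes A. of_int (sign \<pi>) * (\<Prod>a\<in>A. Q a (\<pi> a)))"

definition determinantal_law ::
    "'a set \<Rightarrow> ('a \<Rightarrow> 'a \<Rightarrow> real) \<Rightarrow> 'a set pmf \<Rightarrow> bool" where
  "determinantal_law V Q p \<longleftrightarrow>
     set_pmf p \<subseteq> Pow V \<and>
     (\<forall>A\<subseteq>V. measure_pmf.prob p {X. A \<subseteq> X} = principal_minor Q A)"

definition hypertree_law :: "nat \<Rightarrow> nat \<Rightarrow> nat \<Rightarrow> nat set set pmf \<Rightarrow> bool" where
  "hypertree_law n d l p \<longleftrightarrow>
     determinantal_law (nsets {1..n} (d + 1)) (hypertree_kernel n d l) p"

text \<open>Complexes contain the empty face.\<close>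

definition skeleton_complex :: "nat \<Rightarrow> nat \<Rightarrow> nat set set \<Rightarrow> nat set set" where
  "skeleton_complex n d X = {\<sigma>. \<sigma> \<subseteq> {1..n} \<and> card \<sigma> \<le> d} \<union> X"

subsection \<open>Coboundary expansion\<close>

text \<open>Dimensions are integers, so that the empty set is the unique face of dimension $-1$.
  Hence $B^0$ is the image of the augmentation $\delta_{-1}$, that is, it consists of the
  constant functions on the vertices. A cochain is extended by zero outside its faces.\<close>

definition faces :: "'v set set \<Rightarrow> int \<Rightarrow> 'v set set" where
  "faces K i = {\<sigma>\<in>K. finite \<sigma> \<and> int (card \<sigma>) = i + 1}"

definition cochains :: "'v set set \<Rightarrow> int \<Rightarrow> ('v set \<Rightarrow> bit) set" where
  "cochains K i = {f. \<forall>\<sigma>. \<sigma> \<notin> faces K i \<longrightarrow> f \<sigma> = 0}"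

definition coboundary :: "'v set set \<Rightarrow> int \<Rightarrow> ('v set \<Rightarrow> bit) \<Rightarrow> 'v set \<Rightarrow> bit" where
  "coboundary K i f =
     (\<lambda>\<tau>. if \<tau> \<in> faces K (i + 1) then \<Sum>\<sigma> | \<sigma> \<in> faces K i \<and> \<sigma> \<subseteq> \<tau>. f \<sigma> else 0)"

definition coboundaries :: "'v set set \<Rightarrow> int \<Rightarrow> ('v set \<Rightarrow> bit) set" where
  "coboundaries K i = coboundary K (i - 1) ` cochains K (i - 1)"

text \<open>In all of the following, \<open>d\<close> is the dimension of \<open>K\<close>. An \<open>i\<close>-face has \<open>i + 1\<close> elements,
  so the binomial coefficient is $\binom{d+1}{i+1}$.\<close>

definition face_weight :: "'v set set \<Rightarrow> nat \<Rightarrow> 'v set \<Rightarrow> real" where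
  "face_weight K d \<sigma> =
     real (card {\<tau> \<in> faces K (int d). \<sigma> \<subseteq> \<tau>}) /
     (real ((d + 1) choose card \<sigma>) * real (card (faces K (int d))))"

definition cochain_norm :: "'v set set \<Rightarrow> nat \<Rightarrow> ('v set \<Rightarrow> bit) \<Rightarrow> real" where
  "cochain_norm K d f = (\<Sum>\<sigma> | f \<sigma> \<noteq> 0. face_weight K d \<sigma>)"

definition coset_norm :: "'v set set \<Rightarrow> nat \<Rightarrow> int \<Rightarrow> ('v set \<Rightarrow> bit) \<Rightarrow> real" where
  "coset_norm K d i f =
     Min ((\<lambda>b. cochain_norm K d (\<lambda>\<sigma>. f \<sigma> + b \<sigma>)) ` coboundaries K i)"

definition expansion_at :: "'v set set \<Rightarrow> nat \<Rightarrow> int \<Rightarrow> real" where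
  "expansion_at K d i =
     Min ((\<lambda>f. cochain_norm K d (coboundary K i f) / coset_norm K d i f) `
       (cochains K i - coboundaries K i))"

definition coboundary_expansion :: "'v set set \<Rightarrow> nat \<Rightarrow> real" where
  "coboundary_expansion K d = Min (expansion_at K d ` {0..int d - 1})"

end

theory Submission
  imports Defs
begin

text \<open>
  The expected value of $x^{|X \cap A|}$ is the principal minor on $A$ of $I + (x - 1) P$. Hadamard's
  inequality bounds it by $\exp((x-1)\, p\, |A|)$, with $p$ the constant diagonal entry of $P$, so that
  $W(A) = \sum_i |T^i \cap A|$ obeys Chernoff bounds. Since $I - P$ is singular on the star of a
  $(d-1)$-face, every copy covers every $(d-1)$-face.

  Call a set $S$ of $d$-sets containing $\rho$ minimal if adding a coboundary in the link of $\rho$ does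
  not make it smaller. By descending induction on $|\rho|$, with high probability every minimal $S$
  satisfies $k|S| + W(\{\tau : \tau \supseteq \sigma \in S\}) \le C\, W(\delta S)$, with $C$ independent
  of $k$. If $|S|$ is a positive fraction of $n^D$, where $D = d - |\rho|$, this follows from the cone
  inequality for the complete complex, a Chernoff bound and a union bound over all $S$. If
  $|S| = t^{2^D} n^D$ with $t$ small, call $\pi \supseteq \rho$ heavy if at least
  $t^{2^{d-|\pi|}-1} n^{d-|\pi|}$ elements of $S$ contain it. Only $O(t n |S|)$ of the $d$-faces contain two
  heavy sets with non-heavy intersection; by the Chernoff bound with $x = 1/t$ they are negligible,
  simultaneously for all $S$. In every other $d$-face the elements of $S$ all contain the least
  heavy subset $\pi$ of the face, so the coboundary is computed in the link of $\pi$ and the induction applies.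

  Finally, with high probability no $d$-face lies in more than a constant number, independent of $k$, of
  the $T^i$, so that $W$ and the number of faces of the union are comparable.
\<close>

section \<open>Principal minors\<close>

text \<open>The obstacle is the union bound over sparse \<open>S\<close>. Among N sets there are
  about exp(m ln(N/m)) choices of m of them, while the lower tail of W gains at most its mean, which
  may be only of order k m. With k constant this suffices only if m is a fixed fraction of N. For
  sparse \<open>S\<close> an upper tail replaces the lower one: a set of faces with mean of order t
  k m admits the parameter 1/t and gains k m ln(1/t), and this matches the entropy because |S| / n^D
  is a power of t. What remains passes to smaller links, in which the stars of heavy sets are
  denser. The exponents of t roughly double with each codimension, which leaves a spare factor t
  whenever two heavy sets meet in a non-heavy one. The constants are chosen in the order C for the
  smaller links, tolerated share of bad faces, density threshold, and only then k; so the final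
  bound does not see k. Only cochains of degree d - 1 need this analysis: in lower degrees the
  layers of faces are complete, and it is enough that all degrees are comparable.\<close>

lemma principal_minor_identity_plus:
  assumes A: "finite A"
  shows "principal_minor (\<lambda>a b. (if a = b then 1 else 0) + y * Q a b) A
       = (\<Sum>B\<in>Pow A. y ^ card B * principal_minor Q B)"
proof -
  have expand: "(\<Prod>a\<in>A. (if a = \<pi> a then 1 else 0) + y * Q a (\<pi> a))
      = (\<Sum>B\<in>Pow A. (\<Prod>a\<in>B. y * Q a (\<pi> a)) * (\<Prod>a\<in>A - B. if a = \<pi> a then 1 else 0))" for \<pi>
    using prod_add[OF A, of "\<lambda>a. y * Q a (\<pi> a)" "\<lambda>a. if a = \<pi> a then 1 else 0"]
    by (simp add: add.commute)
  \<comment> \<open>A permutation of \<open>A\<close> survives in the summand of \<open>B\<close>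
    only if it fixes \<open>A - B\<close> pointwise, that is, if it permutes
    \<open>B\<close>.\<close>
  have summand: "(\<Sum>\<pi> | \<pi> permutes A. of_int (sign \<pi>) *
       ((\<Prod>a\<in>B. y * Q a (\<pi> a)) * (\<Prod>a\<in>A - B. if a = \<pi> a then 1 else 0)))
      = y ^ card B * principal_minor Q B" if B: "B \<subseteq> A" for B
  proof -
    have "(\<Sum>\<pi> | \<pi> permutes A. of_int (sign \<pi>) *
       ((\<Prod>a\<in>B. y * Q a (\<pi> a)) * (\<Prod>a\<in>A - B. if a = \<pi> a then 1 else 0)))
      = (\<Sum>\<pi> | \<pi> permutes B. of_int (sign \<pi>) *
       ((\<Prod>a\<in>B. y * Q a (\<pi> a)) * (\<Prod>a\<in>A - B. if a = \<pi> a then 1 else 0)))"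
    proof (rule sum.mono_neutral_right)
      show "finite {\<pi>. \<pi> permutes A}" using A by (rule finite_permutations)
      show "{\<pi>. \<pi> permutes B} \<subseteq> {\<pi>. \<pi> permutes A}"
        using B permutes_subset by blast
      show "\<forall>\<pi>\<in>{\<pi>. \<pi> permutes A} - {\<pi>. \<pi> permutes B}. of_int (sign \<pi>) *
        ((\<Prod>a\<in>B. y * Q a (\<pi> a)) * (\<Prod>a\<in>A - B. if a = \<pi> a then 1 else 0)) = 0"
      proof
        fix \<pi> assume "\<pi> \<in> {\<pi>. \<pi> permutes A} - {\<pi>. \<pi> permutes B}"
        then obtain a where "a \<in> A - B" "\<pi> a \<noteq> a"
          using permutes_superset[of \<pi> A B] by auto
        then have "(\<Prod>a\<in>A - B. if a = \<pi> a then 1 else 0) = (0::real)"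
          using A by (intro prod_zero bexI[of _ a]) auto
        then show "of_int (sign \<pi>) * ((\<Prod>a\<in>B. y * Q a (\<pi> a)) *
            (\<Prod>a\<in>A - B. if a = \<pi> a then 1 else 0)) = 0" by simp
      qed
    qed
    also have "\<dots> = (\<Sum>\<pi> | \<pi> permutes B. y ^ card B * (of_int (sign \<pi>) * (\<Prod>a\<in>B. Q a (\<pi> a))))"
    proof (rule sum.cong[OF refl])
      fix \<pi> assume "\<pi> \<in> {\<pi>. \<pi> permutes B}"
      then have "(\<Prod>a\<in>A - B. if a = \<pi> a then 1 else 0) = (1::real)"
        by (intro prod.neutral) (auto simp: permutes_def)
      then show "of_int (sign \<pi>) * ((\<Prod>a\<in>B. y * Q a (\<pi> a)) *
          (\<Prod>a\<in>A - B. if a = \<pi> a then 1 else 0))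
          = y ^ card B * (of_int (sign \<pi>) * (\<Prod>a\<in>B. Q a (\<pi> a)))"
        by (simp add: prod.distrib)
    qed
    also have "\<dots> = y ^ card B * principal_minor Q B"
      by (simp add: principal_minor_def sum_distrib_left)
    finally show ?thesis .
  qed
  have "principal_minor (\<lambda>a b. (if a = b then 1 else 0) + y * Q a b) A
     = (\<Sum>B\<in>Pow A. \<Sum>\<pi> | \<pi> permutes A. of_int (sign \<pi>) *
       ((\<Prod>a\<in>B. y * Q a (\<pi> a)) * (\<Prod>a\<in>A - B. if a = \<pi> a then 1 else 0)))"
    unfolding principal_minor_def expand sum_distrib_left by (rule sum.swap)
  also have "\<dots> = (\<Sum>B\<in>Pow A. y ^ card B * principal_minor Q B)"
    by (intro sum.cong refl summand) auto
  finally show ?thesis .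
qed

lemma principal_minor_cong:
  assumes "\<And>a b. a \<in> A \<Longrightarrow> b \<in> A \<Longrightarrow> Q a b = R a b"
  shows "principal_minor Q A = principal_minor R A"
  unfolding principal_minor_def
proof (intro sum.cong refl)
  fix \<pi> assume "\<pi> \<in> {\<pi>. \<pi> permutes A}"
  then have "(\<Prod>a\<in>A. Q a (\<pi> a)) = (\<Prod>a\<in>A. R a (\<pi> a))"
    using assms by (intro prod.cong refl) (auto simp: permutes_in_image)
  then show "of_int (sign \<pi>) * (\<Prod>a\<in>A. Q a (\<pi> a)) = of_int (sign \<pi>) * (\<Prod>a\<in>A. R a (\<pi> a))"
    by simp
qed

lemma principal_minor_zero_row:
  assumes "finite A" "a \<in> A" "\<And>b. b \<in> A \<Longrightarrow> Q a b = 0"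
  shows "principal_minor Q A = 0"
  unfolding principal_minor_def
proof (intro sum.neutral ballI)
  fix \<pi> assume "\<pi> \<in> {\<pi>. \<pi> permutes A}"
  then have "(\<Prod>a\<in>A. Q a (\<pi> a)) = 0"
    using assms by (intro prod_zero bexI[of _ a]) (auto simp: permutes_in_image)
  then show "of_int (sign \<pi>) * (\<Prod>a\<in>A. Q a (\<pi> a)) = 0" by simp
qed

lemma principal_minor_equal_rows:
  assumes A: "finite A" "a \<in> A" "b \<in> A" "a \<noteq> b" and eq: "Q a = Q b"
  shows "principal_minor Q A = 0"
proof -
  let ?t = "Transposition.transpose a b"
  have t: "?t permutes A" using A by (simp add: permutes_swap_id)
  have "principal_minor Q A
      = (\<Sum>\<pi> | \<pi> permutes A. of_int (sign (\<pi> \<circ> ?t)) * (\<Prod>c\<in>A. Q c ((\<pi> \<circ> ?t) c)))"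
    unfolding principal_minor_def by (rule sum_permutations_compose_right[OF t])
  also have "\<dots> = (\<Sum>\<pi> | \<pi> permutes A. - (of_int (sign \<pi>) * (\<Prod>c\<in>A. Q c (\<pi> c))))"
  proof (intro sum.cong refl)
    fix \<pi> assume "\<pi> \<in> {\<pi>. \<pi> permutes A}"
    then have "permutation \<pi>" using A permutes_imp_permutation by blast
    moreover have "permutation ?t" using A t permutes_imp_permutation by blast
    ultimately have s: "sign (\<pi> \<circ> ?t) = - sign \<pi>"
      using A by (simp add: sign_compose sign_swap_id)
    have "Q (?t c) = Q c" for c using eq by (auto simp: Transposition.transpose_def)
    then have "(\<Prod>c\<in>A. Q c ((\<pi> \<circ> ?t) c)) = (\<Prod>c\<in>A. ((\<lambda>c. Q c (\<pi> c)) \<circ> ?t) c)"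
      by simp
    also have "\<dots> = (\<Prod>c\<in>A. Q c (\<pi> c))"
      using prod.permute[OF t, of "\<lambda>c. Q c (\<pi> c)"] by (simp add: comp_def)
    finally show "of_int (sign (\<pi> \<circ> ?t)) * (\<Prod>c\<in>A. Q c ((\<pi> \<circ> ?t) c))
        = - (of_int (sign \<pi>) * (\<Prod>c\<in>A. Q c (\<pi> c)))"
      by (simp add: s)
  qed
  also have "\<dots> = - principal_minor Q A"
    by (simp add: principal_minor_def sum_negf)
  finally show ?thesis by simp
qed

lemma principal_minor_row_linear:
  assumes A: "finite A" "a \<in> A"
  shows "principal_minor (Q(a := \<lambda>c. u c + w * v c)) A
       = principal_minor (Q(a := u)) A + w * principal_minor (Q(a := v)) A"
proof -
  have split: "(\<Prod>c\<in>A. (Q(a := r)) c (\<pi> c)) = r (\<pi> a) * (\<Prod>c\<in>A - {a}. Q c (\<pi> c))" for r \<pi>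
    using A by (simp add: prod.remove[of A a])
  show ?thesis
    unfolding principal_minor_def split
    by (simp add: sum_distrib_left sum.distrib[symmetric] algebra_simps)
qed

lemma principal_minor_add_row:
  assumes A: "finite A" "a \<in> A" "b \<in> A" "a \<noteq> b"
  shows "principal_minor (Q(a := \<lambda>c. Q a c + w * Q b c)) A = principal_minor Q A"
proof -
  have "principal_minor (Q(a := Q b)) A = 0"
    using A by (intro principal_minor_equal_rows[of A a b]) auto
  then show ?thesis
    using principal_minor_row_linear[OF A(1,2), of Q "Q a" w "Q b"] by simp
qed

text \<open>Here \<open>v\<close> is a left null vector. Adding \<open>v b / v a\<close> times row
  \<open>b\<close> to row \<open>a\<close>, for all other \<open>b\<close>, preserves the minor and
  turns row \<open>a\<close> into zero.\<close>

lemma principal_minor_null_vector: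
  assumes A: "finite A" "a \<in> A" and v: "v a \<noteq> 0"
    and null: "\<And>c. c \<in> A \<Longrightarrow> (\<Sum>b\<in>A. v b * Q b c) = 0"
  shows "principal_minor Q A = 0"
proof -
  have "principal_minor (Q(a := \<lambda>c. Q a c + (\<Sum>b\<in>B. v b / v a * Q b c))) A = principal_minor Q A"
    if "B \<subseteq> A - {a}" for B
    using finite_subset[OF that] A that
  proof (induction B rule: infinite_finite_induct)
    case (insert b B)
    let ?R = "Q(a := \<lambda>c. Q a c + (\<Sum>b\<in>B. v b / v a * Q b c))"
    have "Q(a := \<lambda>c. Q a c + (\<Sum>b\<in>insert b B. v b / v a * Q b c))
        = ?R(a := \<lambda>c. ?R a c + v b / v a * ?R b c)"
      using insert by (auto simp: fun_eq_iff)
    moreover have "principal_minor (?R(a := \<lambda>c. ?R a c + v b / v a * ?R b c)) A = principal_minor ?R A"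
      using insert.prems A by (intro principal_minor_add_row) auto
    moreover have "principal_minor ?R A = principal_minor Q A"
      using insert by blast
    ultimately show ?case by metis
  qed auto
  from this[of "A - {a}"]
  have "principal_minor Q A = principal_minor (Q(a := \<lambda>c. Q a c + (\<Sum>b\<in>A-{a}. v b / v a * Q b c))) A"
    by simp
  also have "\<dots> = 0"
  proof (rule principal_minor_zero_row[OF A])
    fix c assume "c \<in> A"
    have "Q a c + (\<Sum>b\<in>A-{a}. v b / v a * Q b c) = (\<Sum>b\<in>A. v b / v a * Q b c)"
      using A v by (simp add: sum.remove)
    also have "\<dots> = (\<Sum>b\<in>A. v b * Q b c) / v a" by (simp add: sum_divide_distrib)
    also have "\<dots> = 0" using null[OF \<open>c \<in> A\<close>] by simp
    finally show "(Q(a := \<lambda>c. Q a c + (\<Sum>b\<in>A-{a}. v b / v a * Q b c))) a c = 0" by simp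
  qed
  finally show ?thesis .
qed

text \<open>The Schur complement formula. Once column \<open>a\<close> is cleared outside the pivot,
  a permutation that moves \<open>a\<close> must send some element of \<open>A\<close> to
  \<open>a\<close> and meets a zero there.\<close>

lemma principal_minor_pivot:
  assumes A: "finite A" "a \<notin> A" and pivot: "Q a a \<noteq> 0"
  shows "principal_minor Q (insert a A)
       = Q a a * principal_minor (\<lambda>b c. Q b c - Q b a * Q a c / Q a a) A"
proof -
  define R where "R B = (\<lambda>b c. if b \<in> B then Q b c - Q b a / Q a a * Q a c else Q b c)" for B
  have "principal_minor (R B) (insert a A) = principal_minor Q (insert a A)" if "B \<subseteq> A" for B
    using finite_subset[OF that A(1)] that
  proof (induction B)
    case empty
    then show ?case by (simp add: R_def)
  next
    case (insert b B)
    have "R (insert b B) = (R B)(b := \<lambda>c. R B b c + (- (Q b a / Q a a)) * R B a c)"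
      using insert A by (auto simp: R_def fun_eq_iff)
    then have "principal_minor (R (insert b B)) (insert a A) = principal_minor (R B) (insert a A)"
      using insert.prems A principal_minor_add_row[of "insert a A" b a "R B" "- (Q b a / Q a a)"] by auto
    then show ?case using insert by simp
  qed
  from this[of A] have "principal_minor Q (insert a A) = principal_minor (R A) (insert a A)" by simp
  also have "\<dots> = (\<Sum>\<pi> | \<pi> permutes A. of_int (sign \<pi>) * (\<Prod>c\<in>insert a A. R A c (\<pi> c)))"
    unfolding principal_minor_def
  proof (rule sum.mono_neutral_right)
    show "finite {\<pi>. \<pi> permutes insert a A}" using A by (simp add: finite_permutations)
    show "{\<pi>. \<pi> permutes A} \<subseteq> {\<pi>. \<pi> permutes insert a A}"
      using permutes_subset by blast
    show "\<forall>\<pi>\<in>{\<pi>. \<pi> permutes insert a A} - {\<pi>. \<pi> permutes A}.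
        of_int (sign \<pi>) * (\<Prod>c\<in>insert a A. R A c (\<pi> c)) = 0"
    proof
      fix \<pi> assume \<pi>: "\<pi> \<in> {\<pi>. \<pi> permutes insert a A} - {\<pi>. \<pi> permutes A}"
      then have per: "\<pi> permutes insert a A" by simp
      have "\<pi> a \<noteq> a" using \<pi> permutes_superset[OF per, of A] A by auto
      obtain b where b: "\<pi> b = a" "b \<in> insert a A"
        using per by (metis insertI1 permutes_def)
      then have "b \<in> A" using \<open>\<pi> a \<noteq> a\<close> by auto
      then have "R A b (\<pi> b) = 0" using pivot b by (simp add: R_def)
      then have "(\<Prod>c\<in>insert a A. R A c (\<pi> c)) = 0"
        using b A by (intro prod_zero bexI[of _ b]) auto
      then show "of_int (sign \<pi>) * (\<Prod>c\<in>insert a A. R A c (\<pi> c)) = 0" by simp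
    qed
  qed
  also have "\<dots> = (\<Sum>\<pi> | \<pi> permutes A. Q a a * (of_int (sign \<pi>) * (\<Prod>c\<in>A. R A c (\<pi> c))))"
  proof (intro sum.cong refl)
    fix \<pi> assume "\<pi> \<in> {\<pi>. \<pi> permutes A}"
    then have "\<pi> a = a" using A by (auto simp: permutes_def)
    then show "of_int (sign \<pi>) * (\<Prod>c\<in>insert a A. R A c (\<pi> c))
        = Q a a * (of_int (sign \<pi>) * (\<Prod>c\<in>A. R A c (\<pi> c)))"
      using A by (simp add: R_def)
  qed
  also have "\<dots> = Q a a * principal_minor (R A) A"
    by (simp add: principal_minor_def sum_distrib_left)
  also have "principal_minor (R A) A = principal_minor (\<lambda>b c. Q b c - Q b a * Q a c / Q a a) A"
    by (rule principal_minor_cong) (simp add: R_def)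
  finally show ?thesis .
qed

lemma principal_minor_empty [simp]: "principal_minor Q {} = 1"
  by (simp add: principal_minor_def)

lemma principal_minor_singleton [simp]: "principal_minor Q {a} = Q a a"
  by (simp add: principal_minor_def)

text \<open>Nonnegativity of all principal minors passes to Schur complements, which drives the induction.\<close>

lemma hadamard_inequality:
  assumes "finite A"
    and "\<And>a b. a \<in> A \<Longrightarrow> b \<in> A \<Longrightarrow> Q a b = Q b a"
    and "\<And>B. B \<subseteq> A \<Longrightarrow> principal_minor Q B \<ge> 0"
  shows "principal_minor Q A \<le> (\<Prod>a\<in>A. Q a a)"
  using assms
proof (induction A arbitrary: Q rule: finite_induct)
  case (insert a A)
  have diag: "Q b b \<ge> 0" if "b \<in> insert a A" for b
    using insert.prems(2)[of "{b}"] that by simp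
  show ?case
  proof (cases "Q a a = 0")
    case True
    \<comment> \<open>A zero on the diagonal forces a zero row: otherwise the minor on
      \<open>{a, b}\<close> would be minus the square of a nonzero number.\<close>
    have "Q a b = 0" if "b \<in> A" for b
    proof (rule ccontr)
      assume nz: "Q a b \<noteq> 0"
      have ab: "a \<noteq> b" using that insert by auto
      have sym: "Q b a = Q a b" using that insert.prems(1) by auto
      have pm: "principal_minor Q {a, b} = - (Q a b * Q a b)"
      proof (cases "Q b b = 0")
        case bb: True
        \<comment> \<open>With both diagonal entries zero there is no pivot; adding row
          \<open>a\<close> to row \<open>b\<close> puts the nonzero number \<open>Q a b\<close> on
          the diagonal.\<close>
        let ?Q = "Q(b := \<lambda>c. Q b c + 1 * Q a c)"
        have "principal_minor Q {a, b} = principal_minor ?Q {b, a}"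
          using principal_minor_add_row[of "{b, a}" b a Q 1] ab by (simp add: insert_commute)
        also have "\<dots> = - (Q a b * Q a b)"
          using nz ab True bb sym by (subst principal_minor_pivot) auto
        finally show ?thesis .
      next
        case bb: False
        have "principal_minor Q {a, b} = principal_minor Q {b, a}" by (simp add: insert_commute)
        also have "\<dots> = - (Q a b * Q a b)"
          using bb ab True sym by (subst principal_minor_pivot) auto
        finally show ?thesis .
      qed
      have "principal_minor Q {a, b} \<ge> 0" using insert.prems(2) that by auto
      moreover have "Q a b * Q a b > 0" using nz by (simp add: zero_less_mult_iff) linarith
      ultimately show False using pm by linarith
    qed
    then have "principal_minor Q (insert a A) = 0"
      using insert.hyps True by (intro principal_minor_zero_row[of _ a]) auto
    moreover have "(\<Prod>b\<in>insert a A. Q b b) = 0" using True insert.hyps by simp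
    ultimately show ?thesis by simp
  next
    case False
    then have pos: "Q a a > 0" using diag[of a] by simp
    let ?R = "\<lambda>b c. Q b c - Q b a * Q a c / Q a a"
    have minors: "principal_minor ?R B \<ge> 0" if "B \<subseteq> A" for B
    proof -
      have "finite B" "a \<notin> B" using that insert.hyps finite_subset by auto
      then have "Q a a * principal_minor ?R B \<ge> 0"
        using principal_minor_pivot[of B a Q] insert.prems(2)[of "insert a B"] that False by auto
      then show ?thesis using pos by (simp add: zero_le_mult_iff)
    qed
    have "principal_minor ?R A \<le> (\<Prod>b\<in>A. ?R b b)"
    proof (rule insert.IH)
      fix b c assume "b \<in> A" "c \<in> A"
      then show "?R b c = ?R c b"
        using insert.prems(1)[of b c] insert.prems(1)[of a b] insert.prems(1)[of a c] by simp
    qed (use minors in auto)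
    also have "\<dots> \<le> (\<Prod>b\<in>A. Q b b)"
    proof (intro prod_mono conjI)
      fix b assume b: "b \<in> A"
      show "0 \<le> ?R b b" using minors[of "{b}"] b by simp
      have "Q b a = Q a b" using insert.prems(1)[of a b] b by simp
      then have "Q b a * Q a b / Q a a \<ge> 0" using pos by simp
      then show "?R b b \<le> Q b b" by simp
    qed
    finally have "Q a a * principal_minor ?R A \<le> Q a a * (\<Prod>b\<in>A. Q b b)"
      using pos by simp
    then show ?thesis
      using principal_minor_pivot[of A a Q] insert.hyps False by simp
  qed
qed simp

section \<open>Moments of the determinantal process\<close>

text \<open>Writing x as (x - 1) + 1 expands the power over the subsets of
  \<open>X \<inter> A\<close>. The law turns each inclusion probability into a minor, and the sum is
  then recognised as an expanded determinant.\<close>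

lemma determinantal_pgf:
  assumes law: "determinantal_law V Q p" and V: "finite V" "A \<subseteq> V"
  shows "measure_pmf.expectation p (\<lambda>X. x ^ card (X \<inter> A))
       = principal_minor (\<lambda>a b. (if a = b then 1 else 0) + (x - 1) * Q a b) A"
proof -
  have A: "finite A" using V finite_subset by blast
  have fin: "finite (set_pmf p)"
    using law V unfolding determinantal_law_def by (meson finite_Pow_iff finite_subset)
  have pw: "x ^ card (X \<inter> A) = (\<Sum>B\<in>Pow A. (x - 1) ^ card B * indicator {X. B \<subseteq> X} X)" for X
  proof -
    have "x ^ card (X \<inter> A) = (\<Prod>a\<in>X \<inter> A. (x - 1) + 1)" by simp
    also have "\<dots> = (\<Sum>B\<in>Pow (X \<inter> A). (x - 1) ^ card B)"
      using A by (subst prod_add) auto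
    also have "\<dots> = (\<Sum>B\<in>Pow A. (x - 1) ^ card B * indicator {X. B \<subseteq> X} X)"
      using A by (intro sum.mono_neutral_cong_left) (auto simp: indicator_def)
    finally show ?thesis .
  qed
  have "measure_pmf.expectation p (\<lambda>X. x ^ card (X \<inter> A))
      = (\<Sum>B\<in>Pow A. (x - 1) ^ card B * measure_pmf.prob p {X. B \<subseteq> X})"
    unfolding pw by (subst Bochner_Integration.integral_sum)
      (auto intro!: integrable_measure_pmf_finite fin)
  also have "\<dots> = (\<Sum>B\<in>Pow A. (x - 1) ^ card B * principal_minor Q B)"
    using law V unfolding determinantal_law_def by (intro sum.cong refl) auto
  finally show ?thesis by (simp add: principal_minor_identity_plus[OF A])
qed

text \<open>Hadamard's inequality needs nonnegative minors, and each of them is itself the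
  expectation of a nonnegative variable. Hence no spectral information on the kernel enters, and
  \<open>x < 1\<close> and \<open>x > 1\<close> are treated alike.\<close>

lemma determinantal_pgf_le:
  assumes law: "determinantal_law V Q p" and V: "finite V" "A \<subseteq> V" and x: "x \<ge> 0"
    and sym: "\<And>a b. Q a b = Q b a" and diag: "\<And>a. a \<in> V \<Longrightarrow> Q a a = q"
  shows "measure_pmf.expectation p (\<lambda>X. x ^ card (X \<inter> A)) \<le> exp ((x - 1) * q * real (card A))"
proof -
  let ?M = "\<lambda>a b. (if a = b then 1 else 0) + (x - 1) * Q a b"
  have A: "finite A" using V finite_subset by blast
  have nonneg: "principal_minor ?M B \<ge> 0" if "B \<subseteq> A" for B
  proof -
    have "B \<subseteq> V" using that V by blast
    from determinantal_pgf[OF law V(1) this, of x] have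
      "principal_minor ?M B = measure_pmf.expectation p (\<lambda>X. x ^ card (X \<inter> B))" by simp
    also have "\<dots> \<ge> 0" using x by (intro Bochner_Integration.integral_nonneg) auto
    finally show ?thesis .
  qed
  have "principal_minor ?M A \<le> (\<Prod>a\<in>A. ?M a a)"
    by (rule hadamard_inequality[OF A]) (use sym nonneg in auto)
  also have "\<dots> \<le> (\<Prod>a\<in>A. exp ((x - 1) * q))"
  proof (intro prod_mono conjI)
    fix a assume a: "a \<in> A"
    show "0 \<le> ?M a a" using nonneg[of "{a}"] a by simp
    show "?M a a \<le> exp ((x - 1) * q)" using diag a V exp_ge_add_one_self by auto
  qed
  also have "\<dots> = exp ((x - 1) * q * real (card A))"
    by (simp add: exp_of_nat_mult[symmetric] mult.commute)
  finally show ?thesis using determinantal_pgf[OF law V, of x] by simp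
qed

text \<open>The diagonal entry of the kernel, which is the probability that one copy contains a
  given \<open>d\<close>-face.\<close>

definition rate :: "nat \<Rightarrow> nat \<Rightarrow> nat \<Rightarrow> real" where
  "rate n d l = (real d + 1 + real l) / (real n + real l)"

lemma hypertree_pgf_le:
  assumes "hypertree_law n d l p" "A \<subseteq> nsets {1..n} (d + 1)" "x \<ge> 0"
  shows "measure_pmf.expectation p (\<lambda>X. x ^ card (X \<inter> A)) \<le> exp ((x - 1) * rate n d l * real (card A))"
  using assms unfolding hypertree_law_def
  by (intro determinantal_pgf_le[where Q = "hypertree_kernel n d l"])
    (auto simp: hypertree_kernel_def J_sign_def rate_def Int_commute mult.commute finite_imp_finite_nsets)

section \<open>Every copy covers all codimension-one faces\<close>

lemma incidence_square:
  assumes "x \<notin> \<rho>" "finite \<rho>"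
  shows "incidence \<rho> (insert x \<rho>) * incidence \<rho> (insert x \<rho>) = 1"
proof -
  define s where "s = sorted_list_of_set (insert x \<rho>)"
  have s: "set s = insert x \<rho>" "distinct s" "length s = card (insert x \<rho>)"
    using assms unfolding s_def
    by (simp_all only: set_sorted_list_of_set distinct_sorted_list_of_set length_sorted_list_of_set finite_insert)
  obtain i where i: "i < length s" "s ! i = x"
    using s(1) by (metis in_set_conv_nth insertI1)
  have iff: "\<rho> = insert x \<rho> - {s ! j} \<longleftrightarrow> j = i" if "j < length s" for j
  proof
    assume "\<rho> = insert x \<rho> - {s ! j}"
    then have "s ! j = x" using assms(1) by blast
    then show "j = i" using nth_eq_iff_index_eq[OF s(2) that i(1)] i(2) by simp
  next
    assume "j = i"
    then show "\<rho> = insert x \<rho> - {s ! j}" using i(2) assms(1) by simp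
  qed
  have "incidence \<rho> (insert x \<rho>) = (\<Sum>j<length s. if \<rho> = insert x \<rho> - {s ! j} then (-1) ^ j else 0)"
    unfolding incidence_def s_def[symmetric] s(3) ..
  also have "\<dots> = (\<Sum>j<length s. if j = i then (-1) ^ j else 0)"
    by (intro sum.cong refl if_cong) (simp_all only: iff lessThan_iff)
  also have "\<dots> = (-1) ^ i" using i by simp
  finally show ?thesis by (simp flip: power_add)
qed

lemma star_of_codim_one:
  assumes "\<rho> \<in> nsets A d"
  shows "{\<tau> \<in> nsets A (d + 1). \<rho> \<subseteq> \<tau>} = (\<lambda>x. insert x \<rho>) ` (A - \<rho>)"
proof (intro equalityI subsetI)
  fix \<tau> assume "\<tau> \<in> {\<tau> \<in> nsets A (d + 1). \<rho> \<subseteq> \<tau>}"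
  then have \<tau>: "\<tau> \<subseteq> A" "finite \<tau>" "card \<tau> = d + 1" "\<rho> \<subseteq> \<tau>" by (auto simp: nsets_def)
  moreover have "card \<rho> = d" "finite \<rho>" using assms by (auto simp: nsets_def)
  ultimately have "card (\<tau> - \<rho>) = 1" by (simp add: card_Diff_subset)
  then obtain x where x: "\<tau> - \<rho> = {x}" by (auto simp: card_1_singleton_iff)
  then have "\<tau> = insert x \<rho>" using \<tau> by auto
  moreover have "x \<in> A - \<rho>" using x \<tau>(1) by blast
  ultimately show "\<tau> \<in> (\<lambda>x. insert x \<rho>) ` (A - \<rho>)" by blast
next
  fix \<tau> assume "\<tau> \<in> (\<lambda>x. insert x \<rho>) ` (A - \<rho>)"
  then obtain x where "\<tau> = insert x \<rho>" "x \<in> A" "x \<notin> \<rho>" by blast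
  moreover have "\<rho> \<subseteq> A" "finite \<rho>" "card \<rho> = d" using assms by (auto simp: nsets_def)
  ultimately show "\<tau> \<in> {\<tau> \<in> nsets A (d + 1). \<rho> \<subseteq> \<tau>}"
    unfolding nsets_def by simp blast
qed

text \<open>On the star of \<rho>, which has n - d members, the off-diagonal part of the kernel is
  \<open>?v b * ?v c / (n + l)\<close> with signs \<open>?v\<close>. Multiplied by \<open>?v\<close>
  from the left, the n - d - 1 off-diagonal terms of a column of I - P cancel its diagonal term,
  which carries the factor (n - d - 1) / (n + l).\<close>

lemma hypertree_covers:
  assumes law: "hypertree_law n d l p" and \<rho>: "\<rho> \<in> nsets {1..n} d" and "n > d"
    and X: "X \<in> set_pmf p"
  shows "X \<inter> {\<tau> \<in> nsets {1..n} (d + 1). \<rho> \<subseteq> \<tau>} \<noteq> {}"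
proof
  define A where "A = {\<tau> \<in> nsets {1..n} (d + 1). \<rho> \<subseteq> \<tau>}"
  let ?v = "incidence \<rho>"
  \<comment> \<open>The matrix of \<open>determinantal_pgf\<close> at \<open>x = 0\<close>, with
    \<open>0 - 1\<close> left unevaluated so as to match; its minor is the probability of missing
    \<open>A\<close>.\<close>
  let ?M = "\<lambda>a b. (if a = b then 1 else 0) + (0 - 1) * hypertree_kernel n d l a b"
  assume "X \<inter> {\<tau> \<in> nsets {1..n} (d + 1). \<rho> \<subseteq> \<tau>} = {}"
  then have empty: "X \<inter> A = {}" by (simp add: A_def)
  have r: "card \<rho> = d" "finite \<rho>" "\<rho> \<subseteq> {1..n}" using \<rho> by (auto simp: nsets_def)
  have A: "finite A" by (simp add: A_def finite_imp_finite_nsets)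
  have img: "A = (\<lambda>x. insert x \<rho>) ` ({1..n} - \<rho>)" unfolding A_def using star_of_codim_one[OF \<rho>] .
  have inj: "inj_on (\<lambda>x. insert x \<rho>) ({1..n} - \<rho>)" by (auto simp: inj_on_def)
  have cA: "card A = n - d"
    unfolding img by (subst card_image[OF inj]) (use r in \<open>simp add: card_Diff_subset\<close>)
  have sq: "?v a * ?v a = 1" if "a \<in> A" for a
    using that r incidence_square unfolding img by auto
  have "card A > 0" using cA \<open>n > d\<close> by simp
  then obtain a where a: "a \<in> A" by (metis card_gt_0_iff ex_in_conv)
  have kern: "hypertree_kernel n d l b c = ?v b * ?v c / (real n + real l)"
    if "b \<in> A" "c \<in> A" "b \<noteq> c" for b c
  proof -
    have "b \<inter> c = \<rho>" using that unfolding img by auto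
    then show ?thesis using that r by (simp add: hypertree_kernel_def J_sign_def)
  qed
  have "principal_minor ?M A = 0"
  proof (rule principal_minor_null_vector[where v = ?v, OF A a])
    show "?v a \<noteq> 0" using sq[OF a] by auto
  next
    fix c assume c: "c \<in> A"
    have "(\<Sum>b\<in>A. ?v b * ?M b c) = ?v c * ?M c c + (\<Sum>b\<in>A-{c}. ?v b * ?M b c)"
      using A c by (subst sum.remove[of A c]) auto
    also have "(\<Sum>b\<in>A-{c}. ?v b * ?M b c) = (\<Sum>b\<in>A-{c}. - ?v c / (real n + real l))"
    proof (intro sum.cong refl)
      fix b assume b: "b \<in> A - {c}"
      then have "?v b * ?M b c = - (?v b * ?v b) * ?v c / (real n + real l)"
        using kern[of b c] c by auto
      then show "?v b * ?M b c = - ?v c / (real n + real l)" using sq[of b] b by simp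
    qed
    also have "\<dots> = - (real n - real d - 1) * ?v c / (real n + real l)"
    proof -
      have "real (card (A - {c})) = real n - real d - 1" using A c cA \<open>n > d\<close> by simp
      then show ?thesis
        by (simp only: sum_constant minus_divide_left[symmetric] mult_minus_right mult_minus_left
            times_divide_eq_right)
    qed
    also have "?v c * ?M c c = ?v c * (1 - (real d + 1 + real l) / (real n + real l))"
      by (simp only: hypertree_kernel_def refl if_True)
        (simp only: diff_0 mult_minus_left mult_1 add_uminus_conv_diff)
    finally have *: "(\<Sum>b\<in>A. ?v b * ?M b c) = ?v c * (1 - (real d + 1 + real l) / (real n + real l))
        + - (real n - real d - 1) * ?v c / (real n + real l)" .
    have "real n + real l \<noteq> 0" using \<open>n > d\<close> by linarith
    then have "1 - (real d + 1 + real l) / (real n + real l) = (real n - real d - 1) / (real n + real l)"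
      by (subst diff_divide_eq_iff) simp_all
    then show "(\<Sum>b\<in>A. ?v b * ?M b c) = 0" unfolding *
      by (simp only: times_divide_eq_right mult_minus_left minus_divide_left[symmetric]
          mult.commute add.right_inverse)
  qed
  moreover have "finite (nsets {1..n} (d + 1))" "A \<subseteq> nsets {1..n} (d + 1)"
    by (simp add: finite_imp_finite_nsets) (auto simp: A_def)
  ultimately have "measure_pmf.expectation p (\<lambda>X. (0::real) ^ card (X \<inter> A)) = 0"
    using determinantal_pgf[OF law[unfolded hypertree_law_def], of A 0] by (simp only:)
  \<comment> \<open>Since \<open>0 ^ 0 = 1\<close>, the integrand is the indicator of the sets that
    miss \<open>A\<close>.\<close>
  moreover have "measure_pmf.expectation p (\<lambda>X. (0::real) ^ card (X \<inter> A)) \<ge> pmf p X"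
  proof -
    have "pmf p X = measure_pmf.expectation p (indicator {X})"
      by (simp add: measure_pmf_single)
    also have "\<dots> \<le> measure_pmf.expectation p (\<lambda>X. (0::real) ^ card (X \<inter> A))"
      using empty A
      by (intro integral_mono measure_pmf.integrable_const_bound[where B = 1])
        (auto simp: indicator_def power_0_left)
    finally show ?thesis .
  qed
  ultimately show False using pmf_positive[OF X] by linarith
qed

section \<open>Counts over independent copies and their Chernoff bounds\<close>

text \<open>This is W. A face lying in several copies is counted with multiplicity, so that
  exponential moments factor over the copies.\<close>

definition hits :: "nat \<Rightarrow> (nat \<Rightarrow> nat set set) \<Rightarrow> nat set set \<Rightarrow> nat" where
  "hits k T A = (\<Sum>i\<in>{1..k}. card (T i \<inter> A))"

definition copies :: "nat \<Rightarrow> nat set set pmf \<Rightarrow> (nat \<Rightarrow> nat set set) pmf" where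
  "copies k p = Pi_pmf {1..k} {} (\<lambda>_. p)"

lemma finite_set_pmf_hypertree:
  assumes "hypertree_law n d l p"
  shows "finite (set_pmf p)"
  using assms unfolding hypertree_law_def determinantal_law_def
  by (meson finite_Pow_iff finite_atLeastAtMost finite_imp_finite_nsets finite_subset)

lemma finite_set_pmf_copies:
  assumes "hypertree_law n d l p"
  shows "finite (set_pmf (copies k p))"
  unfolding copies_def using finite_set_pmf_hypertree[OF assms]
  by (simp add: set_Pi_pmf finite_PiE_dflt)

lemma copies_component:
  assumes "T \<in> set_pmf (copies k p)" "i \<in> {1..k}"
  shows "T i \<in> set_pmf p"
  using assms unfolding copies_def by (auto simp: set_Pi_pmf PiE_dflt_def)

text \<open>Both tails at once: the sign of \<open>y\<close> decides whether the event says that the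
  count is at least or at most \<open>a\<close>.\<close>

lemma hits_chernoff:
  assumes law: "hypertree_law n d l p" and A: "A \<subseteq> nsets {1..n} (d + 1)"
  shows "measure_pmf.prob (copies k p) {T. y * a \<le> y * real (hits k T A)}
     \<le> exp (real k * ((exp y - 1) * rate n d l * real (card A)) - y * a)"
proof -
  let ?M = "copies k p" and ?x = "exp y"
  have fin: "finite (set_pmf ?M)" by (rule finite_set_pmf_copies[OF law])
  have "measure_pmf.prob ?M {T. y * a \<le> y * real (hits k T A)}
      = measure_pmf.expectation ?M (indicator {T. y * a \<le> y * real (hits k T A)})" by simp
  also have "\<dots> \<le> measure_pmf.expectation ?M (\<lambda>T. exp (- (y * a)) * (\<Prod>i\<in>{1..k}. ?x ^ card (T i \<inter> A)))"
  proof (intro integral_mono integrable_measure_pmf_finite fin)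
    fix T
    have "(\<Prod>i\<in>{1..k}. ?x ^ card (T i \<inter> A)) = exp (y * real (hits k T A))"
      by (simp add: hits_def exp_sum sum_distrib_left exp_of_nat_mult[symmetric] mult.commute)
    then show "indicator {T. y * a \<le> y * real (hits k T A)} T
        \<le> exp (- (y * a)) * (\<Prod>i\<in>{1..k}. ?x ^ card (T i \<inter> A))"
      by (auto simp: indicator_def exp_add[symmetric])
  qed
  also have "\<dots> = exp (- (y * a)) * measure_pmf.expectation ?M (\<lambda>T. \<Prod>i\<in>{1..k}. ?x ^ card (T i \<inter> A))"
    by simp
  also have "measure_pmf.expectation ?M (\<lambda>T. \<Prod>i\<in>{1..k}. ?x ^ card (T i \<inter> A))
      = (\<Prod>i\<in>{1..k}. measure_pmf.expectation p (\<lambda>X. ?x ^ card (X \<inter> A)))"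
    unfolding copies_def
    by (rule expectation_prod_Pi_pmf)
      (auto intro!: integrable_measure_pmf_finite finite_set_pmf_hypertree[OF law])
  also have "\<dots> \<le> (\<Prod>i\<in>{1..k}. exp ((?x - 1) * rate n d l * real (card A)))"
    by (intro prod_mono conjI Bochner_Integration.integral_nonneg hypertree_pgf_le[OF law A]) auto
  also have "\<dots> = exp (real k * ((?x - 1) * rate n d l * real (card A)))"
    by (simp add: exp_of_nat_mult)
  finally show ?thesis by (simp add: exp_diff exp_minus divide_inverse mult.commute)
qed

section \<open>Minimal cochains in links\<close>

text \<open>The mod 2 coboundary of the complete complex, on supports: \<open>S\<close> is meant to
  consist of sets with \<open>m\<close> elements. The random faces play no part here.\<close>

definition cob :: "nat \<Rightarrow> nat \<Rightarrow> nat set set \<Rightarrow> nat set set" where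
  "cob n m S = {\<tau> \<in> nsets {1..n} (Suc m). odd (card {\<sigma> \<in> S. \<sigma> \<subseteq> \<tau>})}"

text \<open>A face of the link of \<rho> is represented by its union with \<rho>. The coboundary of
  such sets again consists of sets containing \<rho>, so \<open>cob\<close> serves all links. Size
  is cardinality and not the random norm, so minimality is a deterministic property.\<close>

definition link_minimal :: "nat \<Rightarrow> nat \<Rightarrow> nat set \<Rightarrow> nat set set \<Rightarrow> bool" where
  "link_minimal n m \<rho> S \<longleftrightarrow>
     S \<subseteq> {\<sigma> \<in> nsets {1..n} (Suc m). \<rho> \<subseteq> \<sigma>} \<and>
     (\<forall>G \<subseteq> {\<eta> \<in> nsets {1..n} m. \<rho> \<subseteq> \<eta>}. card S \<le> card (sym_diff S (cob n m G)))"

abbreviation star :: "'a set \<Rightarrow> 'a set set \<Rightarrow> 'a set set" where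
  "star \<pi> S \<equiv> {\<sigma> \<in> S. \<pi> \<subseteq> \<sigma>}"

declare finite_imp_finite_nsets [simp]

lemma finite_cob [simp]: "finite (cob n m S)"
  by (simp add: cob_def)

lemma cob_subset: "cob n m S \<subseteq> nsets {1..n} (Suc m)"
  by (auto simp: cob_def)

lemma cobE:
  assumes "\<tau> \<in> cob n m S"
  obtains \<sigma> where "\<sigma> \<in> S" "\<sigma> \<subseteq> \<tau>" "\<tau> \<in> nsets {1..n} (Suc m)"
proof -
  have "{\<sigma> \<in> S. \<sigma> \<subseteq> \<tau>} \<noteq> {}" using assms unfolding cob_def by force
  then show thesis using that assms by (auto simp: cob_def)
qed

lemma card_le_sum_image:
  assumes "finite A" "\<And>x. x \<in> A \<Longrightarrow> finite (B x)" "C \<subseteq> (\<Union>x\<in>A. B x)"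
  shows "card C \<le> (\<Sum>x\<in>A. card (B x))"
proof -
  have "card C \<le> card (\<Union>x\<in>A. B x)" using assms by (intro card_mono) auto
  also have "\<dots> \<le> (\<Sum>x\<in>A. card (B x))" by (rule card_UN_le[OF assms(1)])
  finally show ?thesis .
qed

lemma link_minimal_finite:
  assumes "link_minimal n m \<rho> S"
  shows "finite S"
proof (rule finite_subset)
  show "S \<subseteq> nsets {1..n} (Suc m)" using assms by (auto simp: link_minimal_def)
qed simp

text \<open>A coboundary of sets containing \<pi> changes \<open>S\<close> only inside the star of
  \<pi>, and it is also an admissible change in the link of \<rho>.\<close>

lemma link_minimal_star:
  assumes min: "link_minimal n m \<rho> S" and sub: "\<rho> \<subseteq> \<pi>"
  shows "link_minimal n m \<pi> (star \<pi> S)"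
  unfolding link_minimal_def
proof (intro conjI allI impI)
  show "star \<pi> S \<subseteq> {\<sigma> \<in> nsets {1..n} (Suc m). \<pi> \<subseteq> \<sigma>}"
    using min by (auto simp: link_minimal_def)
next
  fix G assume G: "G \<subseteq> {\<eta> \<in> nsets {1..n} m. \<pi> \<subseteq> \<eta>}"
  have S: "finite S" by (rule link_minimal_finite[OF min])
  have cob: "\<pi> \<subseteq> \<sigma>" if \<sigma>: "\<sigma> \<in> cob n m G" for \<sigma>
  proof -
    obtain \<eta> where "\<eta> \<in> G" "\<eta> \<subseteq> \<sigma>" using \<sigma> by (rule cobE)
    then show ?thesis using G by blast
  qed
  have "G \<subseteq> {\<eta> \<in> nsets {1..n} m. \<rho> \<subseteq> \<eta>}" using G sub by blast
  then have "card S \<le> card (sym_diff S (cob n m G))" using min by (auto simp: link_minimal_def)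
  also have "sym_diff S (cob n m G) = (S - star \<pi> S) \<union> sym_diff (star \<pi> S) (cob n m G)"
    using cob by blast
  also have "card \<dots> = card (S - star \<pi> S) + card (sym_diff (star \<pi> S) (cob n m G))"
  proof (rule card_Un_disjoint)
    show "(S - star \<pi> S) \<inter> sym_diff (star \<pi> S) (cob n m G) = {}" using cob by blast
  qed (use S in simp_all)
  also have "card (S - star \<pi> S) = card S - card (star \<pi> S)"
    using S by (intro card_Diff_subset) auto
  finally have "card S \<le> card S - card (star \<pi> S) + card (sym_diff (star \<pi> S) (cob n m G))" .
  moreover have "card (star \<pi> S) \<le> card S" using S by (intro card_mono) auto
  ultimately show "card (star \<pi> S) \<le> card (sym_diff (star \<pi> S) (cob n m G))" by linarith
qed

lemma nsets_subset_eq: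
  assumes "\<sigma> \<in> nsets A m" "\<tau> \<in> nsets B m" "\<sigma> \<subseteq> \<tau>"
  shows "\<sigma> = \<tau>"
  using assms card_subset_eq[of \<tau> \<sigma>] by (simp add: nsets_def)

text \<open>Adding the coboundary of the cone \<open>G\<close> over the vertex \<open>v\<close> moves \<open>S\<close> off the star of \<open>v\<close>
  and onto the faces \<open>\<sigma>\<close> with \<open>insert v \<sigma>\<close> in the coboundary of \<open>S\<close>.\<close>

lemma cone_bound:
  assumes min: "link_minimal n m \<rho> S" and v: "v \<in> {1..n}" "v \<notin> \<rho>"
  shows "card S \<le> card {\<tau> \<in> cob n (Suc m) S. v \<in> \<tau>}"
proof -
  define G where "G = {\<eta> \<in> nsets {1..n} m. \<rho> \<subseteq> \<eta> \<and> v \<notin> \<eta> \<and> insert v \<eta> \<in> S}"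
  have Ssub: "S \<subseteq> {\<sigma> \<in> nsets {1..n} (Suc m). \<rho> \<subseteq> \<sigma>}" using min by (simp add: link_minimal_def)
  have Gfin: "finite G" by (simp add: G_def)
  have key: "v \<notin> \<sigma> \<and> insert v \<sigma> \<in> cob n (Suc m) S" if \<sigma>: "\<sigma> \<in> sym_diff S (cob n m G)" for \<sigma>
  proof -
    have \<sigma>n: "\<sigma> \<in> nsets {1..n} (Suc m)" using \<sigma> Ssub cob_subset by blast
    then have \<sigma>f: "finite \<sigma>" "card \<sigma> = Suc m" "\<sigma> \<subseteq> {1..n}" by (auto simp: nsets_def)
    have v\<sigma>: "v \<notin> \<sigma>"
    proof
      assume v\<sigma>: "v \<in> \<sigma>"
      have sub: "{\<eta> \<in> G. \<eta> \<subseteq> \<sigma>} \<subseteq> {\<sigma> - {v}}"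
      proof
        fix \<eta> assume \<eta>: "\<eta> \<in> {\<eta> \<in> G. \<eta> \<subseteq> \<sigma>}"
        have "\<sigma> - {v} \<in> nsets {1..n} m" using \<sigma>f v\<sigma> by (auto simp: nsets_def)
        moreover have "\<eta> \<in> nsets {1..n} m" "\<eta> \<subseteq> \<sigma> - {v}" using \<eta> by (auto simp: G_def)
        ultimately show "\<eta> \<in> {\<sigma> - {v}}" using nsets_subset_eq by blast
      qed
      \<comment> \<open>The only member of \<open>G\<close> that fits into a face through
        \<open>v\<close> is \<open>\<sigma> - {v}\<close>, so \<open>cob n m G\<close> agrees with
        \<open>S\<close> on such faces.\<close>
      have "\<sigma> \<in> cob n m G \<longleftrightarrow> \<sigma> \<in> S"
      proof (cases "\<sigma> \<in> S")
        case True
        then have "\<sigma> - {v} \<in> G"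
          using \<sigma>f v\<sigma> v Ssub by (auto simp: G_def nsets_def insert_absorb)
        then have "{\<eta> \<in> G. \<eta> \<subseteq> \<sigma>} = {\<sigma> - {v}}" using sub by auto
        then show ?thesis using True \<sigma>n by (simp add: cob_def)
      next
        case False
        then have "\<sigma> - {v} \<notin> G" using v\<sigma> by (auto simp: G_def insert_absorb)
        then have none: "{\<eta> \<in> G. \<eta> \<subseteq> \<sigma>} = {}" using sub by auto
        have "\<sigma> \<notin> cob n m G"
        proof
          assume "\<sigma> \<in> cob n m G"
          then obtain \<eta> where "\<eta> \<in> G" "\<eta> \<subseteq> \<sigma>" by (rule cobE)
          then show False using none by blast
        qed
        then show ?thesis using False by simp
      qed
      then show False using \<sigma> by blast
    qed
    let ?E = "{\<eta> \<in> G. \<eta> \<subseteq> \<sigma>}"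
    \<comment> \<open>A member of \<open>S\<close> below \<open>insert v \<sigma>\<close> is
      \<sigma> itself if it avoids \<open>v\<close>, and otherwise comes from a member of
      \<open>G\<close> below \<sigma>. So the number of them is odd exactly when \<sigma> lies in
      one of \<open>S\<close> and \<open>cob n m G\<close> but not in both.\<close>
    have "{\<sigma>' \<in> S. \<sigma>' \<subseteq> insert v \<sigma>} = ({\<sigma>} \<inter> S) \<union> insert v ` ?E"
    proof (intro equalityI subsetI)
      fix \<sigma>' assume a: "\<sigma>' \<in> {\<sigma>' \<in> S. \<sigma>' \<subseteq> insert v \<sigma>}"
      then have n': "\<sigma>' \<in> nsets {1..n} (Suc m)" "\<rho> \<subseteq> \<sigma>'" using Ssub by auto
      show "\<sigma>' \<in> ({\<sigma>} \<inter> S) \<union> insert v ` ?E"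
      proof (cases "v \<in> \<sigma>'")
        case True
        then have "\<sigma>' - {v} \<in> ?E" using a n' v by (auto simp: G_def nsets_def insert_absorb)
        moreover have "\<sigma>' = insert v (\<sigma>' - {v})" using True by auto
        ultimately show ?thesis by blast
      next
        case False
        then have "\<sigma>' \<subseteq> \<sigma>" using a by auto
        then have "\<sigma>' = \<sigma>" using nsets_subset_eq[OF n'(1) \<sigma>n] by simp
        then show ?thesis using a by auto
      qed
    qed (auto simp: G_def)
    moreover have "card (({\<sigma>} \<inter> S) \<union> insert v ` ?E) = card ({\<sigma>} \<inter> S) + card (insert v ` ?E)"
      using v\<sigma> Gfin by (intro card_Un_disjoint) auto
    moreover have "card (insert v ` ?E) = card ?E"
      by (intro card_image inj_onI) (auto simp: G_def)
    ultimately have c: "card {\<sigma>' \<in> S. \<sigma>' \<subseteq> insert v \<sigma>} = card ({\<sigma>} \<inter> S) + card ?E" by simp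
    have "odd (card {\<sigma>' \<in> S. \<sigma>' \<subseteq> insert v \<sigma>})"
    proof (cases "\<sigma> \<in> S")
      case True
      then have "\<sigma> \<notin> cob n m G" using \<sigma> by blast
      then have "even (card ?E)" using \<sigma>n by (simp add: cob_def)
      then show ?thesis using True c by simp
    next
      case False
      then have "\<sigma> \<in> cob n m G" using \<sigma> by blast
      then have "odd (card ?E)" by (simp add: cob_def)
      then show ?thesis using False c by simp
    qed
    moreover have "insert v \<sigma> \<in> nsets {1..n} (Suc (Suc m))"
      using \<sigma>f v\<sigma> v by (auto simp: nsets_def)
    ultimately show ?thesis using v\<sigma> by (simp add: cob_def)
  qed
  have inj: "inj_on (insert v) (sym_diff S (cob n m G))"
  proof (rule inj_onI)
    fix \<sigma> \<sigma>' assume *: "\<sigma> \<in> sym_diff S (cob n m G)" "\<sigma>' \<in> sym_diff S (cob n m G)"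
      and eq: "insert v \<sigma> = insert v \<sigma>'"
    have "v \<notin> \<sigma>" "v \<notin> \<sigma>'" using key[OF *(1)] key[OF *(2)] by auto
    then show "\<sigma> = \<sigma>'" using eq by (simp add: insert_ident)
  qed
  have "G \<subseteq> {\<eta> \<in> nsets {1..n} m. \<rho> \<subseteq> \<eta>}" by (auto simp: G_def)
  then have "card S \<le> card (sym_diff S (cob n m G))"
    using min unfolding link_minimal_def by blast
  also have "\<dots> = card (insert v ` sym_diff S (cob n m G))"
    by (rule card_image[OF inj, symmetric])
  also have "\<dots> \<le> card {\<tau> \<in> cob n (Suc m) S. v \<in> \<tau>}"
  proof (rule card_mono)
    show "insert v ` sym_diff S (cob n m G) \<subseteq> {\<tau> \<in> cob n (Suc m) S. v \<in> \<tau>}"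
      using key by blast
  qed simp
  finally show ?thesis .
qed

text \<open>The cone bound is summed over all vertices outside \<rho>; each face of the coboundary
  is counted once for each of its vertices outside \<rho>.\<close>

lemma link_expansion_complete:
  assumes min: "link_minimal n m \<rho> S" and \<rho>: "\<rho> \<subseteq> {1..n}"
  shows "(n - card \<rho>) * card S \<le> (Suc (Suc m) - card \<rho>) * card (cob n (Suc m) S)"
proof -
  have f\<rho>: "finite \<rho>" using \<rho> finite_subset by blast
  have "(n - card \<rho>) * card S = (\<Sum>v\<in>{1..n} - \<rho>. card S)"
    using \<rho> f\<rho> by (simp add: card_Diff_subset)
  also have "\<dots> \<le> (\<Sum>v\<in>{1..n} - \<rho>. card {\<tau> \<in> cob n (Suc m) S. v \<in> \<tau>})"
    by (intro sum_mono cone_bound[OF min]) auto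
  also have "\<dots> = (\<Sum>\<tau>\<in>cob n (Suc m) S. card {v \<in> {1..n} - \<rho>. v \<in> \<tau>})"
    by (rule sum_multicount_gen) auto
  also have "\<dots> = (\<Sum>\<tau>\<in>cob n (Suc m) S. Suc (Suc m) - card \<rho>)"
  proof (intro sum.cong refl)
    fix \<tau> assume "\<tau> \<in> cob n (Suc m) S"
    then obtain \<sigma> where "\<sigma> \<in> S" "\<sigma> \<subseteq> \<tau>" and \<tau>: "\<tau> \<in> nsets {1..n} (Suc (Suc m))" by (rule cobE)
    then have "\<rho> \<subseteq> \<tau>" using min by (auto simp: link_minimal_def)
    moreover have "{v \<in> {1..n} - \<rho>. v \<in> \<tau>} = \<tau> - \<rho>" using \<tau> by (auto simp: nsets_def)
    ultimately show "card {v \<in> {1..n} - \<rho>. v \<in> \<tau>} = Suc (Suc m) - card \<rho>"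
      using \<tau> f\<rho> by (simp add: card_Diff_subset nsets_def)
  qed
  finally show ?thesis by (simp add: mult.commute)
qed

section \<open>Heavy sets\<close>

text \<open>For \<open>card \<pi> = d\<close> the threshold is 1, so every member of
  \<open>S\<close> is heavy. For \<rho> itself, with \<open>card S = t ^ (2 ^ D) * n ^ D\<close> and
  D its codimension, the threshold is missed by exactly one factor \<open>t\<close>.\<close>

definition heavy :: "nat \<Rightarrow> nat \<Rightarrow> real \<Rightarrow> nat set set \<Rightarrow> nat set \<Rightarrow> bool" where
  "heavy n d t S \<pi> \<longleftrightarrow>
     t ^ (2 ^ (d - card \<pi>) - 1) * real n ^ (d - card \<pi>) \<le> real (card (star \<pi> S))"

definition bad :: "nat \<Rightarrow> nat \<Rightarrow> real \<Rightarrow> nat set \<Rightarrow> nat set set \<Rightarrow> nat set set" where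
  "bad n d t \<rho> S = {\<tau> \<in> nsets {1..n} (d + 1). \<exists>\<pi>1 \<pi>2. \<rho> \<subseteq> \<pi>1 \<and> \<rho> \<subseteq> \<pi>2 \<and> \<pi>1 \<subseteq> \<tau> \<and> \<pi>2 \<subseteq> \<tau> \<and>
     heavy n d t S \<pi>1 \<and> heavy n d t S \<pi>2 \<and> \<not> heavy n d t S (\<pi>1 \<inter> \<pi>2)}"

lemma card_star_nsets:
  assumes "\<pi> \<subseteq> {1..n}"
  shows "card (star \<pi> (nsets {1..n} m)) \<le> n ^ (m - card \<pi>)"
proof -
  have f: "finite \<pi>" using assms finite_subset by blast
  have "card (star \<pi> (nsets {1..n} m)) = card ((\<lambda>\<tau>. \<tau> - \<pi>) ` star \<pi> (nsets {1..n} m))"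
    by (intro card_image[symmetric] inj_onI) blast
  also have "\<dots> \<le> card (nsets {1..n} (m - card \<pi>))"
    using f by (intro card_mono) (auto simp: nsets_def card_Diff_subset)
  also have "\<dots> = n choose (m - card \<pi>)" by (simp add: card_nsets)
  also have "\<dots> \<le> n ^ (m - card \<pi>)"
    by (cases "m - card \<pi> \<le> n") (auto intro: binomial_le_pow simp: binomial_eq_0)
  finally show ?thesis .
qed

lemma sum_card_star_le:
  assumes S: "finite S" "\<And>\<sigma>. \<sigma> \<in> S \<Longrightarrow> finite \<sigma> \<and> card \<sigma> \<le> d"
    and P: "finite P" "\<And>\<pi>. \<pi> \<in> P \<Longrightarrow> \<kappa> \<subseteq> \<pi>"
  shows "(\<Sum>\<pi>\<in>P. card (star \<pi> S)) \<le> 2 ^ d * card (star \<kappa> S)"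
proof -
  have "(\<Sum>\<pi>\<in>P. card (star \<pi> S)) = (\<Sum>\<pi>\<in>P. card (star \<pi> (star \<kappa> S)))"
    using P(2) by (intro sum.cong refl arg_cong[where f = card]) blast
  also have "\<dots> = (\<Sum>\<sigma>\<in>star \<kappa> S. card {\<pi> \<in> P. \<pi> \<subseteq> \<sigma>})"
    using S P by (intro sum_multicount_gen) auto
  also have "\<dots> \<le> (\<Sum>\<sigma>\<in>star \<kappa> S. 2 ^ d)"
  proof (intro sum_mono)
    fix \<sigma> assume \<sigma>: "\<sigma> \<in> star \<kappa> S"
    then have "card {\<pi> \<in> P. \<pi> \<subseteq> \<sigma>} \<le> card (Pow \<sigma>)"
      using S by (intro card_mono) auto
    also have "\<dots> = 2 ^ card \<sigma>" using S \<sigma> by (simp add: card_Pow)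
    also have "\<dots> \<le> 2 ^ d" using S \<sigma> by (intro power_increasing) auto
    finally show "card {\<pi> \<in> P. \<pi> \<subseteq> \<sigma>} \<le> 2 ^ d" .
  qed
  finally show ?thesis by (simp add: mult.commute)
qed

lemma heavyD:
  assumes "heavy n d t S \<pi>" and "S \<subseteq> nsets {1..n} d" and "t > 0" "n > 0"
  shows "finite \<pi>" "\<pi> \<subseteq> {1..n}" "card \<pi> \<le> d" "star \<pi> S \<noteq> {}"
proof -
  have "t ^ (2 ^ (d - card \<pi>) - 1) * real n ^ (d - card \<pi>) > 0" using assms by simp
  then have "card (star \<pi> S) \<noteq> 0" using assms(1) unfolding heavy_def by (intro notI) simp
  then show ne: "star \<pi> S \<noteq> {}" by (metis card.empty)
  then obtain \<sigma> where "\<sigma> \<in> S" "\<pi> \<subseteq> \<sigma>" by blast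
  then have "finite \<sigma>" "\<sigma> \<subseteq> {1..n}" "card \<sigma> = d" using assms(2) by (auto simp: nsets_def)
  then show "finite \<pi>" "\<pi> \<subseteq> {1..n}" "card \<pi> \<le> d"
    using finite_subset[OF \<open>\<pi> \<subseteq> \<sigma>\<close>] card_mono[OF _ \<open>\<pi> \<subseteq> \<sigma>\<close>] \<open>\<pi> \<subseteq> \<sigma>\<close> by simp_all
qed

text \<open>The exponents in the definition of heaviness satisfy
  $2^{d-a} + 2^{d-b} \le 2^{d-j}$ for $j < a, b$, which is what produces the extra factor \<open>t\<close>.\<close>

lemma heavy_pairs_bound:
  fixes t :: real
  assumes S: "S \<subseteq> nsets {1..n} d" and t: "0 < t" "t < 1" and n: "n > 0"
    and \<pi>1: "heavy n d t S \<pi>1" and \<kappa>: "\<kappa> \<subseteq> \<pi>1" "\<not> heavy n d t S \<kappa>"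
    and P: "finite P" "\<And>\<pi>2. \<pi>2 \<in> P \<Longrightarrow> heavy n d t S \<pi>2 \<and> \<pi>1 \<inter> \<pi>2 = \<kappa> \<and> card (\<pi>1 \<union> \<pi>2) \<le> d + 1"
  shows "(\<Sum>\<pi>2\<in>P. real n ^ (d + 1 - card (\<pi>1 \<union> \<pi>2))) \<le> 2 ^ d * real n * t * real (card (star \<pi>1 S))"
proof -
  define a j where "a = card \<pi>1" and "j = card \<kappa>"
  define N where "N = real n"
  have N: "N > 0" using n by (simp add: N_def)
  have f1: "finite \<pi>1" "a \<le> d" using heavyD[OF \<pi>1 S t(1) n] by (auto simp: a_def)
  have "\<kappa> \<subset> \<pi>1" using \<kappa> \<pi>1 by auto
  then have ja: "j < a" using f1 psubset_card_mono by (auto simp: a_def j_def)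
  \<comment> \<open>The threshold of \<kappa> is \<open>w * t ^ (2 ^ (d - j - 1))\<close>. Dividing
    by \<open>w\<close> therefore leaves the power \<open>t ^ (2 ^ (d - j - 1))\<close>, which is at
    most \<open>t\<close> times the power of \<open>t\<close> in the threshold of \<pi>1.\<close>
  define w where "w = N ^ (d - j) * t ^ (2 ^ (d - j - 1) - 1)"
  have w: "w > 0" using N t by (simp add: w_def)
  have each: "N ^ (d + 1 - card (\<pi>1 \<union> \<pi>2)) * w \<le> N ^ (d + 1 - a) * real (card (star \<pi>2 S))"
    if \<pi>2: "\<pi>2 \<in> P" for \<pi>2
  proof -
    define b where "b = card \<pi>2"
    have h2: "heavy n d t S \<pi>2" and int: "\<pi>1 \<inter> \<pi>2 = \<kappa>" and un: "card (\<pi>1 \<union> \<pi>2) \<le> d + 1"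
      using P(2)[OF \<pi>2] by auto
    have f2: "finite \<pi>2" "b \<le> d" using heavyD[OF h2 S t(1) n] by (auto simp: b_def)
    have "\<kappa> \<subset> \<pi>2" using h2 \<kappa> int by auto
    then have jb: "j < b" using f2 psubset_card_mono by (auto simp: b_def j_def)
    have un': "card (\<pi>1 \<union> \<pi>2) + j = a + b"
      using card_Un_Int[OF f1(1) f2(1)] int by (simp add: a_def b_def j_def)
    have e: "(d + 1 - card (\<pi>1 \<union> \<pi>2)) + (d - j) = (d + 1 - a) + (d - b)"
      using un un' f1 f2 ja jb by linarith
    have "(2::nat) ^ (d - b) \<le> 2 ^ (d - j - 1)" using jb by (intro power_increasing) auto
    then have "(2::nat) ^ (d - b) - 1 \<le> 2 ^ (d - j - 1) - 1" by (rule diff_le_mono)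
    from power_decreasing[OF this, of t] t have "t ^ (2 ^ (d - j - 1) - 1) \<le> t ^ (2 ^ (d - b) - 1)"
      by simp
    then have "N ^ (d + 1 - card (\<pi>1 \<union> \<pi>2)) * w
        \<le> N ^ (d + 1 - card (\<pi>1 \<union> \<pi>2)) * (N ^ (d - j) * t ^ (2 ^ (d - b) - 1))"
      using N by (simp add: w_def)
    also have "\<dots> = N ^ (d + 1 - a) * (t ^ (2 ^ (d - b) - 1) * N ^ (d - b))"
    proof -
      have "N ^ (d + 1 - card (\<pi>1 \<union> \<pi>2)) * N ^ (d - j) = N ^ (d + 1 - a) * N ^ (d - b)"
        unfolding power_add[symmetric] e ..
      then have "N ^ (d + 1 - card (\<pi>1 \<union> \<pi>2)) * N ^ (d - j) * t ^ (2 ^ (d - b) - 1)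
          = N ^ (d + 1 - a) * N ^ (d - b) * t ^ (2 ^ (d - b) - 1)" by (simp only:)
      then show ?thesis by (simp only: mult_ac)
    qed
    also have "\<dots> \<le> N ^ (d + 1 - a) * real (card (star \<pi>2 S))"
      using h2 N unfolding heavy_def b_def N_def by (intro mult_left_mono) auto
    finally show ?thesis .
  qed
  have "(\<Sum>\<pi>2\<in>P. N ^ (d + 1 - card (\<pi>1 \<union> \<pi>2))) * w
      \<le> (\<Sum>\<pi>2\<in>P. N ^ (d + 1 - a) * real (card (star \<pi>2 S)))"
    unfolding sum_distrib_right by (intro sum_mono each)
  also have "\<dots> = N ^ (d + 1 - a) * real (\<Sum>\<pi>2\<in>P. card (star \<pi>2 S))"
    by (simp add: sum_distrib_left)
  also have "\<dots> \<le> N ^ (d + 1 - a) * real (2 ^ d * card (star \<kappa> S))"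
  proof -
    have "finite S" using S by (rule finite_subset) simp
    then have "(\<Sum>\<pi>2\<in>P. card (star \<pi>2 S)) \<le> 2 ^ d * card (star \<kappa> S)"
      using S P by (intro sum_card_star_le) (auto simp: nsets_def)
    then show ?thesis using N by (intro mult_left_mono) (simp_all only: of_nat_le_iff zero_le_power less_imp_le)
  qed
  also have "\<dots> \<le> N ^ (d + 1 - a) * (2 ^ d * (t ^ (2 ^ (d - j) - 1) * N ^ (d - j)))"
    using \<kappa>(2) N unfolding heavy_def j_def N_def by (intro mult_left_mono) auto
  also have "\<dots> = (2 ^ d * N ^ (d + 1 - a) * t ^ (2 ^ (d - j - 1))) * w"
  proof -
    have "(2::nat) ^ (d - j) = 2 ^ (d - j - 1) + 2 ^ (d - j - 1)"
      using ja f1 by (cases "d - j") auto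
    then have "(2::nat) ^ (d - j) - 1 = 2 ^ (d - j - 1) + (2 ^ (d - j - 1) - 1)" by simp
    then have "t ^ (2 ^ (d - j) - 1) = t ^ (2 ^ (d - j - 1)) * t ^ (2 ^ (d - j - 1) - 1)"
      by (simp only: power_add)
    then show ?thesis by (simp only: w_def mult_ac)
  qed
  finally have "(\<Sum>\<pi>2\<in>P. N ^ (d + 1 - card (\<pi>1 \<union> \<pi>2))) \<le> 2 ^ d * N ^ (d + 1 - a) * t ^ (2 ^ (d - j - 1))"
    using w by (simp only: mult_le_cancel_right_pos)
  also have "\<dots> \<le> 2 ^ d * N ^ (d + 1 - a) * t ^ (2 ^ (d - a))"
    using t N ja by (intro mult_left_mono power_decreasing power_increasing) auto
  also have "\<dots> = 2 ^ d * N * t * (t ^ (2 ^ (d - a) - 1) * N ^ (d - a))"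
  proof -
    have "t ^ (2 ^ (d - a)) = t * t ^ (2 ^ (d - a) - 1)"
      using power_Suc[of t "2 ^ (d - a) - 1"] by simp
    moreover have "N ^ (d + 1 - a) = N * N ^ (d - a)" using f1 by (simp add: Suc_diff_le)
    ultimately show ?thesis by (simp only: mult_ac)
  qed
  also have "\<dots> \<le> 2 ^ d * N * t * real (card (star \<pi>1 S))"
    using \<pi>1 N t unfolding heavy_def a_def N_def by (intro mult_left_mono) auto
  finally show ?thesis by (simp add: N_def)
qed

text \<open>Bad faces are enumerated by a heavy \<pi>1, a non-heavy subset \<kappa> of it and a
  heavy \<pi>2 meeting \<pi>1 in \<kappa>. Each of the three choices costs a factor 2^d: the stars
  of the \<pi>2 overlap inside the star of \<kappa>, \<kappa> is a subset of \<pi>1, and the stars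
  of the \<pi>1 overlap inside \<open>S\<close>.\<close>

lemma card_bad_le:
  fixes t :: real
  assumes S: "S \<subseteq> star \<rho> (nsets {1..n} d)" and t: "0 < t" "t < 1" and n: "n > 0"
  shows "real (card (bad n d t \<rho> S)) \<le> 8 ^ d * real n * t * real (card S)"
proof -
  let ?h = "heavy n d t S"
  have S': "S \<subseteq> nsets {1..n} d" using S by blast
  have fS: "finite S" using S' by (rule finite_subset) simp
  define H where "H = {\<pi>. \<rho> \<subseteq> \<pi> \<and> ?h \<pi>}"
  have hH: "finite \<pi>" "\<pi> \<subseteq> {1..n}" "card \<pi> \<le> d" if "\<pi> \<in> H" for \<pi>
  proof -
    have "?h \<pi>" using that by (simp add: H_def)
    from heavyD[OF this S' t(1) n] show "finite \<pi>" "\<pi> \<subseteq> {1..n}" "card \<pi> \<le> d" by simp_all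
  qed
  have "H \<subseteq> Pow {1..n}" using hH(2) by blast
  then have H: "finite H" by (rule finite_subset) simp
  define K where "K \<pi>1 = {\<kappa> \<in> Pow \<pi>1. \<not> ?h \<kappa>}" for \<pi>1
  define P where "P \<pi>1 \<kappa> = {\<pi>2 \<in> H. \<pi>1 \<inter> \<pi>2 = \<kappa> \<and> card (\<pi>1 \<union> \<pi>2) \<le> d + 1}" for \<pi>1 \<kappa>
  define B where "B \<pi>1 \<pi>2 = star (\<pi>1 \<union> \<pi>2) (nsets {1..n} (d + 1))" for \<pi>1 \<pi>2
  have cover: "bad n d t \<rho> S \<subseteq> (\<Union>\<pi>1\<in>H. \<Union>\<kappa>\<in>K \<pi>1. \<Union>\<pi>2\<in>P \<pi>1 \<kappa>. B \<pi>1 \<pi>2)"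
  proof
    fix \<tau> assume "\<tau> \<in> bad n d t \<rho> S"
    then obtain \<pi>1 \<pi>2 where \<tau>: "\<tau> \<in> nsets {1..n} (d + 1)" and \<pi>: "\<pi>1 \<in> H" "\<pi>2 \<in> H" "\<pi>1 \<union> \<pi>2 \<subseteq> \<tau>"
      "\<not> ?h (\<pi>1 \<inter> \<pi>2)" by (auto simp: bad_def H_def)
    then have "card (\<pi>1 \<union> \<pi>2) \<le> d + 1" using card_mono[of \<tau> "\<pi>1 \<union> \<pi>2"] by (simp add: nsets_def)
    then have "\<pi>2 \<in> P \<pi>1 (\<pi>1 \<inter> \<pi>2)" "\<pi>1 \<inter> \<pi>2 \<in> K \<pi>1" "\<tau> \<in> B \<pi>1 \<pi>2"
      using \<pi> \<tau> by (auto simp: P_def K_def B_def)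
    then show "\<tau> \<in> (\<Union>\<pi>1\<in>H. \<Union>\<kappa>\<in>K \<pi>1. \<Union>\<pi>2\<in>P \<pi>1 \<kappa>. B \<pi>1 \<pi>2)" using \<pi>(1) by blast
  qed
  have fin: "finite (B \<pi>1 \<pi>2)" "finite (P \<pi>1 \<kappa>)" for \<pi>1 \<pi>2 \<kappa>
    using H by (auto simp: B_def P_def)
  have finK: "finite (K \<pi>1)" if "\<pi>1 \<in> H" for \<pi>1 using hH(1)[OF that] by (simp add: K_def)
  have inner: "real (card (\<Union>\<pi>2\<in>P \<pi>1 \<kappa>. B \<pi>1 \<pi>2)) \<le> 2 ^ d * real n * t * real (card (star \<pi>1 S))"
    if "\<pi>1 \<in> H" "\<kappa> \<in> K \<pi>1" for \<pi>1 \<kappa>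
  proof -
    have "card (\<Union>\<pi>2\<in>P \<pi>1 \<kappa>. B \<pi>1 \<pi>2) \<le> (\<Sum>\<pi>2\<in>P \<pi>1 \<kappa>. card (B \<pi>1 \<pi>2))"
      by (rule card_UN_le[OF fin(2)])
    also have "\<dots> \<le> (\<Sum>\<pi>2\<in>P \<pi>1 \<kappa>. n ^ (d + 1 - card (\<pi>1 \<union> \<pi>2)))"
      unfolding B_def
    proof (intro sum_mono card_star_nsets)
      fix \<pi>2 assume "\<pi>2 \<in> P \<pi>1 \<kappa>"
      then have "\<pi>2 \<in> H" by (simp add: P_def)
      then show "\<pi>1 \<union> \<pi>2 \<subseteq> {1..n}" using hH(2) that(1) by simp
    qed
    finally have "real (card (\<Union>\<pi>2\<in>P \<pi>1 \<kappa>. B \<pi>1 \<pi>2)) \<le> real (\<Sum>\<pi>2\<in>P \<pi>1 \<kappa>. n ^ (d + 1 - card (\<pi>1 \<union> \<pi>2)))"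
      by (simp only: of_nat_le_iff)
    also have "\<dots> = (\<Sum>\<pi>2\<in>P \<pi>1 \<kappa>. real n ^ (d + 1 - card (\<pi>1 \<union> \<pi>2)))" by simp
    also have "\<dots> \<le> 2 ^ d * real n * t * real (card (star \<pi>1 S))"
    proof (rule heavy_pairs_bound[OF S' t n])
      show "?h \<pi>1" "\<kappa> \<subseteq> \<pi>1" "\<not> ?h \<kappa>" using that by (simp_all add: H_def K_def)
      show "\<And>\<pi>2. \<pi>2 \<in> P \<pi>1 \<kappa> \<Longrightarrow> ?h \<pi>2 \<and> \<pi>1 \<inter> \<pi>2 = \<kappa> \<and> card (\<pi>1 \<union> \<pi>2) \<le> d + 1"
        by (simp add: P_def H_def)
    qed (rule fin)
    finally show ?thesis .
  qed
  have mid: "real (card (\<Union>\<kappa>\<in>K \<pi>1. \<Union>\<pi>2\<in>P \<pi>1 \<kappa>. B \<pi>1 \<pi>2)) \<le> 4 ^ d * real n * t * real (card (star \<pi>1 S))"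
    if "\<pi>1 \<in> H" for \<pi>1
  proof -
    have "real (card (\<Union>\<kappa>\<in>K \<pi>1. \<Union>\<pi>2\<in>P \<pi>1 \<kappa>. B \<pi>1 \<pi>2))
        \<le> (\<Sum>\<kappa>\<in>K \<pi>1. real (card (\<Union>\<pi>2\<in>P \<pi>1 \<kappa>. B \<pi>1 \<pi>2)))"
      using card_UN_le[OF finK[OF that], of "\<lambda>\<kappa>. \<Union>\<pi>2\<in>P \<pi>1 \<kappa>. B \<pi>1 \<pi>2"]
      by (simp only: of_nat_sum[symmetric] of_nat_le_iff)
    also have "\<dots> \<le> (\<Sum>\<kappa>\<in>K \<pi>1. 2 ^ d * real n * t * real (card (star \<pi>1 S)))"
      by (intro sum_mono inner that)
    also have "\<dots> = real (card (K \<pi>1)) * (2 ^ d * real n * t * real (card (star \<pi>1 S)))" by simp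
    also have "\<dots> \<le> 2 ^ d * (2 ^ d * real n * t * real (card (star \<pi>1 S)))"
    proof -
      have "card (K \<pi>1) \<le> card (Pow \<pi>1)" using hH(1)[OF that] by (intro card_mono) (auto simp: K_def)
      also have "\<dots> \<le> 2 ^ d" using hH[OF that] by (simp add: card_Pow power_increasing)
      finally have "real (card (K \<pi>1)) \<le> real (2 ^ d)" by (rule of_nat_mono)
      then have "real (card (K \<pi>1)) \<le> 2 ^ d" by simp
      then show ?thesis using t by (intro mult_right_mono) auto
    qed
    also have "\<dots> = 4 ^ d * real n * t * real (card (star \<pi>1 S))"
    proof -
      have "(2::real) ^ d * 2 ^ d = 4 ^ d" by (simp flip: power_mult_distrib)
      then show ?thesis by (simp only: mult.assoc[symmetric])
    qed
    finally show ?thesis .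
  qed
  have "real (card (bad n d t \<rho> S)) \<le> real (card (\<Union>\<pi>1\<in>H. \<Union>\<kappa>\<in>K \<pi>1. \<Union>\<pi>2\<in>P \<pi>1 \<kappa>. B \<pi>1 \<pi>2))"
    by (intro of_nat_mono card_mono cover finite_UN_I H fin finK)
  also have "\<dots> \<le> (\<Sum>\<pi>1\<in>H. real (card (\<Union>\<kappa>\<in>K \<pi>1. \<Union>\<pi>2\<in>P \<pi>1 \<kappa>. B \<pi>1 \<pi>2)))"
    using card_UN_le[OF H, of "\<lambda>\<pi>1. \<Union>\<kappa>\<in>K \<pi>1. \<Union>\<pi>2\<in>P \<pi>1 \<kappa>. B \<pi>1 \<pi>2"]
    by (simp only: of_nat_sum[symmetric] of_nat_le_iff)
  also have "\<dots> \<le> (\<Sum>\<pi>1\<in>H. 4 ^ d * real n * t * real (card (star \<pi>1 S)))"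
    by (intro sum_mono mid)
  also have "\<dots> = 4 ^ d * real n * t * real (\<Sum>\<pi>1\<in>H. card (star \<pi>1 S))"
    by (simp add: sum_distrib_left)
  also have "\<dots> \<le> 4 ^ d * real n * t * real (2 ^ d * card (star \<rho> S))"
  proof -
    have "(\<Sum>\<pi>1\<in>H. card (star \<pi>1 S)) \<le> 2 ^ d * card (star \<rho> S)"
    proof (rule sum_card_star_le[OF fS])
      show "\<And>\<sigma>. \<sigma> \<in> S \<Longrightarrow> finite \<sigma> \<and> card \<sigma> \<le> d" using S' by (auto simp: nsets_def)
    qed (simp_all add: H, simp add: H_def)
    then have "real (\<Sum>\<pi>1\<in>H. card (star \<pi>1 S)) \<le> real (2 ^ d * card (star \<rho> S))"
      by (simp only: of_nat_le_iff)
    then show ?thesis using t by (intro mult_left_mono) simp_all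
  qed
  also have "star \<rho> S = S" using S by blast
  also have "4 ^ d * real n * t * real (2 ^ d * card S) = 8 ^ d * real n * t * real (card S)"
  proof -
    have "(4::real) ^ d * 2 ^ d = 8 ^ d" by (simp flip: power_mult_distrib)
    then have "(4 ^ d * 2 ^ d) * (real n * t * real (card S)) = 8 ^ d * (real n * t * real (card S))"
      by (simp only:)
    then show ?thesis by (simp only: of_nat_mult of_nat_power of_nat_numeral mult_ac)
  qed
  finally show ?thesis .
qed

section \<open>Descent to the links of minimal heavy sets\<close>

definition touch :: "nat \<Rightarrow> nat \<Rightarrow> nat set set \<Rightarrow> nat set set" where
  "touch n d S = {\<tau> \<in> nsets {1..n} (d + 1). \<exists>\<sigma>\<in>S. \<sigma> \<subseteq> \<tau>}"

text \<open>The two terms on the left serve different ends. The first absorbs the bad faces when the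
  induction is applied; the second controls the norm of \<open>S\<close> in the union. The sets in
  \<open>S\<close> have \<open>e + 1 = d\<close> elements, so this concerns cochains of degree d - 1
  only.\<close>

definition link_expands :: "nat \<Rightarrow> (nat \<Rightarrow> nat set set) \<Rightarrow> nat \<Rightarrow> nat \<Rightarrow> real \<Rightarrow> nat set \<Rightarrow> bool" where
  "link_expands k T n e C \<rho> \<longleftrightarrow> (\<forall>S. link_minimal n e \<rho> S \<longrightarrow>
     real k * real (card S) + real (hits k T (touch n (Suc e) S)) \<le> C * real (hits k T (cob n (Suc e) S)))"

lemma hits_mono:
  assumes "A \<subseteq> B" "finite B"
  shows "hits k T A \<le> hits k T B"
  unfolding hits_def using assms by (intro sum_mono card_mono) auto

lemma hits_cover:
  assumes "finite X" "\<And>x. x \<in> X \<Longrightarrow> finite (B x)" "A \<subseteq> (\<Union>x\<in>X. B x)"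
  shows "hits k T A \<le> (\<Sum>x\<in>X. hits k T (B x))"
proof -
  have "card (T i \<inter> A) \<le> (\<Sum>x\<in>X. card (T i \<inter> B x))" for i
  proof (rule card_le_sum_image[OF assms(1)])
    show "T i \<inter> A \<subseteq> (\<Union>x\<in>X. T i \<inter> B x)" using assms(3) by blast
  qed (use assms(2) in simp)
  then have "hits k T A \<le> (\<Sum>i\<in>{1..k}. \<Sum>x\<in>X. card (T i \<inter> B x))"
    unfolding hits_def by (intro sum_mono)
  also have "\<dots> = (\<Sum>x\<in>X. hits k T (B x))" unfolding hits_def by (rule sum.swap)
  finally show ?thesis .
qed

definition minimal_heavy :: "nat \<Rightarrow> nat \<Rightarrow> real \<Rightarrow> nat set \<Rightarrow> nat set set \<Rightarrow> nat set set" where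
  "minimal_heavy n d t \<rho> S = {\<pi>. \<rho> \<subseteq> \<pi> \<and> heavy n d t S \<pi> \<and>
     (\<forall>\<pi>'. \<rho> \<subseteq> \<pi>' \<and> \<pi>' \<subset> \<pi> \<longrightarrow> \<not> heavy n d t S \<pi>')}"

lemma finite_minimal_heavy:
  assumes "S \<subseteq> nsets {1..n} d" "t > 0" "n > 0"
  shows "finite (minimal_heavy n d t \<rho> S)"
proof (rule finite_subset)
  show "minimal_heavy n d t \<rho> S \<subseteq> Pow {1..n}"
  proof
    fix \<pi> assume "\<pi> \<in> minimal_heavy n d t \<rho> S"
    then have "heavy n d t S \<pi>" by (simp add: minimal_heavy_def)
    from heavyD(2)[OF this assms] show "\<pi> \<in> Pow {1..n}" by simp
  qed
qed simp

text \<open>Each member of \<open>S\<close> is itself heavy, so a minimal heavy set below it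
  exists.\<close>

lemma contains_minimal_heavy:
  assumes S: "S \<subseteq> star \<rho> (nsets {1..n} d)" and "\<sigma> \<in> S"
  obtains \<pi> where "\<pi> \<in> minimal_heavy n d t \<rho> S" "\<pi> \<subseteq> \<sigma>"
proof -
  have \<sigma>: "\<sigma> \<in> nsets {1..n} d" "\<rho> \<subseteq> \<sigma>" using assms by auto
  have "star \<sigma> S = {\<sigma>}"
  proof (intro equalityI subsetI)
    fix \<sigma>' assume "\<sigma>' \<in> star \<sigma> S"
    then have "\<sigma>' \<in> nsets {1..n} d" "\<sigma> \<subseteq> \<sigma>'" using S by blast+
    from nsets_subset_eq[OF \<sigma>(1) this] show "\<sigma>' \<in> {\<sigma>}" by simp
  qed (use assms in simp)
  then have "heavy n d t S \<sigma>" using \<sigma> by (simp add: heavy_def nsets_def)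
  then have in_F: "\<sigma> \<in> {\<pi> \<in> Pow \<sigma>. \<rho> \<subseteq> \<pi> \<and> heavy n d t S \<pi>}" (is "_ \<in> ?F") using \<sigma> by simp
  have "finite ?F" using \<sigma> by (simp add: nsets_def)
  from finite_has_minimal2[OF this in_F] obtain \<pi>
    where \<pi>: "\<pi> \<in> ?F" and least: "\<forall>\<pi>'\<in>?F. \<pi>' \<subseteq> \<pi> \<longrightarrow> \<pi> = \<pi>'" by (elim bexE conjE) 
  have "\<not> heavy n d t S \<pi>'" if "\<rho> \<subseteq> \<pi>'" "\<pi>' \<subset> \<pi>" for \<pi>'
  proof
    assume "heavy n d t S \<pi>'"
    then have "\<pi>' \<in> ?F" using that \<pi> by blast
    then have "\<pi> = \<pi>'" using least that(2) by (meson psubset_imp_subset)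
    then show False using that(2) by simp
  qed
  then have "\<pi> \<in> minimal_heavy n d t \<rho> S" using \<pi> by (simp add: minimal_heavy_def)
  then show thesis using that \<pi> by simp
qed

text \<open>In a face that is not bad the heavy sets are closed under intersection, so they have a least
  element, and the whole of \<open>S\<close> inside the face lies in the star of that element.\<close>

lemma minimal_heavy_multiplicity:
  assumes S: "S \<subseteq> star \<rho> (nsets {1..n} d)" and \<tau>: "\<tau> \<in> nsets {1..n} (d + 1)"
  shows "card {\<pi> \<in> minimal_heavy n d t \<rho> S. \<tau> \<in> cob n d (star \<pi> S)}
     \<le> of_bool (\<tau> \<in> cob n d S) + 2 ^ (d + 1) * of_bool (\<tau> \<in> bad n d t \<rho> S)"
proof -
  let ?M = "{\<pi> \<in> minimal_heavy n d t \<rho> S. \<tau> \<in> cob n d (star \<pi> S)}"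
  have f\<tau>: "finite \<tau>" "card \<tau> = d + 1" using \<tau> by (auto simp: nsets_def)
  have M\<tau>: "\<pi> \<subseteq> \<tau>" if "\<pi> \<in> ?M" for \<pi>
  proof -
    have "\<tau> \<in> cob n d (star \<pi> S)" using that by simp
    then obtain \<sigma> where "\<sigma> \<in> star \<pi> S" "\<sigma> \<subseteq> \<tau>" by (rule cobE)
    then show ?thesis by blast
  qed
  show ?thesis
  proof (cases "\<tau> \<in> bad n d t \<rho> S")
    case True
    have "card ?M \<le> card (Pow \<tau>)" using M\<tau> f\<tau> by (intro card_mono) auto
    then show ?thesis using True f\<tau> by (simp add: card_Pow)
  next
    case False
    have least: "\<pi> \<subseteq> \<pi>'" if \<pi>: "\<pi> \<in> ?M" and \<pi>': "\<rho> \<subseteq> \<pi>'" "\<pi>' \<subseteq> \<tau>" "heavy n d t S \<pi>'" for \<pi> \<pi>'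
    proof -
      have h: "heavy n d t S \<pi>" "\<rho> \<subseteq> \<pi>" using \<pi> by (simp_all add: minimal_heavy_def)
      have "heavy n d t S (\<pi> \<inter> \<pi>')"
      proof (rule ccontr)
        assume "\<not> heavy n d t S (\<pi> \<inter> \<pi>')"
        then have "\<tau> \<in> bad n d t \<rho> S"
          unfolding bad_def using \<tau> h \<pi>' M\<tau>[OF \<pi>]
          by (intro CollectI conjI exI[of _ \<pi>] exI[of _ \<pi>']) simp_all
        then show False using \<open>\<tau> \<notin> bad n d t \<rho> S\<close> by simp
      qed
      moreover have "\<forall>\<pi>'. \<rho> \<subseteq> \<pi>' \<and> \<pi>' \<subset> \<pi> \<longrightarrow> \<not> heavy n d t S \<pi>'"
        using \<pi> by (simp add: minimal_heavy_def)
      moreover have "\<rho> \<subseteq> \<pi> \<inter> \<pi>'" using h \<pi>' by simp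
      ultimately have "\<not> \<pi> \<inter> \<pi>' \<subset> \<pi>" by blast
      then show ?thesis by blast
    qed
    show ?thesis
    proof (cases "?M = {}")
      case False
      then obtain \<pi> where \<pi>: "\<pi> \<in> ?M" by blast
      have "\<pi>' = \<pi>" if \<pi>': "\<pi>' \<in> ?M" for \<pi>'
      proof
        have h: "\<rho> \<subseteq> \<pi>" "heavy n d t S \<pi>" "\<rho> \<subseteq> \<pi>'" "heavy n d t S \<pi>'"
          using \<pi> \<pi>' by (simp_all add: minimal_heavy_def)
        show "\<pi>' \<subseteq> \<pi>" by (rule least[OF \<pi>' h(1) M\<tau>[OF \<pi>] h(2)])
        show "\<pi> \<subseteq> \<pi>'" by (rule least[OF \<pi> h(3) M\<tau>[OF \<pi>'] h(4)])
      qed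
      then have "?M = {\<pi>}" using \<pi> by blast
      then have "card ?M = 1" by (simp only: card.insert card.empty finite.emptyI) simp
      moreover have "\<tau> \<in> cob n d S"
      proof -
        have "{\<sigma> \<in> S. \<sigma> \<subseteq> \<tau>} = {\<sigma> \<in> star \<pi> S. \<sigma> \<subseteq> \<tau>}"
        proof (intro equalityI subsetI)
          fix \<sigma> assume \<sigma>: "\<sigma> \<in> {\<sigma> \<in> S. \<sigma> \<subseteq> \<tau>}"
          then have "\<sigma> \<in> S" by simp
          from contains_minimal_heavy[OF S this] obtain \<pi>' where
            \<pi>': "\<pi>' \<in> minimal_heavy n d t \<rho> S" "\<pi>' \<subseteq> \<sigma>" .
          have "\<pi> \<subseteq> \<pi>'"
          proof (rule least[OF \<pi>])
            show "\<rho> \<subseteq> \<pi>'" "heavy n d t S \<pi>'" using \<pi>'(1) by (simp_all add: minimal_heavy_def)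
            show "\<pi>' \<subseteq> \<tau>" using \<pi>'(2) \<sigma> by blast
          qed
          then show "\<sigma> \<in> {\<sigma> \<in> star \<pi> S. \<sigma> \<subseteq> \<tau>}" using \<sigma> \<pi>'(2) by blast
        qed blast
        moreover have "\<tau> \<in> cob n d (star \<pi> S)" using \<pi> by simp
        ultimately show ?thesis unfolding cob_def by simp
      qed
      ultimately show ?thesis by simp
    next
      case True
      show ?thesis by (simp only: True card.empty le0)
    qed
  qed
qed

lemma sum_hits_minimal_heavy:
  assumes S: "S \<subseteq> star \<rho> (nsets {1..n} d)" and tn: "t > 0" "n > 0"
  shows "(\<Sum>\<pi>\<in>minimal_heavy n d t \<rho> S. hits k T (cob n d (star \<pi> S)))
     \<le> hits k T (cob n d S) + 2 ^ (d + 1) * hits k T (bad n d t \<rho> S)"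
proof -
  let ?R = "minimal_heavy n d t \<rho> S" and ?N = "nsets {1..n} (d + 1)"
  have R: "finite ?R" by (rule finite_minimal_heavy[OF _ tn]) (use S in blast)
  have N: "cob n d S' \<subseteq> ?N" for S' using cob_subset[of n d S'] by simp
  have "(\<Sum>\<pi>\<in>?R. card (T i \<inter> cob n d (star \<pi> S)))
      \<le> card (T i \<inter> cob n d S) + 2 ^ (d + 1) * card (T i \<inter> bad n d t \<rho> S)" for i
  proof -
    have fin: "finite (T i \<inter> ?N)" by simp
    have "(\<Sum>\<pi>\<in>?R. card (T i \<inter> cob n d (star \<pi> S)))
        = (\<Sum>\<pi>\<in>?R. card {\<tau> \<in> T i \<inter> ?N. \<tau> \<in> cob n d (star \<pi> S)})"
      using N by (intro sum.cong refl arg_cong[where f = card]) blast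
    also have "\<dots> = (\<Sum>\<tau>\<in>T i \<inter> ?N. card {\<pi> \<in> ?R. \<tau> \<in> cob n d (star \<pi> S)})"
      by (rule sum_multicount_gen[OF R fin]) simp
    also have "\<dots> \<le> (\<Sum>\<tau>\<in>T i \<inter> ?N. of_bool (\<tau> \<in> cob n d S) + 2 ^ (d + 1) * of_bool (\<tau> \<in> bad n d t \<rho> S))"
      by (intro sum_mono minimal_heavy_multiplicity[OF S]) simp
    also have "\<dots> = card (T i \<inter> ?N \<inter> cob n d S) + 2 ^ (d + 1) * card (T i \<inter> ?N \<inter> bad n d t \<rho> S)"
      using fin by (simp only: sum.distrib sum_distrib_left[symmetric] sum_of_bool_eq)
        (simp add: Int_def)
    also have "T i \<inter> ?N \<inter> cob n d S = T i \<inter> cob n d S" using N by blast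
    also have "T i \<inter> ?N \<inter> bad n d t \<rho> S = T i \<inter> bad n d t \<rho> S" unfolding bad_def by blast
    finally show ?thesis .
  qed
  then have "(\<Sum>i\<in>{1..k}. \<Sum>\<pi>\<in>?R. card (T i \<inter> cob n d (star \<pi> S)))
      \<le> (\<Sum>i\<in>{1..k}. card (T i \<inter> cob n d S) + 2 ^ (d + 1) * card (T i \<inter> bad n d t \<rho> S))"
    by (rule sum_mono)
  then show ?thesis
    unfolding hits_def by (subst sum.swap) (simp only: sum.distrib sum_distrib_left)
qed

text \<open>The size condition keeps \<rho> below its own threshold, so all minimal heavy sets
  contain \<rho> properly and fall under the induction hypothesis, which applies because stars
  inherit minimality. Their stars cover \<open>S\<close>; the coboundaries of the stars overlap in
  at most one layer, apart from the bad faces.\<close>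

lemma descent:
  assumes min: "link_minimal n e \<rho> S" and t: "0 < t" "t < 1" and n: "n > 0"
    and size: "real (card S) = t ^ (2 ^ (Suc e - card \<rho>)) * real n ^ (Suc e - card \<rho>)"
    and IH: "\<And>\<pi>. \<rho> \<subset> \<pi> \<Longrightarrow> \<pi> \<subseteq> {1..n} \<Longrightarrow> card \<pi> \<le> Suc e \<Longrightarrow> link_expands k T n e C \<pi>"
    and C: "C \<ge> 0"
  shows "real k * real (card S) + real (hits k T (touch n (Suc e) S))
     \<le> C * (real (hits k T (cob n (Suc e) S)) + 2 ^ (e + 2) * real (hits k T (bad n (Suc e) t \<rho> S)))"
proof -
  let ?d = "Suc e"
  let ?R = "minimal_heavy n ?d t \<rho> S"
  have S: "S \<subseteq> star \<rho> (nsets {1..n} ?d)" using min by (auto simp: link_minimal_def)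
  have S': "S \<subseteq> nsets {1..n} ?d" using S by blast
  have fS: "finite S" by (rule link_minimal_finite[OF min])
  have R: "finite ?R" by (rule finite_minimal_heavy[OF S' t(1) n])
  have "star \<rho> S = S" using S by blast
  then have not\<rho>: "\<not> heavy n ?d t S \<rho>"
  proof -
    have pos: "t ^ (2 ^ (?d - card \<rho>) - 1) * real n ^ (?d - card \<rho>) > 0" using t n by simp
    have "t ^ (2 ^ (?d - card \<rho>)) = t * t ^ (2 ^ (?d - card \<rho>) - 1)"
      using power_Suc[of t "2 ^ (?d - card \<rho>) - 1"] by simp
    then have "real (card S) = t * (t ^ (2 ^ (?d - card \<rho>) - 1) * real n ^ (?d - card \<rho>))"
      using size by simp
    also have "\<dots> < t ^ (2 ^ (?d - card \<rho>) - 1) * real n ^ (?d - card \<rho>)"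
      using mult_strict_right_mono[OF t(2) pos] by (simp only: mult_1)
    finally show ?thesis using \<open>star \<rho> S = S\<close> by (simp add: heavy_def)
  qed
  have exp: "real k * real (card (star \<pi> S)) + real (hits k T (touch n ?d (star \<pi> S)))
      \<le> C * real (hits k T (cob n ?d (star \<pi> S)))" if "\<pi> \<in> ?R" for \<pi>
  proof -
    have h: "heavy n ?d t S \<pi>" and "\<rho> \<subseteq> \<pi>" using that by (simp_all add: minimal_heavy_def)
    then have "\<rho> \<subset> \<pi>" using not\<rho> by auto
    then have "link_expands k T n e C \<pi>" using heavyD[OF h S' t(1) n] IH by simp
    then show ?thesis using link_minimal_star[OF min \<open>\<rho> \<subseteq> \<pi>\<close>] unfolding link_expands_def by blast
  qed
  have "card S \<le> (\<Sum>\<pi>\<in>?R. card (star \<pi> S))"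
  proof (rule card_le_sum_image[OF R])
    show "S \<subseteq> (\<Union>\<pi>\<in>?R. star \<pi> S)"
    proof
      fix \<sigma> assume "\<sigma> \<in> S"
      from contains_minimal_heavy[OF S this] obtain \<pi> where "\<pi> \<in> ?R" "\<pi> \<subseteq> \<sigma>" .
      then show "\<sigma> \<in> (\<Union>\<pi>\<in>?R. star \<pi> S)" using \<open>\<sigma> \<in> S\<close> by blast
    qed
  qed (use fS in simp)
  moreover have "hits k T (touch n ?d S) \<le> (\<Sum>\<pi>\<in>?R. hits k T (touch n ?d (star \<pi> S)))"
  proof (rule hits_cover[OF R])
    show "touch n ?d S \<subseteq> (\<Union>\<pi>\<in>?R. touch n ?d (star \<pi> S))"
    proof
      fix \<tau> assume "\<tau> \<in> touch n ?d S"
      then obtain \<sigma> where \<sigma>: "\<sigma> \<in> S" "\<sigma> \<subseteq> \<tau>" "\<tau> \<in> nsets {1..n} (?d + 1)" by (auto simp: touch_def)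
      from contains_minimal_heavy[OF S \<sigma>(1)] obtain \<pi> where "\<pi> \<in> ?R" "\<pi> \<subseteq> \<sigma>" .
      then show "\<tau> \<in> (\<Union>\<pi>\<in>?R. touch n ?d (star \<pi> S))" using \<sigma> by (auto simp: touch_def)
    qed
  qed (simp add: touch_def)
  ultimately have "real k * real (card S) + real (hits k T (touch n ?d S))
      \<le> real k * real (\<Sum>\<pi>\<in>?R. card (star \<pi> S)) + real (\<Sum>\<pi>\<in>?R. hits k T (touch n ?d (star \<pi> S)))"
    by (intro add_mono mult_left_mono of_nat_mono) simp_all
  also have "\<dots> = (\<Sum>\<pi>\<in>?R. real k * real (card (star \<pi> S)) + real (hits k T (touch n ?d (star \<pi> S))))"
    by (simp only: of_nat_sum sum.distrib sum_distrib_left)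
  also have "\<dots> \<le> (\<Sum>\<pi>\<in>?R. C * real (hits k T (cob n ?d (star \<pi> S))))"
    by (intro sum_mono exp)
  also have "\<dots> = C * real (\<Sum>\<pi>\<in>?R. hits k T (cob n ?d (star \<pi> S)))"
    by (simp only: of_nat_sum sum_distrib_left)
  also have "\<dots> \<le> C * real (hits k T (cob n ?d S) + 2 ^ (?d + 1) * hits k T (bad n ?d t \<rho> S))"
    using C by (intro mult_left_mono of_nat_mono sum_hits_minimal_heavy[OF S t(1) n])
  finally show ?thesis by simp
qed

section \<open>Tail bounds\<close>

lemma power_div_fact_le_exp:
  fixes x :: real
  assumes "x \<ge> 0"
  shows "x ^ m / fact m \<le> exp x"
proof -
  have "(\<lambda>i. x ^ i / fact i) sums exp x"
    using exp_converges[of x] by (simp add: divide_inverse mult.commute)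
  then have "sum (\<lambda>i. x ^ i / fact i) {m} \<le> exp x"
    using assms sum_le_suminf[of "\<lambda>i. x ^ i / fact i" "{m}"] by (auto simp: sums_iff)
  then show ?thesis by simp
qed

lemma exp_neg_le_inverse_power:
  assumes "n > 0"
  shows "exp (- real n) \<le> fact q / real n ^ q"
proof -
  have "real n ^ q \<le> fact q * exp (real n)"
    using power_div_fact_le_exp[of "real n" q] by (simp add: divide_le_eq mult.commute)
  then show ?thesis using assms by (simp add: exp_minus field_simps)
qed

text \<open>The bound (e N / m)^m. With z = m ln(m / N) it reads exp(m - z), the form in which it is
  compared with tails of the shape exp(c z).\<close>

lemma binomial_le_exp:
  assumes "m > 0" "N > 0" "M \<le> N"
  shows "real (M choose m) \<le> exp (real m - real m * ln (real m / real N))"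
proof -
  have "M choose m \<le> N choose m" using assms by (intro binomial_right_mono)
  then have "real (M choose m) \<le> real (N choose m)" by simp
  also have "\<dots> \<le> real N ^ m / fact m"
  proof -
    have "real ((N choose m) * fact m) \<le> real (N ^ m)"
      using binomial_fact_pow[of N m] by (rule of_nat_mono)
    then show ?thesis by (simp add: field_simps)
  qed
  also have "\<dots> = (real N / real m) ^ m * (real m ^ m / fact m)"
    using assms by (simp add: power_divide)
  also have "\<dots> \<le> (real N / real m) ^ m * exp (real m)"
    using power_div_fact_le_exp[of "real m" m] by (intro mult_left_mono) auto
  also have "(real N / real m) ^ m = exp (- (real m * ln (real m / real N)))"
  proof -
    have "- ln (real m / real N) = ln (real N / real m)" using assms by (simp add: ln_div)
    then have "exp (- (real m * ln (real m / real N))) = exp (real m * ln (real N / real m))"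
      by (metis mult_minus_right)
    also have "\<dots> = (real N / real m) ^ m" using assms by (simp add: exp_of_nat_mult)
    finally show ?thesis by simp
  qed
  finally show ?thesis by (simp add: exp_diff exp_minus field_simps)
qed

text \<open>From m \<le> 2^(m-1) follows m^m \<le> (2 m)^(m-1) \<le> N^(m-1). The bound is uniform
  in m, so in a union bound every cardinality pays the same power of N.\<close>

lemma self_power_le:
  assumes "m \<ge> 1" "2 * m \<le> (N::nat)"
  shows "(real m / real N) ^ m \<le> 1 / real N"
proof -
  have N: "N > 0" using assms by linarith
  have "m < 2 ^ m" by (rule less_exp)
  also have "(2::nat) ^ m = 2 * 2 ^ (m - 1)" using assms by (cases m) auto
  finally have two: "m \<le> 2 ^ (m - 1)" using assms by (cases m) (auto simp: Suc_leI less_exp)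
  have "m ^ m = m * m ^ (m - 1)" using assms by (cases m) auto
  also have "\<dots> \<le> 2 ^ (m - 1) * m ^ (m - 1)" using two by (rule mult_le_mono1)
  also have "\<dots> = (2 * m) ^ (m - 1)" by (simp add: power_mult_distrib)
  also have "\<dots> \<le> N ^ (m - 1)" using assms by (intro power_mono) auto
  finally have "m ^ m * N \<le> N ^ (m - 1) * N" by (rule mult_le_mono1)
  also have "\<dots> = N ^ m" using assms by (cases m) auto
  finally have "real (m ^ m * N) \<le> real (N ^ m)" by (rule of_nat_mono)
  then show ?thesis using N by (simp add: power_divide field_simps)
qed

lemma prob_UN_le:
  assumes "finite I" "\<And>i. i \<in> I \<Longrightarrow> measure_pmf.prob p (F i) \<le> b" "E \<subseteq> (\<Union>i\<in>I. F i)"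
  shows "measure_pmf.prob p E \<le> real (card I) * b"
proof -
  have "measure_pmf.prob p E \<le> measure_pmf.prob p (\<Union>i\<in>I. F i)"
    using assms(3) by (intro measure_pmf.finite_measure_mono) auto
  also have "\<dots> \<le> (\<Sum>i\<in>I. measure_pmf.prob p (F i))"
    using assms(1) by (intro measure_UNION_le) auto
  also have "\<dots> \<le> (\<Sum>i\<in>I. b)" by (intro sum_mono assms(2))
  finally show ?thesis by simp
qed

lemma rate_bounds:
  assumes "n > 0"
  shows "rate n d l \<ge> 0" "rate n d l * real n \<le> real d + 1 + real l"
  using assms by (auto simp: rate_def field_simps)

text \<open>The solution \<open>t\<close> of \<open>card S = t ^ (2 ^ D) * n ^ D\<close>.\<close>

definition scale :: "nat \<Rightarrow> nat \<Rightarrow> nat set set \<Rightarrow> real" where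
  "scale n D S = root (2 ^ D) (real (card S) / real n ^ D)"

text \<open>The parameter is \<open>y = - ln t\<close>. The mean per copy is at most
  \<open>L * 8 ^ d * t * m\<close>, so multiplying by 1/t leaves \<open>L * 8 ^ d * m\<close>,
  whereas the threshold contributes \<open>\<delta> * m * ln (1/t)\<close> per copy. For small
  \<open>t\<close> the former is at most half the latter. As ln t is ln(m / n^D) divided by 2^D, the
  resulting exponent is a multiple of the entropy of \<open>S\<close>.\<close>

lemma bad_hits_tail:
  assumes law: "hypertree_law n d l p" and n: "n > 0"
    and S: "S \<subseteq> star \<rho> (nsets {1..n} d)" and ne: "S \<noteq> {}" and \<delta>: "\<delta> > 0"
    and small: "scale n D S < 1" "(real d + 1 + real l) * 8 ^ d \<le> - (\<delta> / 2) * ln (scale n D S)"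
  shows "measure_pmf.prob (copies k p)
      {T. \<delta> * real k * real (card S) < real (hits k T (bad n d (scale n D S) \<rho> S))}
    \<le> exp (real k * real (card S) * (\<delta> / (2 * 2 ^ D)) * ln (real (card S) / real n ^ D))"
proof -
  define t where "t = scale n D S"
  define m where "m = real (card S)"
  define L where "L = real d + 1 + real l"
  define B where "B = bad n d t \<rho> S"
  have "finite S" by (rule finite_subset[OF S]) simp
  then have m: "m > 0" using ne by (simp add: m_def card_gt_0_iff)
  have t: "0 < t" "t < 1" using small m n by (auto simp: t_def scale_def m_def)
  have L: "L \<ge> 0" by (simp add: L_def)
  have lnt: "ln t = ln (m / real n ^ D) / 2 ^ D"
    using m n by (simp add: t_def scale_def m_def ln_root)
  have B: "B \<subseteq> nsets {1..n} (d + 1)" by (auto simp: B_def bad_def)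
  have "rate n d l * real (card B) \<le> rate n d l * (8 ^ d * real n * t * m)"
    unfolding B_def m_def using card_bad_le[OF S t n] rate_bounds(1)[OF n] by (intro mult_left_mono)
  also have "\<dots> = (rate n d l * real n) * (8 ^ d * t * m)" by (simp only: mult_ac)
  also have "\<dots> \<le> L * (8 ^ d * t * m)"
    using rate_bounds(2)[OF n, of d l] t m by (intro mult_right_mono) (auto simp: L_def)
  finally have rB: "rate n d l * real (card B) \<le> L * 8 ^ d * t * m" by (simp only: mult_ac)
  have "(1 / t - 1) * (rate n d l * real (card B)) \<le> (1 / t - 1) * (L * 8 ^ d * t * m)"
    using rB t by (intro mult_left_mono) (auto simp: field_simps)
  also have "\<dots> \<le> 1 / t * (L * 8 ^ d * t * m)"
    using t L m by (intro mult_right_mono) auto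
  also have "\<dots> = L * 8 ^ d * m" using t by simp
  also have "\<dots> \<le> - (\<delta> / 2) * ln t * m"
    using small(2) m unfolding t_def[symmetric] L_def[symmetric] by (intro mult_right_mono) auto
  finally have X: "(1 / t - 1) * rate n d l * real (card B) \<le> - (\<delta> / 2) * ln t * m"
    by (simp only: mult.assoc)
  have "measure_pmf.prob (copies k p) {T. \<delta> * real k * m < real (hits k T B)}
      \<le> measure_pmf.prob (copies k p) {T. (- ln t) * (\<delta> * real k * m) \<le> (- ln t) * real (hits k T B)}"
    using t by (intro measure_pmf.finite_measure_mono) (auto simp: mult_le_cancel_left)
  also have "\<dots> \<le> exp (real k * ((exp (- ln t) - 1) * rate n d l * real (card B)) - (- ln t) * (\<delta> * real k * m))"
    by (rule hits_chernoff[OF law B])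
  also have "\<dots> \<le> exp (real k * (- (\<delta> / 2) * ln t * m) - (- ln t) * (\<delta> * real k * m))"
  proof -
    have "exp (- ln t) = 1 / t" using t by (simp add: exp_minus inverse_eq_divide)
    then show ?thesis using X by (intro exp_le_cancel_iff[THEN iffD2] diff_right_mono mult_left_mono) auto
  qed
  also have "real k * (- (\<delta> / 2) * ln t * m) - (- ln t) * (\<delta> * real k * m)
      = real k * m * (\<delta> / 2) * ln t" by (simp add: algebra_simps)
  also have "\<dots> = real k * m * (\<delta> / (2 * 2 ^ D)) * ln (m / real n ^ D)"
    by (simp add: lnt)
  finally show ?thesis by (simp only: B_def m_def t_def)
qed

lemma card_nsets_interval_le: "card (nsets {1..n} j) \<le> n ^ j"
  using card_star_nsets[of "{}" n j] by simp

lemma small_cochains_tail: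
  fixes \<delta> :: real
  assumes \<delta>: "\<delta> > 0" and D: "D \<ge> 1"
  shows "\<exists>\<mu>>0. \<mu> < 1 \<and> (\<exists>k0. \<forall>k\<ge>k0. \<forall>n>0. \<forall>p. \<forall>\<rho>\<subseteq>{1..n}. hypertree_law n d l p \<longrightarrow> d = card \<rho> + D \<longrightarrow>
    measure_pmf.prob (copies k p) {T. \<exists>S. S \<subseteq> star \<rho> (nsets {1..n} d) \<and> S \<noteq> {} \<and>
      real (card S) \<le> \<mu> * real n ^ D \<and>
      \<delta> * real k * real (card S) < real (hits k T (bad n d (scale n D S) \<rho> S))} \<le> 1 / real n ^ q)"
proof -
  \<comment> \<open>\<open>ln t \<le> - X\<close> is what \<open>bad_hits_tail\<close> asks of the
    scale.\<close>
  define X where "X = 2 * ((real d + 1 + real l) * 8 ^ d) / \<delta>"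
  have X: "X > 0" using \<delta> by (simp add: X_def)
  \<comment> \<open>The bound exp(-1) gives ln(m / N) \<le> -1 and 2 m \<le> N; the other one gives
    \<open>ln t \<le> - X\<close>, because passing from m / N to \<open>t\<close> divides the
    logarithm by 2^D.\<close>
  define \<mu> where "\<mu> = min (exp (- 1)) (exp (- X * 2 ^ D))"
  have \<mu>: "\<mu> > 0" "\<mu> \<le> exp (- 1)" "\<mu> \<le> exp (- X * 2 ^ D)" by (auto simp: \<mu>_def)
  have e1: "exp (- 1) \<le> (1 / 2 :: real)"
    using exp_ge_add_one_self[of 1] by (simp add: exp_minus field_simps)
  \<comment> \<open>With z = m ln(m / N) \<le> - m, the tail is at most exp((q + 3) z). One z
    cancels the - z in the number exp(m - z) of sets, one absorbs m, one pays for the at most N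
    values of m, and q remain for the decay.\<close>
  obtain k0 :: nat where k0: "real k0 \<ge> (real q + 3) * (2 * 2 ^ D) / \<delta>" using real_arch_simple by blast
  have "measure_pmf.prob (copies k p) {T. \<exists>S. S \<subseteq> star \<rho> (nsets {1..n} d) \<and> S \<noteq> {} \<and>
      real (card S) \<le> \<mu> * real n ^ D \<and>
      \<delta> * real k * real (card S) < real (hits k T (bad n d (scale n D S) \<rho> S))} \<le> 1 / real n ^ q"
    (is "measure_pmf.prob _ ?E \<le> _")
    if k: "k \<ge> k0" and n: "n > 0" and \<rho>: "\<rho> \<subseteq> {1..n}" and law: "hypertree_law n d l p"
      and d: "d = card \<rho> + D" for k n p \<rho>
  proof -
    define N where "N = n ^ D"
    define St where "St = star \<rho> (nsets {1..n} d)"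
    define F where "F S = {T. \<delta> * real k * real (card S) < real (hits k T (bad n d (scale n D S) \<rho> S))}" for S
    define M where "M = {m. 1 \<le> m \<and> real m \<le> \<mu> * real N}"
    have N: "N > 0" using n by (simp add: N_def)
    have St: "finite St" "card St \<le> N"
      using card_star_nsets[OF \<rho>, of d] d by (auto simp: St_def N_def)
    have kk: "(real q + 3) \<le> real k * (\<delta> / (2 * 2 ^ D))"
    proof -
      have "(real q + 3) * (2 * 2 ^ D) / \<delta> \<le> real k" using k0 k by linarith
      then show ?thesis using \<delta> by (simp add: field_simps)
    qed
    have half: "2 * m \<le> N" if "m \<in> M" for m
    proof -
      have "real m \<le> 1 / 2 * real N"
        using that \<mu>(2) e1 mult_right_mono[of \<mu> "1 / 2" "real N"] by (auto simp: M_def)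
      then show ?thesis by linarith
    qed
    have each: "measure_pmf.prob (copies k p) (F S) \<le> exp ((real q + 3) * (real m * ln (real m / real N)))"
      if m: "m \<in> M" and S: "S \<in> nsets St m" for m S
    proof -
      have S': "S \<subseteq> star \<rho> (nsets {1..n} d)" "card S = m" "S \<noteq> {}"
        using S m by (auto simp: nsets_def St_def M_def)
      have m1: "real m \<ge> 1" "real m / real N \<le> \<mu>" using m N by (auto simp: M_def divide_le_eq)
      have pos: "real m / real N > 0" using m1 N by simp
      have lnX: "ln (real m / real N) \<le> - X * 2 ^ D"
      proof -
        have "ln (real m / real N) \<le> ln (exp (- X * 2 ^ D))"
          using pos m1(2) \<mu>(3) by (subst ln_le_cancel_iff) auto
        then show ?thesis by simp
      qed
      have ln_scale: "ln (scale n D S) = ln (real m / real N) / 2 ^ D"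
        using pos S'(2) by (simp add: scale_def N_def ln_root)
      have scale_pos: "scale n D S > 0" using pos S'(2) by (simp add: scale_def N_def)
      have le: "ln (scale n D S) \<le> - X" using lnX by (simp add: ln_scale divide_le_eq)
      then have "ln (scale n D S) < 0" using X by linarith
      then have "scale n D S < 1" using scale_pos by simp
      moreover have "(real d + 1 + real l) * 8 ^ d \<le> - (\<delta> / 2) * ln (scale n D S)"
      proof -
        have "(real d + 1 + real l) * 8 ^ d = (\<delta> / 2) * X" using \<delta> by (simp add: X_def)
        also have "\<dots> \<le> (\<delta> / 2) * (- ln (scale n D S))" using le \<delta> by (intro mult_left_mono) auto
        finally show ?thesis by simp
      qed
      ultimately have "measure_pmf.prob (copies k p) (F S)
          \<le> exp (real k * real m * (\<delta> / (2 * 2 ^ D)) * ln (real m / real N))"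
        unfolding F_def using bad_hits_tail[OF law n S'(1,3) \<delta>, of D k] S'(2) by (simp add: N_def)
      also have "\<dots> \<le> exp ((real q + 3) * (real m * ln (real m / real N)))"
      proof -
        have "real m * ln (real m / real N) \<le> 0"
        proof (rule mult_nonneg_nonpos)
          show "ln (real m / real N) \<le> 0" using lnX X
            by (smt (verit) mult_neg_pos mult_minus_left zero_less_mult_iff zero_less_power)
        qed simp
        then have "(real k * (\<delta> / (2 * 2 ^ D))) * (real m * ln (real m / real N))
            \<le> (real q + 3) * (real m * ln (real m / real N))"
          using kk by (rule mult_right_mono_neg[rotated])
        then show ?thesis by (simp add: mult_ac)
      qed
      finally show ?thesis .
    qed
    have level: "measure_pmf.prob (copies k p) (\<Union>S\<in>nsets St m. F S) \<le> (1 / real N) ^ (q + 1)"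
      if m: "m \<in> M" for m
    proof -
      define z where "z = real m * ln (real m / real N)"
      have m1: "m \<ge> 1" "real m / real N \<le> \<mu>" using m N by (auto simp: M_def divide_le_eq)
      have pos: "real m / real N > 0" using m1 N by simp
      have z: "z \<le> - real m"
      proof -
        have "ln (real m / real N) \<le> ln (exp (- 1))"
          using pos m1(2) \<mu>(2) by (subst ln_le_cancel_iff) auto
        then have "real m * ln (real m / real N) \<le> real m * (- 1)" by (intro mult_left_mono) auto
        then show ?thesis by (simp add: z_def)
      qed
      have "measure_pmf.prob (copies k p) (\<Union>S\<in>nsets St m. F S) \<le> real (card (nsets St m)) * exp ((real q + 3) * z)"
        using St each[OF m] by (intro prob_UN_le[where F = F]) (auto simp: z_def)
      also have "\<dots> \<le> exp (real m - z) * exp ((real q + 3) * z)"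
        using binomial_le_exp[OF _ N St(2), of m] m1 St(1)
        by (intro mult_right_mono) (auto simp: card_nsets z_def)
      also have "\<dots> = exp (real m - z + (real q + 3) * z)" by (simp add: exp_add)
      also have "\<dots> \<le> exp (real (q + 1) * z)" using z by (simp add: algebra_simps)
      also have "\<dots> = exp z ^ (q + 1)" by (rule exp_of_nat_mult)
      also have "exp z = (real m / real N) ^ m" using pos by (simp add: z_def exp_of_nat_mult)
      also have "((real m / real N) ^ m) ^ (q + 1) \<le> (1 / real N) ^ (q + 1)"
        using self_power_le[OF m1(1) half[OF m]] by (intro power_mono) auto
      finally show ?thesis .
    qed
    have M: "M \<subseteq> {1..N}"
    proof
      fix m assume "m \<in> M"
      then show "m \<in> {1..N}" using half[of m] by (simp add: M_def)
    qed
    then have fM: "finite M" by (rule finite_subset) simp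
    have "?E \<subseteq> (\<Union>m\<in>M. \<Union>S\<in>nsets St m. F S)"
    proof
      fix T assume "T \<in> ?E"
      then obtain S where S: "S \<subseteq> St" "S \<noteq> {}" "real (card S) \<le> \<mu> * real N" "T \<in> F S"
        by (auto simp: St_def N_def F_def)
      have "finite S" using S(1) St(1) by (rule finite_subset)
      then have "card S \<in> M" "S \<in> nsets St (card S)" using S by (auto simp: M_def nsets_def Suc_le_eq card_gt_0_iff)
      then show "T \<in> (\<Union>m\<in>M. \<Union>S\<in>nsets St m. F S)" using S(4) by blast
    qed
    from prob_UN_le[OF fM level this]
    have "measure_pmf.prob (copies k p) ?E \<le> real (card M) * (1 / real N) ^ (q + 1)" by simp
    also have "\<dots> \<le> real N * (1 / real N) ^ (q + 1)"
    proof (rule mult_right_mono)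
      have "card M \<le> card {1..N}" using M by (intro card_mono) auto
      then show "real (card M) \<le> real N" by simp
    qed simp
    also have "\<dots> = (1 / real N) ^ q" using N by simp
    also have "\<dots> \<le> (1 / real n) ^ q"
    proof (rule power_mono)
      have "n ^ 1 \<le> n ^ D" using n D by (intro power_increasing) auto
      then show "1 / real N \<le> 1 / real n" using n N unfolding N_def by (intro divide_left_mono) (auto simp flip: of_nat_power)
    qed simp
    finally show ?thesis by (simp add: power_divide)
  qed
  moreover have "\<mu> < 1" using \<mu>(2) e1 by linarith
  ultimately show ?thesis using \<mu>(1) by (intro exI[of _ \<mu>] conjI exI[of _ k0]) blast+
qed

text \<open>The mean of W on the coboundary is at least k m / 2 by the cone inequality, since n is
  large enough for (n - |\<rho>|) / (n + l) \<ge> 1/2. The Chernoff bound at k m / 8 with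
  \<open>y = -1\<close> leaves exp(- k m / 8), and \<open>k \<ge> 16 / \<mu>\<close> brings this to
  exp(- 2 N), which beats the at most 2^N candidates \<open>S\<close>.\<close>

lemma large_cochains_tail:
  fixes \<mu> :: real
  assumes \<mu>: "\<mu> > 0" and D: "D \<ge> 1"
    and k: "real k \<ge> 16 / \<mu>" and n: "n > 0" "n \<ge> 2 * Suc e + l" and \<rho>: "\<rho> \<subseteq> {1..n}"
    and law: "hypertree_law n (Suc e) l p" and d: "Suc e = card \<rho> + D"
  shows "measure_pmf.prob (copies k p) {T. \<exists>S. link_minimal n e \<rho> S \<and>
      \<mu> * real n ^ D < real (card S) \<and>
      real (hits k T (cob n (Suc e) S)) < real k * real (card S) / 8} \<le> exp (- real n)"
    (is "measure_pmf.prob _ ?E \<le> _")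
proof -
  define N where "N = n ^ D"
  define St where "St = star \<rho> (nsets {1..n} (Suc e))"
  define Fam where "Fam = {S. link_minimal n e \<rho> S \<and> \<mu> * real N < real (card S)}"
  define F where "F S = {T. real (hits k T (cob n (Suc e) S)) < real k * real (card S) / 8}" for S
  have N: "real N \<ge> real n"
  proof -
    have "n ^ 1 \<le> n ^ D" using n D by (intro power_increasing) auto
    then show ?thesis by (simp add: N_def)
  qed
  have St: "finite St" "card St \<le> N"
    using card_star_nsets[OF \<rho>, of "Suc e"] d by (auto simp: St_def N_def)
  have Fam: "Fam \<subseteq> Pow St" by (auto simp: Fam_def link_minimal_def St_def)
  then have fin: "finite Fam" by (rule finite_subset) (simp add: St)
  have each: "measure_pmf.prob (copies k p) (F S) \<le> exp (- 2 * real N)" if S: "S \<in> Fam" for S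
  proof -
    define m where "m = real (card S)"
    define A where "A = cob n (Suc e) S"
    have min: "link_minimal n e \<rho> S" and m: "m > \<mu> * real N" using S by (auto simp: Fam_def m_def)
    have A: "A \<subseteq> nsets {1..n} (Suc e + 1)" using cob_subset by (simp add: A_def)
    have j: "card \<rho> \<le> n" using card_mono[OF _ \<rho>] by simp
    have "real ((n - card \<rho>) * card S) \<le> real ((Suc (Suc e) - card \<rho>) * card A)"
      unfolding A_def by (intro of_nat_mono link_expansion_complete[OF min \<rho>])
    then have "(real n - real (card \<rho>)) * m \<le> (real D + 1) * real (card A)"
      using d j by (simp add: m_def of_nat_diff distrib_right)
    also have "\<dots> \<le> (real (Suc e) + 1 + real l) * real (card A)" using d by (intro mult_right_mono) auto
    finally have "(real n - real (card \<rho>)) * m / (real n + real l) \<le> rate n (Suc e) l * real (card A)"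
      using n by (simp add: rate_def divide_right_mono)
    moreover have "m / 2 \<le> (real n - real (card \<rho>)) * m / (real n + real l)"
    proof -
      have "2 * card \<rho> + l \<le> n" using n(2) unfolding d by simp
      then have "real (2 * card \<rho> + l) \<le> real n" by (rule of_nat_mono)
      then have "real n + real l \<le> 2 * (real n - real (card \<rho>))" by simp
      then have "m * (real n + real l) \<le> m * (2 * (real n - real (card \<rho>)))"
        by (intro mult_left_mono) (auto simp: m_def)
      then show ?thesis using n by (simp add: field_simps)
    qed
    ultimately have r: "m / 2 \<le> rate n (Suc e) l * real (card A)" by linarith
    have e1: "exp (- 1) \<le> (1 / 2 :: real)"
      using exp_ge_add_one_self[of 1] by (simp add: exp_minus field_simps)
    have "measure_pmf.prob (copies k p) (F S)
        \<le> measure_pmf.prob (copies k p) {T. (- 1) * (real k * m / 8) \<le> (- 1) * real (hits k T A)}"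
      by (intro measure_pmf.finite_measure_mono) (auto simp: F_def m_def A_def)
    also have "\<dots> \<le> exp (real k * ((exp (- 1) - 1) * rate n (Suc e) l * real (card A)) - (- 1) * (real k * m / 8))"
      by (rule hits_chernoff[OF law A])
    also have "\<dots> \<le> exp (real k * (- (m / 4)) - (- 1) * (real k * m / 8))"
    proof -
      have "(exp (- 1) - 1) * (rate n (Suc e) l * real (card A)) \<le> (- (1 / 2)) * (rate n (Suc e) l * real (card A))"
        using e1 rate_bounds(1)[OF n(1), of "Suc e" l] by (intro mult_right_mono) auto
      also have "\<dots> \<le> - (m / 4)" using r by linarith
      finally have "(exp (- 1) - 1) * rate n (Suc e) l * real (card A) \<le> - (m / 4)" by (simp only: mult.assoc)
      then show ?thesis by (intro exp_le_cancel_iff[THEN iffD2] diff_right_mono mult_left_mono) auto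
    qed
    also have "\<dots> \<le> exp (- 2 * real N)"
    proof -
      have "16 * real N \<le> real k * m"
      proof -
        have "16 / \<mu> * (\<mu> * real N) \<le> real k * m" using k m \<mu> by (intro mult_mono) auto
        then show ?thesis using \<mu> by simp
      qed
      then show ?thesis by (simp add: mult.commute)
    qed
    finally show ?thesis .
  qed
  have "?E \<subseteq> (\<Union>S\<in>Fam. F S)" by (auto simp: Fam_def F_def N_def)
  from prob_UN_le[OF fin each this]
  have "measure_pmf.prob (copies k p) ?E \<le> real (card Fam) * exp (- 2 * real N)" .
  also have "\<dots> \<le> exp (real N) * exp (- 2 * real N)"
  proof (rule mult_right_mono)
    have "card Fam \<le> card (Pow St)" using Fam St by (intro card_mono) auto
    also have "\<dots> \<le> 2 ^ N" using St by (simp add: card_Pow power_increasing)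
    finally have "real (card Fam) \<le> real (2 ^ N)" by (rule of_nat_mono)
    also have "\<dots> = 2 ^ N" by simp
    also have "\<dots> \<le> exp 1 ^ N" using exp_ge_add_one_self[of "1::real"] by (intro power_mono) auto
    also have "\<dots> = exp (real N)" by (simp flip: exp_of_nat_mult)
    finally show "real (card Fam) \<le> exp (real N)" .
  qed simp
  also have "\<dots> = exp (- real N)" by (simp flip: exp_add)
  also have "\<dots> \<le> exp (- real n)" using N by simp
  finally show ?thesis .
qed

lemma degree_tail:
  assumes k: "k \<ge> 1" and n: "n > 0" and \<rho>: "\<rho> \<subseteq> {1..n}" and law: "hypertree_law n d l p"
    and d: "d = card \<rho> + D" and D: "D \<ge> 1"
  shows "measure_pmf.prob (copies k p)
      {T. (2 * (real d + 1 + real l) + 1) * real k * real n ^ D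
        < real (hits k T (star \<rho> (nsets {1..n} (d + 1))))} \<le> exp (- real n)"
proof -
  define L where "L = real d + 1 + real l"
  define A where "A = star \<rho> (nsets {1..n} (d + 1))"
  define N where "N = real n ^ D"
  have A: "A \<subseteq> nsets {1..n} (d + 1)" by (auto simp: A_def)
  have N: "N \<ge> real n"
  proof -
    have "real n ^ 1 \<le> real n ^ D" using n D by (intro power_increasing) auto
    then show ?thesis by (simp add: N_def)
  qed
  have "real (card A) \<le> real (n ^ (d + 1 - card \<rho>))"
    unfolding A_def by (intro of_nat_mono card_star_nsets \<rho>)
  also have "\<dots> = real n * N" using d by (simp add: N_def)
  finally have "rate n d l * real (card A) \<le> rate n d l * (real n * N)"
    using rate_bounds(1)[OF n] by (intro mult_left_mono)
  also have "\<dots> = (rate n d l * real n) * N" by simp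
  also have "\<dots> \<le> L * N" using rate_bounds(2)[OF n, of d l] by (intro mult_right_mono) (auto simp: L_def N_def)
  finally have r: "rate n d l * real (card A) \<le> L * N" .
  have "measure_pmf.prob (copies k p) {T. (2 * L + 1) * real k * N < real (hits k T A)}
      \<le> measure_pmf.prob (copies k p) {T. 1 * ((2 * L + 1) * real k * N) \<le> 1 * real (hits k T A)}"
    by (intro measure_pmf.finite_measure_mono) auto
  also have "\<dots> \<le> exp (real k * ((exp 1 - 1) * rate n d l * real (card A)) - 1 * ((2 * L + 1) * real k * N))"
    by (rule hits_chernoff[OF law A])
  \<comment> \<open>As e - 1 \<le> 2, a threshold of 2 L + 1 leaves the exponent - k N; it is at
    most - n because \<open>D \<ge> 1\<close>.\<close>
  also have "\<dots> \<le> exp (real k * (2 * (L * N)) - 1 * ((2 * L + 1) * real k * N))"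
  proof -
    have "(exp 1 - 1) * (rate n d l * real (card A)) \<le> 2 * (L * N)"
      by (rule mult_mono) (use r exp_le rate_bounds(1)[OF n, of d l] in auto)
    then show ?thesis by (intro exp_le_cancel_iff[THEN iffD2] diff_right_mono mult_left_mono) (auto simp: mult.assoc)
  qed
  also have "\<dots> = exp (- (real k * N))" by (simp add: algebra_simps)
  also have "\<dots> \<le> exp (- real n)"
  proof -
    have "1 * real n \<le> real k * N" using k N by (intro mult_mono) auto
    then show ?thesis by simp
  qed
  finally show ?thesis by (simp only: A_def L_def N_def)
qed

text \<open>The parameter is x = n: every further copy containing \<tau> gains a factor 1/n, while
  the exponential moment stays bounded as the rate is of order 1/n. Of the q + d + 1 copies, d + 1
  pay for the choice of \<tau>. The multiplicity bound is independent of \<open>k\<close>; only the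
  factor in front depends on it.\<close>

lemma multiplicity_tail:
  assumes n: "n > 0" and law: "hypertree_law n d l p"
  shows "measure_pmf.prob (copies k p) {T. \<exists>\<tau>\<in>nsets {1..n} (d + 1). q + d + 1 \<le> hits k T {\<tau>}}
    \<le> exp (real k * (real d + 1 + real l)) / real n ^ q"
proof -
  define r where "r = q + d + 1"
  define b where "b = exp (real k * (real d + 1 + real l)) / real n ^ r"
  have each: "measure_pmf.prob (copies k p) {T. r \<le> hits k T {\<tau>}} \<le> b"
    if \<tau>: "\<tau> \<in> nsets {1..n} (d + 1)" for \<tau>
  proof -
    have "measure_pmf.prob (copies k p) {T. r \<le> hits k T {\<tau>}}
        \<le> measure_pmf.prob (copies k p) {T. ln (real n) * real r \<le> ln (real n) * real (hits k T {\<tau>})}"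
      using n by (intro measure_pmf.finite_measure_mono) (auto intro!: mult_left_mono)
    also have "\<dots> \<le> exp (real k * ((exp (ln (real n)) - 1) * rate n d l * real (card {\<tau>})) - ln (real n) * real r)"
      using \<tau> by (intro hits_chernoff[OF law]) auto
    also have "\<dots> = exp (real k * ((real n - 1) * rate n d l)) / real n ^ r"
      using n by (simp add: exp_diff mult.commute[of "ln (real n)"] exp_of_nat_mult)
    also have "\<dots> \<le> b"
    proof -
      have "(real n - 1) * rate n d l \<le> real n * rate n d l"
        using rate_bounds(1)[OF n] by (intro mult_right_mono) auto
      also have "\<dots> \<le> real d + 1 + real l" using rate_bounds(2)[OF n, of d l] by (simp add: mult.commute)
      finally show ?thesis unfolding b_def
        by (intro divide_right_mono exp_le_cancel_iff[THEN iffD2] mult_left_mono) auto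
    qed
    finally show ?thesis .
  qed
  have "{T. \<exists>\<tau>\<in>nsets {1..n} (d + 1). r \<le> hits k T {\<tau>}} \<subseteq> (\<Union>\<tau>\<in>nsets {1..n} (d + 1). {T. r \<le> hits k T {\<tau>}})"
    by blast
  from prob_UN_le[OF _ each this] have
    "measure_pmf.prob (copies k p) {T. \<exists>\<tau>\<in>nsets {1..n} (d + 1). r \<le> hits k T {\<tau>}}
      \<le> real (card (nsets {1..n} (d + 1))) * b" by simp
  also have "\<dots> \<le> real (n ^ (d + 1)) * b"
    by (intro mult_right_mono of_nat_mono card_nsets_interval_le) (simp add: b_def)
  also have "\<dots> = exp (real k * (real d + 1 + real l)) / real n ^ q"
    using n by (simp add: b_def r_def power_add field_simps)
  finally show ?thesis by (simp only: r_def)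
qed

section \<open>Expansion in links\<close>

lemma hits_empty [simp]: "hits k T {} = 0"
  by (simp add: hits_def)

lemma hits_star_codim_one:
  assumes law: "hypertree_law n d l p" and "n > d" and T: "T \<in> set_pmf (copies k p)"
    and \<rho>: "\<rho> \<in> nsets {1..n} d"
  shows "k \<le> hits k T (star \<rho> (nsets {1..n} (d + 1)))"
proof -
  have "1 \<le> card (T i \<inter> star \<rho> (nsets {1..n} (d + 1)))" if "i \<in> {1..k}" for i
  proof -
    have "T i \<inter> star \<rho> (nsets {1..n} (d + 1)) \<noteq> {}"
      by (rule hypertree_covers[OF law \<rho> \<open>n > d\<close> copies_component[OF T that]])
    then show ?thesis by (simp add: Suc_le_eq card_gt_0_iff)
  qed
  then have "(\<Sum>i\<in>{1..k}. 1) \<le> hits k T (star \<rho> (nsets {1..n} (d + 1)))"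
    unfolding hits_def by (rule sum_mono)
  then show ?thesis by simp
qed

text \<open>The base of the induction: the only nonempty candidate is \<open>{\<rho>}\<close>, whose
  coboundary is its whole star, with at least \<open>k\<close> hits.\<close>

lemma link_expands_codim_one:
  assumes \<rho>: "\<rho> \<in> nsets {1..n} (Suc e)"
    and h: "k \<le> hits k T (star \<rho> (nsets {1..n} (Suc e + 1)))"
  shows "link_expands k T n e 2 \<rho>"
  unfolding link_expands_def
proof (intro allI impI)
  fix S assume "link_minimal n e \<rho> S"
  then have S: "S \<subseteq> star \<rho> (nsets {1..n} (Suc e))" by (auto simp: link_minimal_def)
  have "S \<subseteq> {\<rho>}"
  proof
    fix \<sigma> assume "\<sigma> \<in> S"
    then have "\<sigma> \<in> nsets {1..n} (Suc e)" "\<rho> \<subseteq> \<sigma>" using S by blast+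
    from nsets_subset_eq[OF \<rho> this] show "\<sigma> \<in> {\<rho>}" by simp
  qed
  then consider "S = {}" | "S = {\<rho>}" by blast
  then show "real k * real (card S) + real (hits k T (touch n (Suc e) S))
      \<le> 2 * real (hits k T (cob n (Suc e) S))"
  proof cases
    case 1
    have "touch n (Suc e) {} = {}" by (simp add: touch_def)
    then show ?thesis by (simp add: 1)
  next
    case 2
    have "{\<sigma> \<in> {\<rho>}. \<sigma> \<subseteq> \<tau>} = (if \<rho> \<subseteq> \<tau> then {\<rho>} else {})" for \<tau> by auto
    then have "cob n (Suc e) S = star \<rho> (nsets {1..n} (Suc e + 1))"
      unfolding cob_def 2 by (simp only: Suc_eq_plus1) auto
    moreover have "touch n (Suc e) S = star \<rho> (nsets {1..n} (Suc e + 1))"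
      by (simp add: touch_def 2)
    ultimately show ?thesis using h 2 by simp
  qed
qed

lemma link_expands_mono:
  assumes "link_expands k T n e C \<rho>" "C \<le> C'"
  shows "link_expands k T n e C' \<rho>"
  unfolding link_expands_def
proof (intro allI impI)
  fix S assume "link_minimal n e \<rho> S"
  then have "real k * real (card S) + real (hits k T (touch n (Suc e) S))
      \<le> C * real (hits k T (cob n (Suc e) S))"
    using assms(1) by (simp add: link_expands_def)
  also have "\<dots> \<le> C' * real (hits k T (cob n (Suc e) S))"
    using assms(2) by (intro mult_right_mono) simp_all
  finally show "real k * real (card S) + real (hits k T (touch n (Suc e) S))
      \<le> C' * real (hits k T (cob n (Suc e) S))" .
qed

text \<open>For sparse \<open>S\<close> the bad faces cost at most \<open>k * card S / 2\<close>,
  hence at most half the left-hand side, and absorbing them doubles \<open>C\<close>. For dense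
  \<open>S\<close> the coboundary alone gives 8 W \<ge> k |S|, and the degree of \<rho> bounds the
  touched faces by L / \<mu> times k |S|.\<close>

lemma link_expands_step:
  assumes d: "Suc e = card \<rho> + D" and D: "D \<ge> 1" and n: "n > 0" and C: "C > 0" and \<mu>: "0 < \<mu>" "\<mu> < 1"
    and L: "L \<ge> 0"
    and IH: "\<And>\<pi>. \<rho> \<subset> \<pi> \<Longrightarrow> \<pi> \<subseteq> {1..n} \<Longrightarrow> card \<pi> \<le> Suc e \<Longrightarrow> link_expands k T n e C \<pi>"
    and small: "\<And>S. S \<subseteq> star \<rho> (nsets {1..n} (Suc e)) \<Longrightarrow> S \<noteq> {} \<Longrightarrow> real (card S) \<le> \<mu> * real n ^ D \<Longrightarrow>
      real (hits k T (bad n (Suc e) (scale n D S) \<rho> S)) \<le> 1 / (2 * C * 2 ^ (e + 2)) * real k * real (card S)"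
    and large: "\<And>S. link_minimal n e \<rho> S \<Longrightarrow> \<mu> * real n ^ D < real (card S) \<Longrightarrow>
      real k * real (card S) / 8 \<le> real (hits k T (cob n (Suc e) S))"
    and deg: "real (hits k T (star \<rho> (nsets {1..n} (Suc e + 1)))) \<le> L * real k * real n ^ D"
  shows "link_expands k T n e (max (2 * C) (8 + 8 * L / \<mu>)) \<rho>"
  unfolding link_expands_def
proof (intro allI impI)
  fix S assume min: "link_minimal n e \<rho> S"
  then have S: "S \<subseteq> star \<rho> (nsets {1..n} (Suc e))" by (auto simp: link_minimal_def)
  define m where "m = real (card S)"
  define Q where "Q = real k * m + real (hits k T (touch n (Suc e) S))"
  define W where "W = real (hits k T (cob n (Suc e) S))"
  have W: "W \<ge> 0" by (simp add: W_def)
  have "Q \<le> max (2 * C) (8 + 8 * L / \<mu>) * W"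
  proof (cases "S = {}")
    case True
    have "touch n (Suc e) {} = {}" by (simp add: touch_def)
    then have "Q = 0" by (simp add: True Q_def m_def)
    then show ?thesis using W C by (simp add: zero_le_mult_iff le_max_iff_disj)
  next
    case ne: False
    have m: "m > 0" using ne link_minimal_finite[OF min] by (simp add: m_def card_gt_0_iff)
    show ?thesis
    proof (cases "m \<le> \<mu> * real n ^ D")
      case True
      define t where "t = scale n D S"
      define B where "B = real (hits k T (bad n (Suc e) t \<rho> S))"
      have frac: "0 < m / real n ^ D" "m / real n ^ D < 1"
        using m n True \<mu> by (auto simp: divide_less_eq divide_le_eq)
          (use True \<mu> n in \<open>smt (verit) mult_less_cancel_right2 of_nat_0_less_iff zero_less_power\<close>)
      have t: "0 < t" "t < 1" using frac by (simp_all add: t_def scale_def m_def)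
      have "t ^ (2 ^ D) = m / real n ^ D" using frac by (simp add: t_def scale_def m_def)
      then have size: "real (card S) = t ^ (2 ^ (Suc e - card \<rho>)) * real n ^ (Suc e - card \<rho>)"
        using d n by (simp add: m_def)
      have "Q \<le> C * (W + 2 ^ (e + 2) * B)"
        unfolding Q_def W_def B_def m_def
        using C by (intro descent[OF min t n size IH]) simp_all
      also have "\<dots> = C * W + C * 2 ^ (e + 2) * B" by (simp add: algebra_simps)
      also have "\<dots> \<le> C * W + C * 2 ^ (e + 2) * (1 / (2 * C * 2 ^ (e + 2)) * real k * m)"
        using small[OF S ne] True C unfolding B_def t_def m_def
        by (intro add_left_mono mult_left_mono) simp_all
      also have "\<dots> = C * W + real k * m / 2" using C by simp
      also have "\<dots> \<le> C * W + Q / 2" by (simp add: Q_def)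
      finally have "Q \<le> 2 * C * W" by linarith
      also have "\<dots> \<le> max (2 * C) (8 + 8 * L / \<mu>) * W" using W by (intro mult_right_mono) simp_all
      finally show ?thesis .
    next
      case False
      then have big: "\<mu> * real n ^ D < m" by simp
      have km: "real k * m \<le> 8 * W" using large[OF min] big by (simp add: W_def m_def)
      have "touch n (Suc e) S \<subseteq> star \<rho> (nsets {1..n} (Suc e + 1))"
        using S by (auto simp: touch_def)
      then have "hits k T (touch n (Suc e) S) \<le> hits k T (star \<rho> (nsets {1..n} (Suc e + 1)))"
        by (rule hits_mono) simp
      then have "real (hits k T (touch n (Suc e) S)) \<le> L * real k * real n ^ D"
        using deg by linarith
      also have "\<dots> \<le> L * real k * (m / \<mu>)"
        using big \<mu> L by (intro mult_left_mono) (simp_all add: field_simps)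
      also have "\<dots> = L / \<mu> * (real k * m)" by simp
      also have "\<dots> \<le> L / \<mu> * (8 * W)" using km L \<mu> by (intro mult_left_mono) simp_all
      finally have "Q \<le> 8 * W + L / \<mu> * (8 * W)" using km by (simp add: Q_def)
      also have "\<dots> = (8 + 8 * L / \<mu>) * W" by (simp add: algebra_simps)
      also have "\<dots> \<le> max (2 * C) (8 + 8 * L / \<mu>) * W" using W by (intro mult_right_mono) simp_all
      finally show ?thesis .
    qed
  qed
  then show "real k * real (card S) + real (hits k T (touch n (Suc e) S))
      \<le> max (2 * C) (8 + 8 * L / \<mu>) * real (hits k T (cob n (Suc e) S))"
    by (simp only: Q_def W_def m_def)
qed

lemma prob_Un_le:
  assumes "E \<subseteq> A \<union> B" "measure_pmf.prob p A \<le> a" "measure_pmf.prob p B \<le> b"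
  shows "measure_pmf.prob p E \<le> a + b"
proof -
  have "measure_pmf.prob p E \<le> measure_pmf.prob p (A \<union> B)"
    using assms(1) by (intro measure_pmf.finite_measure_mono) simp_all
  also have "\<dots> \<le> measure_pmf.prob p A + measure_pmf.prob p B"
    by (intro measure_Un_le) simp_all
  finally show ?thesis using assms by linarith
qed

lemma links_expand_whp:
  "\<exists>C>0. \<exists>k0. \<forall>k\<ge>k0. \<exists>K\<ge>0. \<exists>n0. \<forall>n\<ge>n0. \<forall>p. hypertree_law n (Suc e) l p \<longrightarrow>
     measure_pmf.prob (copies k p) {T. \<exists>\<rho>\<subseteq>{1..n}. card \<rho> \<le> Suc e \<and> Suc e \<le> card \<rho> + D \<and>
       \<not> link_expands k T n e C \<rho>} \<le> K / real n ^ q"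
proof (induction D)
  case 0
  have "measure_pmf.prob (copies k p) {T. \<exists>\<rho>\<subseteq>{1..n}. card \<rho> \<le> Suc e \<and> Suc e \<le> card \<rho> + 0 \<and>
       \<not> link_expands k T n e 2 \<rho>} = 0" if n: "n \<ge> Suc (Suc e)" and law: "hypertree_law n (Suc e) l p" for k n p
  proof -
    have "link_expands k T n e 2 \<rho>"
      if T: "T \<in> set_pmf (copies k p)" and \<rho>: "\<rho> \<subseteq> {1..n}" "card \<rho> = Suc e" for T \<rho>
    proof -
      have \<rho>': "\<rho> \<in> nsets {1..n} (Suc e)" using \<rho> by (simp add: nsets_def finite_subset[OF \<rho>(1)])
      show ?thesis
        using n by (intro link_expands_codim_one[OF \<rho>'] hits_star_codim_one[OF law _ T \<rho>']) simp
    qed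
    then have "set_pmf (copies k p) \<inter> {T. \<exists>\<rho>\<subseteq>{1..n}. card \<rho> \<le> Suc e \<and> Suc e \<le> card \<rho> + 0 \<and>
       \<not> link_expands k T n e 2 \<rho>} = {}" by fastforce
    then show ?thesis by (simp add: measure_pmf_zero_iff)
  qed
  then show ?case
    by (intro exI[of _ 2] conjI exI[of _ 0] allI impI exI[of _ "Suc (Suc e)"]) simp_all
next
  case (Suc D)
  show ?case
  proof (cases "Suc e \<le> D")
    case True
    then have "Suc e \<le> c + Suc D \<longleftrightarrow> Suc e \<le> c + D" for c by simp
    then show ?thesis using Suc.IH by (simp only:)
  next
    case False
    define d where "d = Suc e"
    define j where "j = d - Suc D"
    have j: "d = j + Suc D" "j \<le> d" using False by (simp_all add: d_def j_def)
    obtain C k0 where C: "C > 0" and IH: "\<forall>k\<ge>k0. \<exists>K\<ge>0. \<exists>n0. \<forall>n\<ge>n0. \<forall>p. hypertree_law n (Suc e) l p \<longrightarrow>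
       measure_pmf.prob (copies k p) {T. \<exists>\<rho>\<subseteq>{1..n}. card \<rho> \<le> Suc e \<and> Suc e \<le> card \<rho> + D \<and>
       \<not> link_expands k T n e C \<rho>} \<le> K / real n ^ q" using Suc.IH by blast
    \<comment> \<open>Multiplied by the factor \<open>C * 2 ^ (e + 2)\<close> of
      \<open>descent\<close>, this is 1/2, the share of \<open>k * card S\<close> granted to the bad
      faces.\<close>
    define \<delta> where "\<delta> = 1 / (2 * C * 2 ^ (e + 2))"
    have \<delta>: "\<delta> > 0" using C by (simp add: \<delta>_def)
    \<comment> \<open>The exponent \<open>q + d\<close> leaves room for the union over at most n^d
      sets \<rho>.\<close>
    obtain \<mu> k1 where \<mu>: "0 < \<mu>" "\<mu> < 1" and small: "\<forall>k\<ge>k1. \<forall>n>0. \<forall>p. \<forall>\<rho>\<subseteq>{1..n}.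
        hypertree_law n d l p \<longrightarrow> d = card \<rho> + Suc D \<longrightarrow>
        measure_pmf.prob (copies k p) {T. \<exists>S. S \<subseteq> star \<rho> (nsets {1..n} d) \<and> S \<noteq> {} \<and>
          real (card S) \<le> \<mu> * real n ^ Suc D \<and>
          \<delta> * real k * real (card S) < real (hits k T (bad n d (scale n (Suc D) S) \<rho> S))} \<le> 1 / real n ^ (q + d)"
      using small_cochains_tail[OF \<delta>, of "Suc D" d l "q + d"] by auto
    obtain k2 :: nat where k2: "16 / \<mu> \<le> real k2" using real_arch_simple by blast
    define L where "L = 2 * (real d + 1 + real l) + 1"
    define C' where "C' = max (2 * C) (8 + 8 * L / \<mu>)"
    have L: "L \<ge> 0" by (simp add: L_def)
    have C': "C' > 0" "C \<le> C'" using C by (auto simp: C'_def)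
    have main: "\<exists>K\<ge>0. \<exists>n0. \<forall>n\<ge>n0. \<forall>p. hypertree_law n (Suc e) l p \<longrightarrow>
       measure_pmf.prob (copies k p) {T. \<exists>\<rho>\<subseteq>{1..n}. card \<rho> \<le> Suc e \<and> Suc e \<le> card \<rho> + Suc D \<and>
       \<not> link_expands k T n e C' \<rho>} \<le> K / real n ^ q"
      if k: "k \<ge> max (max k0 k1) (max k2 1)" for k
    proof -
      have ks: "k \<ge> k0" "k \<ge> k1" "k \<ge> k2" "k \<ge> 1" using k by simp_all
      then have k\<mu>: "16 / \<mu> \<le> real k" using k2 by linarith
      obtain K n0 where K: "K \<ge> 0" and prev: "\<forall>n\<ge>n0. \<forall>p. hypertree_law n (Suc e) l p \<longrightarrow>
         measure_pmf.prob (copies k p) {T. \<exists>\<rho>\<subseteq>{1..n}. card \<rho> \<le> Suc e \<and> Suc e \<le> card \<rho> + D \<and>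
         \<not> link_expands k T n e C \<rho>} \<le> K / real n ^ q" using IH ks(1) by blast
      define K' where "K' = (1 + 2 * fact (q + d) :: real)"
      have K': "K' \<ge> 0" by (simp add: K'_def)
      have "measure_pmf.prob (copies k p) {T. \<exists>\<rho>\<subseteq>{1..n}. card \<rho> \<le> Suc e \<and> Suc e \<le> card \<rho> + Suc D \<and>
          \<not> link_expands k T n e C' \<rho>} \<le> (K + K') / real n ^ q" (is "measure_pmf.prob _ ?E \<le> _")
        if n: "n \<ge> max n0 (2 * Suc e + l + 1)" and law: "hypertree_law n (Suc e) l p" for n p
      proof -
        have ns: "n \<ge> n0" "n > 0" "n \<ge> 2 * Suc e + l" using n by simp_all
        have law': "hypertree_law n d l p" using law by (simp add: d_def)
        define E0 where "E0 = {T. \<exists>\<rho>\<subseteq>{1..n}. card \<rho> \<le> Suc e \<and> Suc e \<le> card \<rho> + D \<and>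
         \<not> link_expands k T n e C \<rho>}"
        define EA where "EA \<rho> = {T. \<exists>S. S \<subseteq> star \<rho> (nsets {1..n} d) \<and> S \<noteq> {} \<and>
          real (card S) \<le> \<mu> * real n ^ Suc D \<and>
          \<delta> * real k * real (card S) < real (hits k T (bad n d (scale n (Suc D) S) \<rho> S))}" for \<rho>
        define EB where "EB \<rho> = {T. \<exists>S. link_minimal n e \<rho> S \<and> \<mu> * real n ^ Suc D < real (card S) \<and>
          real (hits k T (cob n (Suc e) S)) < real k * real (card S) / 8}" for \<rho>
        define EC where "EC \<rho> = {T. L * real k * real n ^ Suc D
          < real (hits k T (star \<rho> (nsets {1..n} (d + 1))))}" for \<rho>
        have P0: "measure_pmf.prob (copies k p) E0 \<le> K / real n ^ q"
          unfolding E0_def using prev ns(1) law by blast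
        have each: "measure_pmf.prob (copies k p) (EA \<rho> \<union> (EB \<rho> \<union> EC \<rho>)) \<le> K' / real n ^ (q + d)"
          if \<rho>: "\<rho> \<in> nsets {1..n} j" for \<rho>
        proof -
          have r: "\<rho> \<subseteq> {1..n}" "d = card \<rho> + Suc D" using \<rho> j by (simp_all add: nsets_def)
          have A: "measure_pmf.prob (copies k p) (EA \<rho>) \<le> 1 / real n ^ (q + d)"
            unfolding EA_def using small ks(2) ns(2) law' r by blast
          have e: "exp (- real n) \<le> fact (q + d) / real n ^ (q + d)"
            by (rule exp_neg_le_inverse_power[OF ns(2)])
          have B: "measure_pmf.prob (copies k p) (EB \<rho>) \<le> fact (q + d) / real n ^ (q + d)"
            using large_cochains_tail[OF \<mu>(1) _ k\<mu> ns(2,3) r(1) law, of "Suc D"] r(2) e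
            unfolding EB_def d_def by simp
          have C: "measure_pmf.prob (copies k p) (EC \<rho>) \<le> fact (q + d) / real n ^ (q + d)"
            using degree_tail[OF ks(4) ns(2) r(1) law' r(2)] e
            unfolding EC_def L_def by simp
          have BC: "measure_pmf.prob (copies k p) (EB \<rho> \<union> EC \<rho>)
              \<le> fact (q + d) / real n ^ (q + d) + fact (q + d) / real n ^ (q + d)"
            by (rule prob_Un_le[OF _ B C]) simp
          have "measure_pmf.prob (copies k p) (EA \<rho> \<union> (EB \<rho> \<union> EC \<rho>))
              \<le> 1 / real n ^ (q + d) + (fact (q + d) / real n ^ (q + d) + fact (q + d) / real n ^ (q + d))"
            by (rule prob_Un_le[OF _ A BC]) simp
          then show ?thesis by (simp add: K'_def add_divide_distrib)
        qed
        have "measure_pmf.prob (copies k p) (\<Union>\<rho>\<in>nsets {1..n} j. EA \<rho> \<union> (EB \<rho> \<union> EC \<rho>))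
            \<le> real (card (nsets {1..n} j)) * (K' / real n ^ (q + d))"
          by (rule prob_UN_le[OF _ each subset_refl]) simp_all
        also have "\<dots> \<le> real (n ^ d) * (K' / real n ^ (q + d))"
        proof (rule mult_right_mono[OF of_nat_mono])
          have "card (nsets {1..n} j) \<le> n ^ j" by (rule card_nsets_interval_le)
          also have "\<dots> \<le> n ^ d" using j(2) ns(2) by (intro power_increasing) simp_all
          finally show "card (nsets {1..n} j) \<le> n ^ d" .
        qed (use K' in simp)
        also have "\<dots> = K' / real n ^ q" using ns(2) by (simp add: power_add)
        finally have P1: "measure_pmf.prob (copies k p) (\<Union>\<rho>\<in>nsets {1..n} j. EA \<rho> \<union> (EB \<rho> \<union> EC \<rho>))
            \<le> K' / real n ^ q" .
        have cover: "?E \<subseteq> E0 \<union> (\<Union>\<rho>\<in>nsets {1..n} j. EA \<rho> \<union> (EB \<rho> \<union> EC \<rho>))"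
        proof (rule subsetI, rule ccontr)
          fix T assume TE: "T \<in> ?E" and out: "T \<notin> E0 \<union> (\<Union>\<rho>\<in>nsets {1..n} j. EA \<rho> \<union> (EB \<rho> \<union> EC \<rho>))"
          obtain \<rho> where \<rho>: "\<rho> \<subseteq> {1..n}" "card \<rho> \<le> Suc e" "Suc e \<le> card \<rho> + Suc D"
            "\<not> link_expands k T n e C' \<rho>" using TE by blast
          have old: "link_expands k T n e C \<pi>"
            if "\<pi> \<subseteq> {1..n}" "card \<pi> \<le> Suc e" "Suc e \<le> card \<pi> + D" for \<pi>
            using out that unfolding E0_def by blast
          show False
          proof (cases "Suc e \<le> card \<rho> + D")
            case True
            then show False using \<rho> old link_expands_mono[OF _ C'(2)] by blast
          next
            case False
            then have card\<rho>: "Suc e = card \<rho> + Suc D" using \<rho>(3) by simp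
            then have \<rho>j: "\<rho> \<in> nsets {1..n} j"
              using \<rho>(1) finite_subset[OF \<rho>(1)] by (simp add: nsets_def j_def d_def)
            then have nA: "T \<notin> EA \<rho>" and nB: "T \<notin> EB \<rho>" and nC: "T \<notin> EC \<rho>" using out by blast+
            have "link_expands k T n e C' \<rho>"
              unfolding C'_def
            proof (rule link_expands_step[OF card\<rho> _ ns(2) C \<mu> L])
              fix \<pi> assume \<pi>: "\<rho> \<subset> \<pi>" "\<pi> \<subseteq> {1..n}" "card \<pi> \<le> Suc e"
              have "card \<rho> < card \<pi>"
                using psubset_card_mono[OF finite_subset[OF \<pi>(2)] \<pi>(1)] by simp
              then show "link_expands k T n e C \<pi>" using old[OF \<pi>(2,3)] card\<rho> by simp
            next
              fix S assume "S \<subseteq> star \<rho> (nsets {1..n} (Suc e))" "S \<noteq> {}"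
                "real (card S) \<le> \<mu> * real n ^ Suc D"
              then have "\<not> \<delta> * real k * real (card S) < real (hits k T (bad n d (scale n (Suc D) S) \<rho> S))"
                using nA unfolding EA_def d_def by blast
              then show "real (hits k T (bad n (Suc e) (scale n (Suc D) S) \<rho> S))
                  \<le> 1 / (2 * C * 2 ^ (e + 2)) * real k * real (card S)"
                by (simp add: \<delta>_def d_def)
            next
              fix S assume "link_minimal n e \<rho> S" "\<mu> * real n ^ Suc D < real (card S)"
              then have "\<not> real (hits k T (cob n (Suc e) S)) < real k * real (card S) / 8"
                using nB unfolding EB_def by blast
              then show "real k * real (card S) / 8 \<le> real (hits k T (cob n (Suc e) S))" by simp
            next
              show "real (hits k T (star \<rho> (nsets {1..n} (Suc e + 1)))) \<le> L * real k * real n ^ Suc D"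
                using nC unfolding EC_def d_def by simp
            qed simp
            then show False using \<rho>(4) by simp
          qed
        qed
        have "measure_pmf.prob (copies k p) ?E \<le> K / real n ^ q + K' / real n ^ q"
          by (rule prob_Un_le[OF cover P0 P1])
        then show ?thesis by (simp add: add_divide_distrib)
      qed
      then show ?thesis
        using K K' by (intro exI[of _ "K + K'"] conjI exI[of _ "max n0 (2 * Suc e + l + 1)"] allI impI) simp_all
    qed
    show ?thesis
      by (rule exI[of _ C'], rule conjI[OF C'(1)], rule exI[of _ "max (max k0 k1) (max k2 1)"],
          intro allI impI, rule main)
  qed
qed

section \<open>Cochains as sets of faces\<close>

lemma odd_card_sym_diff:
  assumes "finite A" "finite B"
  shows "odd (card (sym_diff A B)) \<longleftrightarrow> odd (card A) \<noteq> odd (card B)"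
proof -
  have "card (sym_diff A B) = card (A - B) + card (B - A)"
    using assms by (intro card_Un_disjoint) auto
  moreover have "card A = card (A - B) + card (A \<inter> B)"
    using assms by (metis Int_Diff_Un Int_Diff_disjoint add.commute card_Un_disjoint finite_Diff finite_Int)
  moreover have "card B = card (B - A) + card (A \<inter> B)"
    using assms by (metis Int_Diff_Un Int_Diff_disjoint Int_commute add.commute card_Un_disjoint finite_Diff finite_Int)
  ultimately show ?thesis by auto
qed

lemma cob_sym_diff:
  assumes "finite A" "finite B"
  shows "cob n m (sym_diff A B) = sym_diff (cob n m A) (cob n m B)"
proof -
  have "odd (card {\<sigma> \<in> sym_diff A B. \<sigma> \<subseteq> \<tau>})
      \<longleftrightarrow> odd (card {\<sigma> \<in> A. \<sigma> \<subseteq> \<tau>}) \<noteq> odd (card {\<sigma> \<in> B. \<sigma> \<subseteq> \<tau>})" for \<tau>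
  proof -
    have "{\<sigma> \<in> sym_diff A B. \<sigma> \<subseteq> \<tau>} = sym_diff {\<sigma> \<in> A. \<sigma> \<subseteq> \<tau>} {\<sigma> \<in> B. \<sigma> \<subseteq> \<tau>}" by blast
    then show ?thesis using odd_card_sym_diff[of "{\<sigma> \<in> A. \<sigma> \<subseteq> \<tau>}" "{\<sigma> \<in> B. \<sigma> \<subseteq> \<tau>}"] assms by simp
  qed
  then show ?thesis unfolding cob_def by blast
qed

text \<open>An \<open>m\<close>-subset of \<tau> lies in exactly two (m+1)-subsets of \<tau>, so
  summing the parities over these gives an even number.\<close>

lemma cob_cob:
  assumes G: "G \<subseteq> nsets {1..n} m"
  shows "cob n (Suc m) (cob n m G) = {}"
proof -
  have "even (card {\<sigma> \<in> cob n m G. \<sigma> \<subseteq> \<tau>})" if \<tau>: "\<tau> \<in> nsets {1..n} (Suc (Suc m))" for \<tau>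
  proof -
    have t: "finite \<tau>" "card \<tau> = Suc (Suc m)" "\<tau> \<subseteq> {1..n}" using \<tau> by (auto simp: nsets_def)
    have fG: "finite {\<eta> \<in> G. \<eta> \<subseteq> \<tau>}" using finite_subset[OF G] by simp
    have "{\<sigma> \<in> cob n m G. \<sigma> \<subseteq> \<tau>} = {\<sigma> \<in> nsets \<tau> (Suc m). odd (card {\<eta> \<in> {\<eta> \<in> G. \<eta> \<subseteq> \<tau>}. \<eta> \<subseteq> \<sigma>})}"
    proof (intro equalityI subsetI)
      fix \<sigma> assume "\<sigma> \<in> {\<sigma> \<in> cob n m G. \<sigma> \<subseteq> \<tau>}"
      then have \<sigma>: "\<sigma> \<in> cob n m G" "\<sigma> \<subseteq> \<tau>" by simp_all
      have "{\<eta> \<in> {\<eta> \<in> G. \<eta> \<subseteq> \<tau>}. \<eta> \<subseteq> \<sigma>} = {\<eta> \<in> G. \<eta> \<subseteq> \<sigma>}" using \<sigma>(2) by blast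
      then show "\<sigma> \<in> {\<sigma> \<in> nsets \<tau> (Suc m). odd (card {\<eta> \<in> {\<eta> \<in> G. \<eta> \<subseteq> \<tau>}. \<eta> \<subseteq> \<sigma>})}"
        using \<sigma> by (simp add: cob_def nsets_def)
    next
      fix \<sigma> assume "\<sigma> \<in> {\<sigma> \<in> nsets \<tau> (Suc m). odd (card {\<eta> \<in> {\<eta> \<in> G. \<eta> \<subseteq> \<tau>}. \<eta> \<subseteq> \<sigma>})}"
      then have \<sigma>: "\<sigma> \<in> nsets \<tau> (Suc m)" "odd (card {\<eta> \<in> {\<eta> \<in> G. \<eta> \<subseteq> \<tau>}. \<eta> \<subseteq> \<sigma>})" by simp_all
      then have sub: "\<sigma> \<subseteq> \<tau>" by (simp add: nsets_def)
      have "{\<eta> \<in> {\<eta> \<in> G. \<eta> \<subseteq> \<tau>}. \<eta> \<subseteq> \<sigma>} = {\<eta> \<in> G. \<eta> \<subseteq> \<sigma>}" using sub by blast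
      moreover have "\<sigma> \<in> nsets {1..n} (Suc m)" using \<sigma>(1) t(3) nsets_mono by blast
      ultimately show "\<sigma> \<in> {\<sigma> \<in> cob n m G. \<sigma> \<subseteq> \<tau>}" using \<sigma>(2) sub by (simp add: cob_def)
    qed
    then have "even (card {\<sigma> \<in> cob n m G. \<sigma> \<subseteq> \<tau>})
        \<longleftrightarrow> even (\<Sum>\<sigma>\<in>nsets \<tau> (Suc m). card {\<eta> \<in> {\<eta> \<in> G. \<eta> \<subseteq> \<tau>}. \<eta> \<subseteq> \<sigma>})"
      using t(1) by (simp add: even_sum_iff)
    moreover have "(\<Sum>\<sigma>\<in>nsets \<tau> (Suc m). card {\<eta> \<in> {\<eta> \<in> G. \<eta> \<subseteq> \<tau>}. \<eta> \<subseteq> \<sigma>})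
        = (\<Sum>\<eta>\<in>{\<eta> \<in> G. \<eta> \<subseteq> \<tau>}. 2)"
    proof (rule sum_multicount_gen[OF _ fG])
      show "\<forall>\<eta>\<in>{\<eta> \<in> G. \<eta> \<subseteq> \<tau>}. card {\<sigma> \<in> nsets \<tau> (Suc m). \<eta> \<subseteq> \<sigma>} = 2"
      proof
        fix \<eta> assume \<eta>: "\<eta> \<in> {\<eta> \<in> G. \<eta> \<subseteq> \<tau>}"
        then have \<eta>m: "card \<eta> = m" "finite \<eta>" "\<eta> \<subseteq> \<tau>" using G by (auto simp: nsets_def)
        then have "\<eta> \<in> nsets \<tau> m" by (simp add: nsets_def)
        from star_of_codim_one[OF this]
        have "{\<sigma> \<in> nsets \<tau> (Suc m). \<eta> \<subseteq> \<sigma>} = (\<lambda>x. insert x \<eta>) ` (\<tau> - \<eta>)" by simp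
        moreover have "card ((\<lambda>x. insert x \<eta>) ` (\<tau> - \<eta>)) = card (\<tau> - \<eta>)"
          by (intro card_image inj_onI) blast
        moreover have "card (\<tau> - \<eta>) = 2" using \<eta>m t by (simp add: card_Diff_subset)
        ultimately show "card {\<sigma> \<in> nsets \<tau> (Suc m). \<eta> \<subseteq> \<sigma>} = 2" by simp
      qed
    qed (use t in simp)
    ultimately show ?thesis by simp
  qed
  then show ?thesis unfolding cob_def[of n "Suc m"] by blast
qed

section \<open>From bit-valued cochains to their supports\<close>

abbreviation supp :: "('a \<Rightarrow> bit) \<Rightarrow> 'a set" where
  "supp f \<equiv> {\<sigma>. f \<sigma> \<noteq> 0}"

lemma of_nat_bit_eq_0_iff: "(of_nat m :: bit) = 0 \<longleftrightarrow> even m"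
  by (induction m) auto

lemma supp_add: "supp (\<lambda>\<sigma>. f \<sigma> + g \<sigma>) = sym_diff (supp f) (supp g)"
proof -
  have "f \<sigma> + g \<sigma> \<noteq> 0 \<longleftrightarrow> (f \<sigma> \<noteq> 0) \<noteq> (g \<sigma> \<noteq> 0)" for \<sigma>
    by (cases "f \<sigma>"; cases "g \<sigma>") auto
  then show ?thesis by blast
qed

lemma supp_coboundary:
  assumes f: "f \<in> cochains K i" and K: "finite (faces K i)"
  shows "supp (coboundary K i f) = {\<tau> \<in> faces K (i + 1). odd (card {\<sigma> \<in> supp f. \<sigma> \<subseteq> \<tau>})}"
proof -
  have "(\<Sum>\<sigma> | \<sigma> \<in> faces K i \<and> \<sigma> \<subseteq> \<tau>. f \<sigma>) \<noteq> 0 \<longleftrightarrow> odd (card {\<sigma> \<in> supp f. \<sigma> \<subseteq> \<tau>})" for \<tau>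
  proof -
    have "(\<Sum>\<sigma> | \<sigma> \<in> faces K i \<and> \<sigma> \<subseteq> \<tau>. f \<sigma>) = (\<Sum>\<sigma> | \<sigma> \<in> supp f \<and> \<sigma> \<subseteq> \<tau>. f \<sigma>)"
      using f K by (intro sum.mono_neutral_right) (auto simp: cochains_def)
    also have "\<dots> = (\<Sum>\<sigma> | \<sigma> \<in> supp f \<and> \<sigma> \<subseteq> \<tau>. 1)"
      by (intro sum.cong refl) simp
    also have "\<dots> = of_nat (card {\<sigma> \<in> supp f. \<sigma> \<subseteq> \<tau>})" by simp
    finally show ?thesis by (simp only: of_nat_bit_eq_0_iff)
  qed
  then show ?thesis unfolding coboundary_def by auto
qed

lemma finite_cochains:
  assumes "finite (faces K i)"
  shows "finite (cochains K i)"
proof (rule finite_subset)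
  show "cochains K i \<subseteq> {f. \<forall>x. (x \<in> faces K i \<longrightarrow> f x \<in> {0, 1}) \<and> (x \<notin> faces K i \<longrightarrow> f x = 0)}"
    by (auto simp: cochains_def)
  show "finite {f. \<forall>x. (x \<in> faces K i \<longrightarrow> f x \<in> {0, 1 :: bit}) \<and> (x \<notin> faces K i \<longrightarrow> f x = 0)}"
    using assms by (rule finite_set_of_finite_funs) simp
qed

lemma supp_cochains:
  assumes "finite (faces K i)"
  shows "supp ` cochains K i = Pow (faces K i)"
proof (intro equalityI subsetI)
  fix S assume "S \<in> Pow (faces K i)"
  then have "(\<lambda>\<sigma>. of_bool (\<sigma> \<in> S)) \<in> cochains K i" by (auto simp: cochains_def)
  then have "supp (\<lambda>\<sigma>. of_bool (\<sigma> \<in> S)) \<in> supp ` cochains K i" by (rule imageI)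
  moreover have "supp (\<lambda>\<sigma>. of_bool (\<sigma> \<in> S)) = S" by auto
  ultimately show "S \<in> supp ` cochains K i" by (simp only:)
qed (auto simp: cochains_def)

section \<open>The complex with complete skeleton and top faces U\<close>

locale hypertree_complex =
  fixes n e :: nat and U :: "nat set set"
  assumes U: "U \<subseteq> nsets {1..n} (Suc (Suc e))"
begin

abbreviation K :: "nat set set" where
  "K \<equiv> skeleton_complex n (Suc e) U"

text \<open>Indexing by cardinality includes \<open>m = 0\<close>, the empty face of dimension -1,
  on which the coboundaries of degree 0 rest.\<close>

lemma faces_low:
  assumes "m \<le> Suc e"
  shows "faces K (int m - 1) = nsets {1..n} m"
proof (intro equalityI subsetI)
  fix \<sigma> assume "\<sigma> \<in> faces K (int m - 1)"
  then have "\<sigma> \<in> K" "finite \<sigma>" "card \<sigma> = m" by (simp_all add: faces_def)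
  moreover have "\<sigma> \<notin> U"
  proof
    assume "\<sigma> \<in> U"
    then have "card \<sigma> = Suc (Suc e)" using U by (auto simp: nsets_def)
    then show False using \<open>card \<sigma> = m\<close> assms by simp
  qed
  ultimately show "\<sigma> \<in> nsets {1..n} m" by (simp add: skeleton_complex_def nsets_def)
qed (use assms in \<open>simp add: faces_def skeleton_complex_def nsets_def\<close>)

lemma faces_top: "faces K (int (Suc e)) = U"
proof (intro equalityI subsetI)
  fix \<sigma> assume "\<sigma> \<in> U"
  then have "finite \<sigma>" "card \<sigma> = Suc (Suc e)" using U by (auto simp: nsets_def)
  then show "\<sigma> \<in> faces K (int (Suc e))" using \<open>\<sigma> \<in> U\<close> by (simp add: faces_def skeleton_complex_def)
qed (auto simp: faces_def skeleton_complex_def)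

lemma finite_U: "finite U"
  using U by (rule finite_subset) simp

text \<open>The faces of dimension \<open>m + 1\<close>. Only the layer for \<open>m = e\<close> is
  incomplete, so a coboundary in \<open>K\<close> is the complete one cut down to this set.\<close>

definition upper_faces :: "nat \<Rightarrow> nat set set" where
  "upper_faces m = (if m = e then U else nsets {1..n} (Suc (Suc m)))"

lemma faces_upper:
  assumes "m \<le> e"
  shows "faces K (int m + 1) = upper_faces m"
proof (cases "m = e")
  case True
  then show ?thesis using faces_top by (simp add: upper_faces_def add.commute)
next
  case False
  then show ?thesis using faces_low[of "Suc (Suc m)"] assms by (simp add: upper_faces_def add.commute)
qed

lemma upper_faces_subset: "upper_faces m \<subseteq> nsets {1..n} (Suc (Suc m))"
  using U by (auto simp: upper_faces_def)

lemma faces_middle: "m \<le> e \<Longrightarrow> faces K (int m) = nsets {1..n} (Suc m)"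
  using faces_low[of "Suc m"] by simp

lemma supp_coboundary_middle:
  assumes m: "m \<le> e" and f: "f \<in> cochains K (int m)"
  shows "supp (coboundary K (int m) f) = cob n (Suc m) (supp f) \<inter> upper_faces m"
proof -
  have "finite (faces K (int m))" using m by (simp add: faces_middle)
  from supp_coboundary[OF f this] show ?thesis
    unfolding faces_upper[OF m] cob_def using upper_faces_subset[of m] by blast
qed

text \<open>All layers involved are complete, so the coboundaries of degree at most \<open>e\<close>
  do not depend on \<open>U\<close>.\<close>

lemma supp_coboundaries:
  assumes m: "m \<le> e"
  shows "supp ` coboundaries K (int m) = cob n m ` Pow (nsets {1..n} m)"
proof -
  have low: "faces K (int m - 1) = nsets {1..n} m" using m by (intro faces_low) simp
  have fin: "finite (faces K (int m - 1))" by (simp add: low)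
  have "supp (coboundary K (int m - 1) g) = cob n m (supp g)" if "g \<in> cochains K (int m - 1)" for g
    using supp_coboundary[OF that fin] faces_middle[OF m] by (simp add: cob_def)
  then have "supp ` coboundaries K (int m) = cob n m ` (supp ` cochains K (int m - 1))"
    unfolding coboundaries_def image_image by (rule image_cong[OF refl])
  then show ?thesis by (simp only: supp_cochains[OF fin] low)
qed

lemma finite_coboundaries: "m \<le> e \<Longrightarrow> finite (coboundaries K (int m))"
  unfolding coboundaries_def by (intro finite_imageI finite_cochains) (simp add: faces_low)

lemma coboundaries_subset_cochains: "coboundaries K (int m) \<subseteq> cochains K (int m)"
  by (auto simp: coboundaries_def coboundary_def cochains_def)

text \<open>The representative minimises cardinality rather than norm. This is enough because the
  coset norm is at most the norm of any representative; the coboundary does not change since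
  \<open>cob\<close> squares to zero.\<close>

lemma minimal_representative:
  assumes m: "m \<le> e" and f: "f \<in> cochains K (int m)"
  obtains b where "b \<in> coboundaries K (int m)" "link_minimal n m {} (supp (\<lambda>\<sigma>. f \<sigma> + b \<sigma>))"
    "supp (coboundary K (int m) f) = cob n (Suc m) (supp (\<lambda>\<sigma>. f \<sigma> + b \<sigma>)) \<inter> upper_faces m"
proof -
  have Sf: "supp f \<subseteq> nsets {1..n} (Suc m)"
    using f faces_middle[OF m] by (auto simp: cochains_def)
  have fin: "finite (supp f)" using Sf by (rule finite_subset) simp
  let ?c = "\<lambda>G. card (sym_diff (supp f) (cob n m G))"
  let ?P = "Pow (nsets {1..n} m)"
  obtain G where G: "G \<in> ?P" and least: "\<And>G'. G' \<in> ?P \<Longrightarrow> ?c G \<le> ?c G'"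
  proof -
    have "finite ?P" "?P \<noteq> {}" by auto
    from arg_min_if_finite(1)[OF this] arg_min_least[OF this] show thesis by (rule that)
  qed
  have "cob n m G \<in> supp ` coboundaries K (int m)"
    unfolding supp_coboundaries[OF m] using G by (rule imageI)
  then obtain b where b: "cob n m G = supp b" "b \<in> coboundaries K (int m)" by (rule imageE)
  have S: "supp (\<lambda>\<sigma>. f \<sigma> + b \<sigma>) = sym_diff (supp f) (cob n m G)" by (simp only: supp_add b(1))
  have fG: "finite G'" if "G' \<subseteq> nsets {1..n} m" for G' using that by (rule finite_subset) simp
  have "link_minimal n m {} (sym_diff (supp f) (cob n m G))"
    unfolding link_minimal_def
  proof (intro conjI allI impI)
    show "sym_diff (supp f) (cob n m G) \<subseteq> {\<sigma> \<in> nsets {1..n} (Suc m). {} \<subseteq> \<sigma>}"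
      using Sf cob_subset[of n m G] by blast
  next
    fix G' assume "G' \<subseteq> {\<eta> \<in> nsets {1..n} m. {} \<subseteq> \<eta>}"
    then have G': "G' \<subseteq> nsets {1..n} m" by simp
    have "sym_diff (sym_diff (supp f) (cob n m G)) (cob n m G')
        = sym_diff (supp f) (sym_diff (cob n m G) (cob n m G'))" by blast
    also have "\<dots> = sym_diff (supp f) (cob n m (sym_diff G G'))"
      using G G' by (simp only: cob_sym_diff[OF fG fG] Pow_iff)
    finally have eq: "sym_diff (sym_diff (supp f) (cob n m G)) (cob n m G')
      = sym_diff (supp f) (cob n m (sym_diff G G'))" .
    have "sym_diff G G' \<in> ?P" using G G' by blast
    from least[OF this] show "?c G \<le> card (sym_diff (sym_diff (supp f) (cob n m G)) (cob n m G'))"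
      by (simp only: eq)
  qed
  moreover have "cob n (Suc m) (sym_diff (supp f) (cob n m G)) = cob n (Suc m) (supp f)"
  proof -
    have "cob n (Suc m) (cob n m G) = {}" using G by (intro cob_cob) simp
    then show ?thesis
      by (simp only: cob_sym_diff[OF fin finite_cob] Diff_empty empty_Diff Un_empty_right)
  qed
  ultimately show thesis
    using that[OF b(2)] supp_coboundary_middle[OF m f] by (simp only: S)
qed

lemma cochain_norm_eq:
  assumes "\<And>\<sigma>. \<sigma> \<in> supp f \<Longrightarrow> card \<sigma> = c"
  shows "cochain_norm K (Suc e) f
    = (\<Sum>\<sigma>\<in>supp f. real (card (star \<sigma> U))) / (real (Suc (Suc e) choose c) * real (card U))"
  unfolding cochain_norm_def face_weight_def faces_top sum_divide_distrib
  using assms by (intro sum.cong refl) simp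

lemma card_upper_faces: "\<tau> \<in> upper_faces m \<Longrightarrow> card \<tau> = Suc (Suc m)"
  using upper_faces_subset[of m] by (auto simp: nsets_def)

text \<open>\<open>Min\<close> says nothing about an empty set, so a cochain outside the
  coboundaries has to be exhibited. A single face works, as its coboundary in the complete complex
  is nonempty.\<close>

lemma cochains_not_coboundaries:
  assumes m: "m \<le> e" and n: "Suc e \<le> n" and cov: "\<And>\<sigma>. \<sigma> \<in> nsets {1..n} (Suc m) \<Longrightarrow> star \<sigma> U \<noteq> {}"
  shows "cochains K (int m) - coboundaries K (int m) \<noteq> {}"
proof
  assume "cochains K (int m) - coboundaries K (int m) = {}"
  then have sub: "cochains K (int m) \<subseteq> coboundaries K (int m)" by blast
  define \<sigma> where "\<sigma> = {1..Suc m}"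
  have \<sigma>: "\<sigma> \<in> nsets {1..n} (Suc m)" using m n by (auto simp: \<sigma>_def nsets_def)
  have fin: "finite (faces K (int m))" using m by (simp add: faces_middle)
  have "{\<sigma>} \<in> supp ` cochains K (int m)"
    using \<sigma> unfolding supp_cochains[OF fin] faces_middle[OF m] by simp
  then have "{\<sigma>} \<in> supp ` coboundaries K (int m)" using image_mono[OF sub] by (rule rev_subsetD)
  then obtain G where G: "{\<sigma>} = cob n m G" "G \<in> Pow (nsets {1..n} m)"
    unfolding supp_coboundaries[OF m] by (rule imageE)
  have empty: "cob n (Suc m) {\<sigma>} = {}" unfolding G(1) using G(2) by (intro cob_cob) simp
  obtain \<tau> where \<tau>: "\<tau> \<in> U" "\<sigma> \<subseteq> \<tau>" using cov[OF \<sigma>] by blast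
  then have t: "card \<tau> = Suc (Suc e)" "finite \<tau>" "\<tau> \<subseteq> {1..n}" using U by (auto simp: nsets_def)
  have "\<tau> \<noteq> \<sigma>" using t(1) \<sigma> m by (auto simp: nsets_def)
  then obtain x where x: "x \<in> \<tau>" "x \<notin> \<sigma>" using \<tau>(2) by blast
  have "insert x \<sigma> \<in> nsets {1..n} (Suc (Suc m))" using \<sigma> x t(3) by (auto simp: nsets_def)
  moreover have "{\<sigma>' \<in> {\<sigma>}. \<sigma>' \<subseteq> insert x \<sigma>} = {\<sigma>}" by auto
  ultimately have "insert x \<sigma> \<in> cob n (Suc m) {\<sigma>}" unfolding cob_def by simp
  then show False using empty by simp
qed

text \<open>The norms of a cochain and of its coboundary are normalised by different binomial
  coefficients, both between 1 and \<open>2 ^ (e + 2)\<close>; this accounts for the extra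
  factor.\<close>

lemma expansion_ge:
  assumes B: "B > 0" and n: "Suc e \<le> n"
    and cov: "\<And>m \<sigma>. m \<le> Suc e \<Longrightarrow> \<sigma> \<in> nsets {1..n} m \<Longrightarrow> star \<sigma> U \<noteq> {}"
    and exp: "\<And>m S. m \<le> e \<Longrightarrow> link_minimal n m {} S \<Longrightarrow> (\<Sum>\<sigma>\<in>S. real (card (star \<sigma> U)))
       \<le> B * (\<Sum>\<tau>\<in>cob n (Suc m) S \<inter> upper_faces m. real (card (star \<tau> U)))"
  shows "1 / (B * 2 ^ (e + 2)) \<le> coboundary_expansion K (Suc e)"
proof -
  define \<beta> where "\<beta> = 1 / (B * 2 ^ (e + 2))"
  have \<beta>: "\<beta> > 0" using B by (simp add: \<beta>_def)
  have "star {} U \<noteq> {}" by (rule cov[of 0]) (simp_all add: nsets_def)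
  then have cU: "card U > 0" using finite_U by (auto simp: card_gt_0_iff)
  have ratio: "\<beta> \<le> cochain_norm K (Suc e) (coboundary K (int m) f) / coset_norm K (Suc e) (int m) f"
    if m: "m \<le> e" and f: "f \<in> cochains K (int m)" "f \<notin> coboundaries K (int m)" for m f
  proof -
    have sub: "supp (\<lambda>\<sigma>. f \<sigma> + b \<sigma>) \<subseteq> nsets {1..n} (Suc m)" if "b \<in> coboundaries K (int m)" for b
    proof -
      have "b \<in> cochains K (int m)" using that coboundaries_subset_cochains by blast
      then have "supp f \<subseteq> nsets {1..n} (Suc m)" "supp b \<subseteq> nsets {1..n} (Suc m)"
        using f(1) by (auto simp: cochains_def faces_middle[OF m])
      then show ?thesis unfolding supp_add by blast
    qed
    let ?c1 = "Suc (Suc e) choose Suc m" and ?c2 = "Suc (Suc e) choose Suc (Suc m)"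
    have c1: "?c1 \<ge> 1" "?c2 \<ge> 1" using m by (simp_all add: Suc_le_eq zero_less_binomial_iff del: binomial_Suc_Suc)
    have c2: "?c2 \<le> 2 ^ (e + 2)"
    proof -
      have "?c2 \<le> 2 ^ Suc (Suc e)" by (rule binomial_le_pow2)
      then show ?thesis by simp
    qed
    have norm: "cochain_norm K (Suc e) (\<lambda>\<sigma>. f \<sigma> + b \<sigma>)
        = (\<Sum>\<sigma>\<in>supp (\<lambda>\<sigma>. f \<sigma> + b \<sigma>). real (card (star \<sigma> U))) / (real ?c1 * real (card U))"
      if "b \<in> coboundaries K (int m)" for b
      by (rule cochain_norm_eq) (use sub[OF that] in \<open>auto simp: nsets_def\<close>)
    have fin: "finite (coboundaries K (int m))" by (rule finite_coboundaries[OF m])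
    from minimal_representative[OF m f(1)] obtain b where b: "b \<in> coboundaries K (int m)"
      and min: "link_minimal n m {} (supp (\<lambda>\<sigma>. f \<sigma> + b \<sigma>))"
      and cobf: "supp (coboundary K (int m) f) = cob n (Suc m) (supp (\<lambda>\<sigma>. f \<sigma> + b \<sigma>)) \<inter> upper_faces m" .
    define X where "X = (\<Sum>\<tau>\<in>supp (coboundary K (int m) f). real (card (star \<tau> U)))"
    have X: "X \<ge> 0" by (simp add: X_def sum_nonneg)
    have cf: "cochain_norm K (Suc e) (coboundary K (int m) f) = X / (real ?c2 * real (card U))"
      unfolding X_def by (rule cochain_norm_eq) (use cobf card_upper_faces in auto)
    have "cochain_norm K (Suc e) (\<lambda>\<sigma>. f \<sigma> + b \<sigma>) \<le> B * X / (real ?c1 * real (card U))"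
      unfolding norm[OF b] using exp[OF m min] by (intro divide_right_mono) (simp_all only: X_def cobf, simp)
    also have "\<dots> \<le> B * X / real (card U)"
    proof (rule divide_left_mono)
      have "1 \<le> real ?c1" using c1(1) by linarith
      then show "real (card U) \<le> real ?c1 * real (card U)" by (simp add: mult_le_cancel_right1 del: binomial_Suc_Suc)
      show "0 < real ?c1 * real (card U) * real (card U)"
        using c1(1) cU m by (intro mult_pos_pos) (simp_all del: binomial_Suc_Suc)
    qed (use B X in simp)
    also have "\<dots> = (B * 2 ^ (e + 2)) * (X / (2 ^ (e + 2) * real (card U)))" by simp
    also have "\<dots> \<le> (B * 2 ^ (e + 2)) * (X / (real ?c2 * real (card U)))"
    proof (intro mult_left_mono divide_left_mono mult_right_mono)
      have "real ?c2 \<le> real (2 ^ (e + 2))" using c2 by (rule of_nat_mono)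
      then show "real ?c2 \<le> 2 ^ (e + 2)" by simp
      show "0 < 2 ^ (e + 2) * real (card U) * (real ?c2 * real (card U))"
        using c1(2) cU m by (intro mult_pos_pos) (simp_all del: binomial_Suc_Suc)
    qed (use B X in simp_all)
    finally have upper: "cochain_norm K (Suc e) (\<lambda>\<sigma>. f \<sigma> + b \<sigma>)
        \<le> (B * 2 ^ (e + 2)) * cochain_norm K (Suc e) (coboundary K (int m) f)" by (simp only: cf)
    have "coset_norm K (Suc e) (int m) f \<le> cochain_norm K (Suc e) (\<lambda>\<sigma>. f \<sigma> + b \<sigma>)"
      unfolding coset_norm_def using fin b by (intro Min_le) simp_all
    also note upper
    finally have le: "\<beta> * coset_norm K (Suc e) (int m) f \<le> cochain_norm K (Suc e) (coboundary K (int m) f)"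
      using B by (simp add: \<beta>_def field_simps)
    \<comment> \<open>The coset norm must be positive, as a quotient by 0 would be 0. It is attained
      at some nonzero \<open>f + b'\<close>, and by \<open>cov\<close> every face has positive
      weight.\<close>
    have "coset_norm K (Suc e) (int m) f
        \<in> (\<lambda>b. cochain_norm K (Suc e) (\<lambda>\<sigma>. f \<sigma> + b \<sigma>)) ` coboundaries K (int m)"
      unfolding coset_norm_def using fin b by (intro Min_in) auto
    then obtain b' where b': "coset_norm K (Suc e) (int m) f = cochain_norm K (Suc e) (\<lambda>\<sigma>. f \<sigma> + b' \<sigma>)"
      "b' \<in> coboundaries K (int m)" by (rule imageE)
    have "f \<noteq> b'" using f(2) b'(2) by blast
    then obtain \<sigma> where "f \<sigma> \<noteq> b' \<sigma>" by (auto simp: fun_eq_iff)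
    then have \<sigma>: "\<sigma> \<in> supp (\<lambda>\<sigma>. f \<sigma> + b' \<sigma>)" by (cases "f \<sigma>"; cases "b' \<sigma>") auto
    have fs: "finite (supp (\<lambda>\<sigma>. f \<sigma> + b' \<sigma>))" using sub[OF b'(2)] by (rule finite_subset) simp
    have "0 < (\<Sum>\<sigma>\<in>supp (\<lambda>\<sigma>. f \<sigma> + b' \<sigma>). real (card (star \<sigma> U)))"
    proof (rule sum_pos2[OF fs \<sigma>])
      have "\<sigma> \<in> nsets {1..n} (Suc m)" using sub[OF b'(2)] \<sigma> by blast
      from cov[OF _ this] have "star \<sigma> U \<noteq> {}" using m by simp
      then have "card (star \<sigma> U) > 0" using finite_U by (simp only: card_gt_0_iff) simp
      then show "0 < real (card (star \<sigma> U))" by simp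
    qed simp
    then have "coset_norm K (Suc e) (int m) f > 0"
      unfolding b'(1) norm[OF b'(2)] using cU c1 by (intro divide_pos_pos mult_pos_pos) simp_all
    then show ?thesis using le by (simp add: pos_le_divide_eq)
  qed
  have at: "\<beta> \<le> expansion_at K (Suc e) i" if "i \<in> {0..int (Suc e) - 1}" for i
  proof -
    define m where "m = nat i"
    have i: "i = int m" and m: "m \<le> e" using that by (simp_all add: m_def nat_le_iff)
    show ?thesis
      unfolding expansion_at_def i
    proof (rule Min.boundedI)
      have "finite (faces K (int m))" using m by (simp add: faces_middle)
      then show "finite ((\<lambda>f. cochain_norm K (Suc e) (coboundary K (int m) f) / coset_norm K (Suc e) (int m) f) `
          (cochains K (int m) - coboundaries K (int m)))" using finite_cochains by blast
      show "(\<lambda>f. cochain_norm K (Suc e) (coboundary K (int m) f) / coset_norm K (Suc e) (int m) f) `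
          (cochains K (int m) - coboundaries K (int m)) \<noteq> {}"
        using cochains_not_coboundaries[OF m n cov[of "Suc m"]] m by simp
    qed (use ratio[OF m] in blast)
  qed
  then show ?thesis
    unfolding coboundary_expansion_def \<beta>_def[symmetric] by (intro Min.boundedI) auto
qed

end

section \<open>Expansion of the union\<close>

lemma card_star_nsets_ge:
  assumes \<pi>: "\<pi> \<subseteq> {1..n}" and b: "card \<pi> \<le> d" and n: "2 * d \<le> n" "n > 0"
  shows "real n ^ (d - card \<pi>) \<le> (2 * real d) ^ (d - card \<pi>) * real (card (star \<pi> (nsets {1..n} d)))"
proof (cases "d - card \<pi> = 0")
  case True
  then have "card \<pi> = d" using b by simp
  then have "star \<pi> (nsets {1..n} d) \<noteq> {}" using \<pi> finite_subset[OF \<pi>] by (auto simp: nsets_def)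
  then have "card (star \<pi> (nsets {1..n} d)) > 0" by (simp add: card_gt_0_iff)
  then show ?thesis using True by simp
next
  case False
  define b where "b = card \<pi>"
  have bd: "b < d" using False by (simp add: b_def)
  have f: "finite \<pi>" using \<pi> by (rule finite_subset) simp
  have "real n ^ (d - b) = (2 * real d) ^ (d - b) * (real n / (2 * real d)) ^ (d - b)"
    using bd by (simp add: power_divide)
  also have "\<dots> \<le> (2 * real d) ^ (d - b) * (real (n - b) / real (d - b)) ^ (d - b)"
  proof (intro mult_left_mono power_mono)
    have "real n * real (d - b) \<le> real (n - b) * (2 * real d)"
    proof -
      have "n * (d - b) \<le> n * d" by simp
      also have "\<dots> \<le> (n - b) * (2 * d)"
      proof -
        have "n \<le> 2 * (n - b)" using bd n by linarith
        then have "n * d \<le> 2 * (n - b) * d" by (rule mult_le_mono1)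
        then show ?thesis by (simp add: mult_ac)
      qed
      finally have "real (n * (d - b)) \<le> real ((n - b) * (2 * d))" by (rule of_nat_mono)
      then show ?thesis by simp
    qed
    then show "real n / (2 * real d) \<le> real (n - b) / real (d - b)"
      using bd by (simp add: divide_simps mult.commute)
  qed simp_all
  also have "\<dots> \<le> (2 * real d) ^ (d - b) * real ((n - b) choose (d - b))"
    using bd n by (intro mult_left_mono binomial_ge_n_over_k_pow_k) simp_all
  also have "\<dots> \<le> (2 * real d) ^ (d - b) * real (card (star \<pi> (nsets {1..n} d)))"
  proof (intro mult_left_mono of_nat_mono)
    have "(n - b) choose (d - b) = card (nsets ({1..n} - \<pi>) (d - b))"
      using \<pi> f by (simp add: card_nsets card_Diff_subset b_def)
    also have "\<dots> \<le> card (star \<pi> (nsets {1..n} d))"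
    proof (rule card_inj_on_le)
      show "inj_on (\<lambda>\<eta>. \<eta> \<union> \<pi>) (nsets ({1..n} - \<pi>) (d - b))"
        by (rule inj_onI) (auto simp: nsets_def)
      show "(\<lambda>\<eta>. \<eta> \<union> \<pi>) ` nsets ({1..n} - \<pi>) (d - b) \<subseteq> star \<pi> (nsets {1..n} d)"
      proof (rule image_subsetI)
        fix \<eta> assume "\<eta> \<in> nsets ({1..n} - \<pi>) (d - b)"
        then have \<eta>: "\<eta> \<subseteq> {1..n}" "\<eta> \<inter> \<pi> = {}" "finite \<eta>" "card \<eta> = d - b" by (auto simp: nsets_def)
        then have "card (\<eta> \<union> \<pi>) = d" using f bd by (simp add: card_Un_disjoint b_def)
        then show "\<eta> \<union> \<pi> \<in> star \<pi> (nsets {1..n} d)" using \<eta> \<pi> f by (simp add: nsets_def)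
      qed
    qed simp
    finally show "(n - b) choose (d - b) \<le> card (star \<pi> (nsets {1..n} d))" .
  qed simp
  finally show ?thesis by (simp only: b_def)
qed

text \<open>A lower degree bound without any tail estimate: each \<open>d\<close>-set containing
  \<pi> brings \<open>k\<close> hits, and a face is counted at most 2^(d+1) times.\<close>

lemma hits_star_ge:
  assumes \<pi>: "\<pi> \<subseteq> {1..n}" and b: "card \<pi> \<le> d" and n: "2 * d \<le> n" "n > 0"
    and deg: "\<And>\<rho>. \<rho> \<in> nsets {1..n} d \<Longrightarrow> k \<le> hits k T (star \<rho> (nsets {1..n} (d + 1)))"
  shows "real k * real n ^ (d - card \<pi>)
     \<le> (2 * real d) ^ d * 2 ^ (d + 1) * real (hits k T (star \<pi> (nsets {1..n} (d + 1))))"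
proof -
  let ?P = "star \<pi> (nsets {1..n} d)" and ?N = "nsets {1..n} (d + 1)"
  define H where "H = hits k T (star \<pi> ?N)"
  have one: "(\<Sum>\<rho>\<in>?P. card (T i \<inter> star \<rho> ?N)) \<le> 2 ^ (d + 1) * card (T i \<inter> star \<pi> ?N)" for i
  proof -
    have eq: "T i \<inter> star \<rho> ?N = star \<rho> (T i \<inter> ?N)" for \<rho> by blast
    show ?thesis
      unfolding eq by (rule sum_card_star_le) (auto simp: nsets_def)
  qed
  have "k * card ?P = (\<Sum>\<rho>\<in>?P. k)" by simp
  also have "\<dots> \<le> (\<Sum>\<rho>\<in>?P. hits k T (star \<rho> ?N))" by (intro sum_mono deg) simp
  also have "\<dots> = (\<Sum>i\<in>{1..k}. \<Sum>\<rho>\<in>?P. card (T i \<inter> star \<rho> ?N))"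
    unfolding hits_def by (rule sum.swap)
  also have "\<dots> \<le> (\<Sum>i\<in>{1..k}. 2 ^ (d + 1) * card (T i \<inter> star \<pi> ?N))" by (intro sum_mono one)
  also have "\<dots> = 2 ^ (d + 1) * H" by (simp only: H_def hits_def sum_distrib_left)
  finally have "real (k * card ?P) \<le> real (2 ^ (d + 1) * H)" by (rule of_nat_mono)
  then have kP: "real k * real (card ?P) \<le> 2 ^ (d + 1) * real H" by simp
  have "real k * real n ^ (d - card \<pi>) \<le> real k * ((2 * real d) ^ (d - card \<pi>) * real (card ?P))"
    by (intro mult_left_mono card_star_nsets_ge[OF \<pi> b n]) simp
  also have "\<dots> \<le> real k * ((2 * real d) ^ d * real (card ?P))"
  proof (cases "d = 0")
    case False
    then show ?thesis by (intro mult_left_mono mult_right_mono power_increasing) simp_all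
  qed simp
  also have "\<dots> = (2 * real d) ^ d * (real k * real (card ?P))" by simp
  also have "\<dots> \<le> (2 * real d) ^ d * (2 ^ (d + 1) * real H)" using kP by (intro mult_left_mono) simp_all
  finally show ?thesis by (simp add: H_def mult.assoc)
qed

lemma card_le_hits:
  assumes "finite A"
  shows "card ((\<Union>i\<in>{1..k}. T i) \<inter> A) \<le> hits k T A"
proof -
  have "card ((\<Union>i\<in>{1..k}. T i) \<inter> A) \<le> (\<Sum>i\<in>{1..k}. card (T i \<inter> A))"
    using assms by (intro card_le_sum_image) auto
  then show ?thesis by (simp only: hits_def)
qed

lemma hits_le_multiplicity:
  assumes A: "finite A" and mult: "\<And>\<tau>. \<tau> \<in> A \<Longrightarrow> hits k T {\<tau>} \<le> r"
  shows "hits k T A \<le> r * card ((\<Union>i\<in>{1..k}. T i) \<inter> A)"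
proof -
  let ?X = "(\<Union>i\<in>{1..k}. T i) \<inter> A"
  have fX: "finite ?X" using A by simp
  have "T i \<inter> A = T i \<inter> ?X" if "i \<in> {1..k}" for i using that by blast
  then have "hits k T A = hits k T ?X" unfolding hits_def by (intro sum.cong refl) (simp only:)
  also have "\<dots> \<le> (\<Sum>\<tau>\<in>?X. hits k T {\<tau>})" using fX by (intro hits_cover) auto
  also have "\<dots> \<le> (\<Sum>\<tau>\<in>?X. r)" using mult by (intro sum_mono) simp
  finally show ?thesis by (simp add: mult.commute)
qed

text \<open>The two summands of \<open>B\<close> belong to the degree \<open>e\<close> and to the
  lower degrees. In both cases \<open>k\<close> cancels, and passing from W to the union costs only
  the multiplicity \<open>r\<close>.\<close>

lemma union_expansion_ge:
  fixes e k r :: nat and C L :: real and T :: "nat \<Rightarrow> nat set set"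
  defines "U \<equiv> (\<Union>i\<in>{1..k}. T i)"
  defines "B \<equiv> 2 ^ (e + 2) * C * real r
      + L * real r * real (e + 2) * (2 * real (Suc e)) ^ Suc e * 2 ^ (e + 2)"
  assumes n: "n \<ge> 2 * Suc e" and k: "k \<ge> 1" and C: "C > 0" and L: "L > 0" and r: "r \<ge> 1"
    and T: "\<And>i. i \<in> {1..k} \<Longrightarrow> T i \<subseteq> nsets {1..n} (Suc (Suc e))"
    and link: "link_expands k T n e C {}"
    and mult: "\<And>\<tau>. \<tau> \<in> nsets {1..n} (Suc (Suc e)) \<Longrightarrow> hits k T {\<tau>} \<le> r"
    and cover: "\<And>\<rho>. \<rho> \<in> nsets {1..n} (Suc e) \<Longrightarrow> k \<le> hits k T (star \<rho> (nsets {1..n} (Suc (Suc e))))"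
    and deg: "\<And>\<rho>. \<rho> \<subseteq> {1..n} \<Longrightarrow> card \<rho> \<le> e \<Longrightarrow>
      real (hits k T (star \<rho> (nsets {1..n} (Suc (Suc e))))) \<le> L * real k * real n ^ (Suc e - card \<rho>)"
  shows "1 / (B * 2 ^ (e + 2)) \<le> coboundary_expansion (skeleton_complex n (Suc e) U) (Suc e)"
proof -
  let ?N = "nsets {1..n} (Suc (Suc e))"
  have n0: "n > 0" using n by simp
  interpret hypertree_complex n e U
    by unfold_locales (unfold U_def, rule UN_least, rule T)
  define c where "c = (2 * real (Suc e)) ^ Suc e * 2 ^ (e + 2)"
  have c: "c > 0" by (simp add: c_def)
  have Bpos: "B > 0" using C L r by (simp add: B_def add_pos_pos)
  have starU: "star \<sigma> U = U \<inter> star \<sigma> ?N" for \<sigma> using U by blast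
  have up: "real (card (star \<sigma> U)) \<le> real (hits k T (star \<sigma> ?N))" for \<sigma>
    unfolding starU unfolding U_def by (intro of_nat_mono card_le_hits) simp
  have down: "real (hits k T A) \<le> real r * real (card (U \<inter> A))" if "A \<subseteq> ?N" for A
  proof -
    have "finite A" using that by (rule finite_subset) simp
    then have "hits k T A \<le> r * card (U \<inter> A)"
      unfolding U_def using that mult by (intro hits_le_multiplicity) blast+
    then have "real (hits k T A) \<le> real (r * card (U \<inter> A))" by (rule of_nat_mono)
    then show ?thesis by simp
  qed
  have low: "real k * real n ^ (Suc e - card \<pi>) \<le> c * real r * real (card (star \<pi> U))"
    if "\<pi> \<subseteq> {1..n}" "card \<pi> \<le> Suc e" for \<pi>
  proof -
    have "real k * real n ^ (Suc e - card \<pi>) \<le> c * real (hits k T (star \<pi> ?N))"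
      using hits_star_ge[OF that n n0, of k T] cover by (simp add: c_def)
    also have "\<dots> \<le> c * (real r * real (card (star \<pi> U)))"
      unfolding starU using c by (intro mult_left_mono down) auto
    finally show ?thesis by (simp only: mult.assoc)
  qed
  show ?thesis
  proof (rule expansion_ge[OF Bpos])
    show "Suc e \<le> n" using n by simp
  next
    fix m \<sigma> assume m: "m \<le> Suc e" and "\<sigma> \<in> nsets {1..n} m"
    then have "\<sigma> \<subseteq> {1..n}" "card \<sigma> \<le> Suc e" by (auto simp: nsets_def)
    from low[OF this] have "0 < c * real r * real (card (star \<sigma> U))"
      using k n0 by (smt (verit) mult_pos_pos of_nat_0_less_iff zero_less_power less_eq_Suc_le One_nat_def)
    then have "card (star \<sigma> U) \<noteq> 0" by (intro notI) simp
    then show "star \<sigma> U \<noteq> {}" by (metis card.empty)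
  next
    fix m S assume m: "m \<le> e" and min: "link_minimal n m {} S"
    have S: "S \<subseteq> nsets {1..n} (Suc m)" using min by (auto simp: link_minimal_def)
    have fS: "finite S" by (rule link_minimal_finite[OF min])
    define Y where "Y = (\<Sum>\<tau>\<in>cob n (Suc m) S \<inter> upper_faces m. real (card (star \<tau> U)))"
    have Y: "Y \<ge> 0" by (simp add: Y_def sum_nonneg)
    show "(\<Sum>\<sigma>\<in>S. real (card (star \<sigma> U))) \<le> B * Y"
    proof (cases "m = e")
      case True
      \<comment> \<open>In degree \<open>e\<close> the link of the empty set is used: counting pairs
        bounds the weight of \<open>S\<close> by the touched faces of \<open>U\<close>.\<close>
      have "(\<Sum>\<sigma>\<in>S. card (star \<sigma> U)) = (\<Sum>\<tau>\<in>U. card {\<sigma> \<in> S. \<sigma> \<subseteq> \<tau>})"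
        using fS finite_U by (intro sum_multicount_gen) auto
      also have "\<dots> = (\<Sum>\<tau>\<in>U \<inter> touch n (Suc e) S. card {\<sigma> \<in> S. \<sigma> \<subseteq> \<tau>})"
      proof (rule sum.mono_neutral_right[OF finite_U])
        show "\<forall>\<tau>\<in>U - U \<inter> touch n (Suc e) S. card {\<sigma> \<in> S. \<sigma> \<subseteq> \<tau>} = 0"
        proof
          fix \<tau> assume "\<tau> \<in> U - U \<inter> touch n (Suc e) S"
          then have "\<tau> \<in> ?N" "\<tau> \<notin> touch n (Suc e) S" using U by auto
          then have "{\<sigma> \<in> S. \<sigma> \<subseteq> \<tau>} = {}" by (auto simp: touch_def)
          then show "card {\<sigma> \<in> S. \<sigma> \<subseteq> \<tau>} = 0" by (simp only: card.empty)
        qed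
      qed simp
      also have "\<dots> \<le> (\<Sum>\<tau>\<in>U \<inter> touch n (Suc e) S. 2 ^ (e + 2))"
      proof (rule sum_mono)
        fix \<tau> assume "\<tau> \<in> U \<inter> touch n (Suc e) S"
        then have t: "finite \<tau>" "card \<tau> = e + 2" by (auto simp: touch_def nsets_def)
        then have "card {\<sigma> \<in> S. \<sigma> \<subseteq> \<tau>} \<le> card (Pow \<tau>)" by (intro card_mono) auto
        then show "card {\<sigma> \<in> S. \<sigma> \<subseteq> \<tau>} \<le> 2 ^ (e + 2)" using t by (simp add: card_Pow)
      qed
      also have "\<dots> = 2 ^ (e + 2) * card (U \<inter> touch n (Suc e) S)" by simp
      also have "\<dots> \<le> 2 ^ (e + 2) * hits k T (touch n (Suc e) S)"
        unfolding U_def by (intro mult_left_mono card_le_hits) (simp_all add: touch_def)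
      finally have "real (\<Sum>\<sigma>\<in>S. card (star \<sigma> U)) \<le> real (2 ^ (e + 2) * hits k T (touch n (Suc e) S))"
        by (rule of_nat_mono)
      then have "(\<Sum>\<sigma>\<in>S. real (card (star \<sigma> U))) \<le> 2 ^ (e + 2) * real (hits k T (touch n (Suc e) S))" by simp
      also have "\<dots> \<le> 2 ^ (e + 2) * (C * real (hits k T (cob n (Suc e) S)))"
      proof (rule mult_left_mono)
        have "real k * real (card S) + real (hits k T (touch n (Suc e) S)) \<le> C * real (hits k T (cob n (Suc e) S))"
          using link min True unfolding link_expands_def by blast
        moreover have "0 \<le> real k * real (card S)" by simp
        ultimately show "real (hits k T (touch n (Suc e) S)) \<le> C * real (hits k T (cob n (Suc e) S))" by linarith
      qed simp
      also have "\<dots> \<le> 2 ^ (e + 2) * (C * (real r * real (card (U \<inter> cob n (Suc e) S))))"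
        using C by (intro mult_left_mono down cob_subset) simp_all
      also have "real (card (U \<inter> cob n (Suc e) S)) = Y"
      proof -
        have "card (star \<tau> U) = 1" if "\<tau> \<in> U" for \<tau>
        proof -
          have "star \<tau> U = {\<tau>}"
          proof (intro equalityI subsetI)
            fix \<tau>' assume "\<tau>' \<in> star \<tau> U"
            then have "\<tau>' \<in> ?N" "\<tau> \<subseteq> \<tau>'" using U by blast+
            moreover have "\<tau> \<in> ?N" using that U by blast
            ultimately have "\<tau> = \<tau>'" by (intro nsets_subset_eq)
            then show "\<tau>' \<in> {\<tau>}" by simp
          qed (use that in simp)
          then show ?thesis by simp
        qed
        then have "Y = (\<Sum>\<tau>\<in>cob n (Suc m) S \<inter> upper_faces m. 1)"
          unfolding Y_def by (intro sum.cong refl) (simp add: True upper_faces_def)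
        then show ?thesis by (simp add: True upper_faces_def Int_commute)
      qed
      also have "2 ^ (e + 2) * (C * (real r * Y)) = (2 ^ (e + 2) * C * real r) * Y" by simp
      also have "\<dots> \<le> B * Y" using Y L c by (intro mult_right_mono) (simp_all add: B_def)
      finally show ?thesis .
    next
      case False
      then have me: "Suc m \<le> e" using m by simp
      \<comment> \<open>Below degree \<open>e\<close> the coboundary loses no faces. The cone
        inequality gains a factor n / (e + 2), which offsets the drop of the degrees from order k
        n^(e-m) to order k n^(e-m-1).\<close>
      have "(\<Sum>\<sigma>\<in>S. real (card (star \<sigma> U))) \<le> (\<Sum>\<sigma>\<in>S. L * real k * real n ^ (e - m))"
      proof (rule sum_mono)
        fix \<sigma> assume "\<sigma> \<in> S"
        then have s: "\<sigma> \<subseteq> {1..n}" "card \<sigma> = Suc m" using S by (auto simp: nsets_def)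
        have "real (card (star \<sigma> U)) \<le> real (hits k T (star \<sigma> ?N))" by (rule up)
        also have "\<dots> \<le> L * real k * real n ^ (e - m)" using deg[OF s(1)] s(2) me by simp
        finally show "real (card (star \<sigma> U)) \<le> L * real k * real n ^ (e - m)" .
      qed
      also have "\<dots> = L * real k * real n ^ (e - Suc m) * (real n * real (card S))"
      proof -
        have "e - m = Suc (e - Suc m)" using me by simp
        then show ?thesis by (simp add: mult_ac)
      qed
      also have "\<dots> \<le> L * real k * real n ^ (e - Suc m) * (real (e + 2) * real (card (cob n (Suc m) S)))"
      proof (rule mult_left_mono)
        have "n * card S \<le> Suc (Suc m) * card (cob n (Suc m) S)"
          using link_expansion_complete[OF min] by simp
        also have "\<dots> \<le> (e + 2) * card (cob n (Suc m) S)" using me by (intro mult_le_mono1) simp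
        finally have "real (n * card S) \<le> real ((e + 2) * card (cob n (Suc m) S))" by (rule of_nat_mono)
        then show "real n * real (card S) \<le> real (e + 2) * real (card (cob n (Suc m) S))" by (simp only: of_nat_mult)
      qed (use L in simp)
      also have "\<dots> = L * real (e + 2) * (\<Sum>\<tau>\<in>cob n (Suc m) S. real k * real n ^ (e - Suc m))" by simp
      also have "\<dots> \<le> L * real (e + 2) * (\<Sum>\<tau>\<in>cob n (Suc m) S. c * real r * real (card (star \<tau> U)))"
      proof (intro mult_left_mono sum_mono)
        fix \<tau> assume "\<tau> \<in> cob n (Suc m) S"
        then have "\<tau> \<subseteq> {1..n}" "card \<tau> = Suc (Suc m)" using cob_subset[of n "Suc m" S] by (auto simp: nsets_def)
        then show "real k * real n ^ (e - Suc m) \<le> c * real r * real (card (star \<tau> U))"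
          using low[of \<tau>] me by simp
      qed (use L in simp)
      also have "\<dots> = (L * real r * real (e + 2) * c) * (\<Sum>\<tau>\<in>cob n (Suc m) S. real (card (star \<tau> U)))"
        by (simp only: sum_distrib_left[symmetric] mult_ac)
      also have "(\<Sum>\<tau>\<in>cob n (Suc m) S. real (card (star \<tau> U))) = Y"
      proof -
        have "cob n (Suc m) S \<inter> upper_faces m = cob n (Suc m) S"
          using cob_subset[of n "Suc m" S] False by (auto simp: upper_faces_def)
        then show ?thesis by (simp only: Y_def)
      qed
      also have "(L * real r * real (e + 2) * c) * Y \<le> B * Y"
        using Y C by (intro mult_right_mono) (simp_all add: B_def c_def)
      finally show ?thesis .
    qed
  qed
qed

section \<open>Collecting the exceptional events\<close>

lemma degrees_tail:
  assumes k: "k \<ge> 1" and n: "n > 0" and law: "hypertree_law n (Suc e) l p"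
  shows "measure_pmf.prob (copies k p) {T. \<exists>\<rho>\<subseteq>{1..n}. card \<rho> \<le> e \<and>
      (2 * (real (Suc e) + 1 + real l) + 1) * real k * real n ^ (Suc e - card \<rho>)
        < real (hits k T (star \<rho> (nsets {1..n} (Suc e + 1))))}
    \<le> real (Suc e) * fact (q + e) / real n ^ q" (is "measure_pmf.prob _ ?E \<le> _")
proof -
  define I where "I = (\<Union>j\<in>{..e}. nsets {1..n} j)"
  define F where "F \<rho> = {T. (2 * (real (Suc e) + 1 + real l) + 1) * real k * real n ^ (Suc e - card \<rho>)
        < real (hits k T (star \<rho> (nsets {1..n} (Suc e + 1))))}" for \<rho>
  have I: "finite I" by (simp add: I_def)
  have each: "measure_pmf.prob (copies k p) (F \<rho>) \<le> fact (q + e) / real n ^ (q + e)" if "\<rho> \<in> I" for \<rho>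
  proof -
    have \<rho>: "\<rho> \<subseteq> {1..n}" "card \<rho> \<le> e" using that by (auto simp: I_def nsets_def)
    have "measure_pmf.prob (copies k p) (F \<rho>) \<le> exp (- real n)"
      unfolding F_def using \<rho>(2) by (intro degree_tail[OF k n \<rho>(1) law]) simp_all
    also have "\<dots> \<le> fact (q + e) / real n ^ (q + e)" by (rule exp_neg_le_inverse_power[OF n])
    finally show ?thesis .
  qed
  have "?E \<subseteq> (\<Union>\<rho>\<in>I. F \<rho>)"
  proof
    fix T assume "T \<in> ?E"
    then obtain \<rho> where \<rho>: "\<rho> \<subseteq> {1..n}" "card \<rho> \<le> e" "T \<in> F \<rho>" by (auto simp: F_def)
    then have "\<rho> \<in> I" using finite_subset[OF \<rho>(1)] by (simp add: I_def nsets_def)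
    then show "T \<in> (\<Union>\<rho>\<in>I. F \<rho>)" using \<rho>(3) by blast
  qed
  from prob_UN_le[OF I each this]
  have "measure_pmf.prob (copies k p) ?E \<le> real (card I) * (fact (q + e) / real n ^ (q + e))" .
  also have "\<dots> \<le> real (Suc e * n ^ e) * (fact (q + e) / real n ^ (q + e))"
  proof (intro mult_right_mono of_nat_mono)
    have "card I \<le> (\<Sum>j\<in>{..e}. card (nsets {1..n} j))" unfolding I_def by (rule card_UN_le) simp
    also have "\<dots> \<le> (\<Sum>j\<in>{..e}. n ^ e)"
    proof (rule sum_mono)
      fix j assume "j \<in> {..e}"
      then have "n ^ j \<le> n ^ e" using n by (intro power_increasing) simp_all
      then show "card (nsets {1..n} j) \<le> n ^ e" using card_nsets_interval_le[of n j] by simp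
    qed
    finally show "card I \<le> Suc e * n ^ e" by simp
  qed simp
  also have "\<dots> = real (Suc e) * fact (q + e) / real n ^ q"
    using n by (simp only: power_add of_nat_mult of_nat_power) (simp add: field_simps)
  finally show ?thesis .
qed

theorem theorem21:
  fixes d l :: nat and s :: real
  assumes "d \<ge> 1" and "s > 0"
  shows "\<exists>\<beta>>0. \<exists>k0::nat. \<forall>k\<ge>k0. \<forall>p :: nat \<Rightarrow> nat set set pmf.
    (\<forall>n>l. hypertree_law n d l (p n)) \<longrightarrow>
    (\<lambda>n. measure_pmf.prob (Pi_pmf {1..k} {} (\<lambda>_. p n))
        {T. coboundary_expansion (skeleton_complex n d (\<Union>i\<in>{1..k}. T i)) d < \<beta>})
      \<in> O(\<lambda>n. real n powr (- s))"
proof -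
  obtain e where d: "d = Suc e" using assms(1) by (cases d) simp_all
  define q where "q = nat \<lceil>s\<rceil>"
  have q: "s \<le> real q" unfolding q_def by linarith
  obtain C k0 where C: "C > 0" and whp: "\<forall>k\<ge>k0. \<exists>K\<ge>0. \<exists>n0. \<forall>n\<ge>n0. \<forall>p. hypertree_law n (Suc e) l p \<longrightarrow>
     measure_pmf.prob (copies k p) {T. \<exists>\<rho>\<subseteq>{1..n}. card \<rho> \<le> Suc e \<and> Suc e \<le> card \<rho> + Suc e \<and>
       \<not> link_expands k T n e C \<rho>} \<le> K / real n ^ q"
    using links_expand_whp[of e l "Suc e" q] by blast
  \<comment> \<open>The multiplicity bound; through it the decay exponent enters \<beta>
    explicitly.\<close>
  define r where "r = q + Suc e + 1"
  define L where "L = 2 * (real (Suc e) + 1 + real l) + 1"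
  define B where "B = 2 ^ (e + 2) * C * real r
      + L * real r * real (e + 2) * (2 * real (Suc e)) ^ Suc e * 2 ^ (e + 2)"
  define \<beta> where "\<beta> = 1 / (B * 2 ^ (e + 2))"
  have L: "L > 0" by (simp add: L_def add_pos_nonneg)
  have r: "r \<ge> 1" by (simp add: r_def)
  have "B > 0" using C L r by (simp add: B_def add_pos_pos)
  then have \<beta>: "\<beta> > 0" by (simp add: \<beta>_def)
  have "(\<lambda>n. measure_pmf.prob (copies k (p n))
        {T. coboundary_expansion (skeleton_complex n d (\<Union>i\<in>{1..k}. T i)) d < \<beta>})
      \<in> O(\<lambda>n. real n powr (- s))"
    if k: "k \<ge> max k0 1" and law: "\<forall>n>l. hypertree_law n d l (p n)" for k p
  proof -
    have k1: "k \<ge> k0" "k \<ge> 1" using k by simp_all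
    obtain K n0 where K: "K \<ge> 0" and prob1: "\<forall>n\<ge>n0. \<forall>p. hypertree_law n (Suc e) l p \<longrightarrow>
      measure_pmf.prob (copies k p) {T. \<exists>\<rho>\<subseteq>{1..n}. card \<rho> \<le> Suc e \<and> Suc e \<le> card \<rho> + Suc e \<and>
       \<not> link_expands k T n e C \<rho>} \<le> K / real n ^ q"
      using whp k1(1) by blast
    define K2 where "K2 = exp (real k * (real (Suc e) + 1 + real l))"
    define K3 where "K3 = (real (Suc e) * fact (q + e) :: real)"
    have bound: "measure_pmf.prob (copies k (p n))
        {T. coboundary_expansion (skeleton_complex n d (\<Union>i\<in>{1..k}. T i)) d < \<beta>}
        \<le> (K + (K2 + K3)) * real n powr (- s)" (is "measure_pmf.prob _ ?E \<le> _")
      if n: "n \<ge> max n0 (l + 2 * Suc e)" for n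
    proof -
      have ns: "n \<ge> n0" "n > l" "n > 0" "n \<ge> 2 * Suc e" "n > Suc e" using n by simp_all
      have lw: "hypertree_law n (Suc e) l (p n)" using law ns(2) by (simp add: d)
      define E1 where "E1 = {T. \<exists>\<rho>\<subseteq>{1..n}. card \<rho> \<le> Suc e \<and> Suc e \<le> card \<rho> + Suc e \<and>
       \<not> link_expands k T n e C \<rho>}"
      define E2 where "E2 = {T. \<exists>\<tau>\<in>nsets {1..n} (Suc e + 1). q + Suc e + 1 \<le> hits k T {\<tau>}}"
      define E3 where "E3 = {T. \<exists>\<rho>\<subseteq>{1..n}. card \<rho> \<le> e \<and>
        (2 * (real (Suc e) + 1 + real l) + 1) * real k * real n ^ (Suc e - card \<rho>)
        < real (hits k T (star \<rho> (nsets {1..n} (Suc e + 1))))}"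
      have P1: "measure_pmf.prob (copies k (p n)) E1 \<le> K / real n ^ q"
        unfolding E1_def using prob1 ns(1) lw by blast
      have P2: "measure_pmf.prob (copies k (p n)) E2 \<le> K2 / real n ^ q"
        unfolding E2_def K2_def by (rule multiplicity_tail[OF ns(3) lw])
      have P3: "measure_pmf.prob (copies k (p n)) E3 \<le> K3 / real n ^ q"
        unfolding E3_def K3_def by (rule degrees_tail[OF k1(2) ns(3) lw])
      have P23: "measure_pmf.prob (copies k (p n)) (E2 \<union> E3) \<le> K2 / real n ^ q + K3 / real n ^ q"
        by (rule prob_Un_le[OF subset_refl P2 P3])
      \<comment> \<open>Restricting to the support matters: that the copies consist of
        \<open>d\<close>-faces and cover every \<open>d\<close>-set holds only there.\<close>
      have cover: "?E \<inter> set_pmf (copies k (p n)) \<subseteq> E1 \<union> (E2 \<union> E3)"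
      proof (rule subsetI, rule ccontr)
        fix T assume TE: "T \<in> ?E \<inter> set_pmf (copies k (p n))" and out: "T \<notin> E1 \<union> (E2 \<union> E3)"
        then have Tset: "T \<in> set_pmf (copies k (p n))" and n1: "T \<notin> E1" and n2: "T \<notin> E2" and n3: "T \<notin> E3"
          by simp_all
        have "1 / (B * 2 ^ (e + 2))
            \<le> coboundary_expansion (skeleton_complex n (Suc e) (\<Union>i\<in>{1..k}. T i)) (Suc e)"
          unfolding B_def
        proof (rule union_expansion_ge[OF ns(4) k1(2) C L r])
          fix i assume "i \<in> {1..k}"
          then have "T i \<in> set_pmf (p n)" by (rule copies_component[OF Tset])
          then show "T i \<subseteq> nsets {1..n} (Suc (Suc e))"
            using lw by (auto simp: hypertree_law_def determinantal_law_def)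
        next
          show "link_expands k T n e C {}"
          proof (rule ccontr)
            assume "\<not> link_expands k T n e C {}"
            then have "T \<in> E1" unfolding E1_def by (intro CollectI exI[of _ "{}"]) simp
            then show False using n1 by simp
          qed
        next
          fix \<tau> assume "\<tau> \<in> nsets {1..n} (Suc (Suc e))"
          then have "\<not> q + Suc e + 1 \<le> hits k T {\<tau>}" using n2 unfolding E2_def by simp
          then show "hits k T {\<tau>} \<le> r" by (simp add: r_def)
        next
          fix \<rho> assume "\<rho> \<in> nsets {1..n} (Suc e)"
          from hits_star_codim_one[OF lw ns(5) Tset this]
          show "k \<le> hits k T (star \<rho> (nsets {1..n} (Suc (Suc e))))" by simp
        next
          fix \<rho> assume \<rho>: "\<rho> \<subseteq> {1..n}" "card \<rho> \<le> e"
          show "real (hits k T (star \<rho> (nsets {1..n} (Suc (Suc e))))) \<le> L * real k * real n ^ (Suc e - card \<rho>)"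
          proof (rule ccontr)
            assume "\<not> ?thesis"
            then have "T \<in> E3" unfolding E3_def using \<rho> by (intro CollectI exI[of _ \<rho>]) (simp add: L_def)
            then show False using n3 by simp
          qed
        qed
        then show False using TE by (simp add: \<beta>_def d)
      qed
      have "measure_pmf.prob (copies k (p n)) ?E
          = measure_pmf.prob (copies k (p n)) (?E \<inter> set_pmf (copies k (p n)))"
        by (rule measure_Int_set_pmf[symmetric])
      also have "\<dots> \<le> K / real n ^ q + (K2 / real n ^ q + K3 / real n ^ q)"
        by (rule prob_Un_le[OF cover P1 P23])
      also have "\<dots> = (K + (K2 + K3)) * (1 / real n ^ q)" by (simp add: add_divide_distrib)
      also have "\<dots> \<le> (K + (K2 + K3)) * real n powr (- s)"
      proof (rule mult_left_mono)
        have "1 / real n ^ q = real n powr (- real q)"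
          using ns(3) by (simp add: powr_minus powr_realpow divide_inverse)
        also have "\<dots> \<le> real n powr (- s)" using ns(3) q by (intro powr_mono) simp_all
        finally show "1 / real n ^ q \<le> real n powr (- s)" .
      qed (use K in \<open>simp add: K2_def K3_def\<close>)
      finally show ?thesis .
    qed
    show ?thesis
    proof (rule bigoI[of _ "K + (K2 + K3)"])
      show "\<forall>\<^sub>F n in sequentially. norm (measure_pmf.prob (copies k (p n))
          {T. coboundary_expansion (skeleton_complex n d (\<Union>i\<in>{1..k}. T i)) d < \<beta>})
          \<le> (K + (K2 + K3)) * norm (real n powr (- s))"
        using eventually_ge_at_top[of "max n0 (l + 2 * Suc e)"]
      proof eventually_elim
        case (elim n)
        then show ?case using bound[of n] by simp
      qed
    qed
  qed
  then show ?thesis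
    using \<beta> unfolding copies_def by (intro exI[of _ \<beta>] conjI exI[of _ "max k0 1"] allI impI) 
qed

end
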